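(* Let $H\subset\mathbb{P}^2(\mathbb{C})$ be an $f$-invariant Herman ring for a rational map $f$, and let $\Gamma_h\subset H$ be the invariant circle $\Im(t)=h$, where $t$ is the canonical parameter on $H$. If the transverse Lyapunov exponent $\mathrm{Lyap}(t)$ is negative along $\Gamma_h$, then a neighborhood of $\Gamma_h$ in the Herman ring $H$ is uniformly attracting, and hence is contained in the Fatou set of $f$. On the other hand, if $\mathrm{Lyap}(t)$ is positive along $\Gamma_h$, then $\Gamma_h$ is contained in the Julia set of $f$.
   Context: A rational map of $\mathbb{P}^2(\mathbb{C})$ is given by three homogeneous polynomials of the same degree $d\ge2$ without common factor. An $f$-invariant Herman ring is a complex one-dimensional annulus $H$, smoothly (holomorphically) embedded in $\mathbb{P}^2(\mathbb{C})$, which $f$ maps to itself by an irrational rotation. A canonical parameter is a conformal isomorphism $t$ from $H$ onto a cylinder $h_0<\Im(t)<h_1$ in $\mathbb{C}/\mathbb{Z}$, in which $f|_H$ is $t\mapsto t+\alpha$ with $\alpha$ irrational. Near any circle $\Gamma_h=\{\Im(t)=h\}$, a neighborhood in $\mathbb{P}^2(\mathbb{C})$ has holomorphic coordinates $(t,u)$, with $u$ near $0\in\mathbb{C}$ and $t$ near the circle $\Im(t)=h$ in $\mathbb{C}/\mathbb{Z}$, such that $u=0$ on $H$ and $t|_H$ is the canonical parameter. In these coordinates $f$ has the form $(t,u)\mapsto(T,U)$, with $(t,0)\mapsto(t+\alpha,0)$. The transverse Lyapunov exponent (constant on each circle $\Im(t)=h$) is $$\mathrm{Lyap}(t)=\int_0^1\log\left|\frac{\partial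 U}{\partial u}(t+\tau,0)\right|d\tau\ \in[-\infty,\infty).$$ A neighborhood $H_0$ of $\Gamma_h$ in $H$ is uniformly attracting if there are a neighborhood $V$ of $H_0$ in $\mathbb{P}^2(\mathbb{C})$, an integer $n\ge1$ and a constant $c<1$ such that $|u_n|\le c\,|u_0|$ for every $(t_0,u_0)\in V$, where $(t_n,u_n)=f^{\circ n}(t_0,u_0)$ in the holomorphic coordinates $(t,u)$ on a neighborhood of $\Gamma_h$ in $\mathbb{P}^2(\mathbb{C})$. The Fatou set is the union of all open sets on which the iterates of $f$ form a normal family; the Julia set is its complement in $\mathbb{P}^2(\mathbb{C})$. *)

theory Defs
  imports "HOL-Analysis.Analysis" "HOL-Library.Poly_Mapping"
begin

section \<open>The complex projective plane\<close>

definition proj_rel :: "complex^3 \<Rightarrow> complex^3 \<Rightarrow> bool" where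
  "proj_rel v w \<longleftrightarrow> v \<noteq> 0 \<and> w \<noteq> 0 \<and> (\<exists>c. c \<noteq> 0 \<and> w = c *s v)"

lemma part_equivp_proj_rel: "part_equivp proj_rel"
proof (rule part_equivpI)
  show "\<exists>x. proj_rel x x"
    by (rule exI[of _ "axis 1 1"]) (auto simp: proj_rel_def axis_eq_0_iff intro!: exI[of _ 1])
  show "symp proj_rel"
  proof (rule sympI)
    fix v w assume "proj_rel v w"
    then obtain c where c: "v \<noteq> 0" "w \<noteq> 0" "c \<noteq> 0" "w = c *s v" by (auto simp: proj_rel_def)
    have "inverse c *s w = v"
      unfolding c(4) using c(3) by (simp add: vector_smult_assoc)
    then have "v = inverse c *s w" ..
    moreover have "inverse c \<noteq> 0" using c(3) by simp
    ultimately show "proj_rel w v"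
      unfolding proj_rel_def using c(1,2) by blast
  qed
  show "transp proj_rel"
  proof (rule transpI)
    fix u v w assume "proj_rel u v" "proj_rel v w"
    then obtain c d where *: "u \<noteq> 0" "w \<noteq> 0" "c \<noteq> 0" "d \<noteq> 0" and "v = c *s u" "w = d *s v"
      unfolding proj_rel_def by blast
    then have "w = (d * c) *s u" by (simp add: vector_smult_assoc)
    moreover have "d * c \<noteq> 0" using * by simp
    ultimately show "proj_rel u w"
      unfolding proj_rel_def using * by blast
  qed
qed

text \<open>Below, \<open>abs_cp2 v\<close> is the point with homogeneous coordinates \<open>v\<close> (for \<open>v \<noteq> 0\<close>), and
  \<open>rep_cp2 p\<close> is some choice of homogeneous coordinates of \<open>p\<close>.\<close>

quotient_type cp2 = "complex^3" / partial: proj_rel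
  by (rule part_equivp_proj_rel)

text \<open>The matrix of the orthogonal projector of \<open>\<complex>\<^sup>3\<close> onto the line spanned by \<open>v\<close>; it depends
  only on the line. The plane is metrized by the Frobenius distance of projectors, which is
  \<open>\<surd>2\<close> times the sine of the Fubini--Study angle; \<open>open_cp2_iff\<close> below shows that its topology
  is the quotient topology.\<close>

definition line_projector :: "complex^3 \<Rightarrow> complex^3^3" where
  "line_projector v = (\<chi> i j. v $ i * cnj (v $ j) / of_real ((norm v)\<^sup>2))"

lemma norm_smult_complex3: "norm (c *s (v :: complex^3)) = cmod c * norm v"
  by (simp add: norm_vec_def L2_set_right_distrib norm_mult)

lemma line_projector_smult:
  assumes "c \<noteq> 0"
  shows "line_projector (c *s v) = line_projector v"
proof -
  have "(c * x) * cnj (c * y) / of_real ((norm (c *s v))\<^sup>2) = x * cnj y / of_real ((norm v)\<^sup>2)" for x y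
  proof -
    have "of_real ((norm (c *s v))\<^sup>2) = (c * cnj c) * of_real ((norm v)\<^sup>2)"
      by (simp add: norm_smult_complex3 power_mult_distrib complex_norm_square [symmetric])
    then show ?thesis using assms by simp
  qed
  then show ?thesis by (simp add: line_projector_def vec_eq_iff)
qed

lemma sum_sq_cmod3: "(\<Sum>j\<in>UNIV. cnj (v $ j) * v $ j) = of_real ((norm (v :: complex^3))\<^sup>2)"
proof -
  have "(norm v)\<^sup>2 = (\<Sum>j\<in>UNIV. (cmod (v $ j))\<^sup>2)"
    by (simp add: norm_vec_def L2_set_def sum_nonneg)
  then show ?thesis
    by (simp only: of_real_sum complex_norm_square mult.commute)
qed

lemma line_projector_mult:
  "line_projector v *v w = ((\<Sum>j\<in>UNIV. cnj (v $ j) * w $ j) / of_real ((norm v)\<^sup>2)) *s v"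
  by (simp add: line_projector_def matrix_vector_mult_def vec_eq_iff sum_distrib_left
      sum_distrib_right sum_divide_distrib mult_ac)

lemma line_projector_self: "v \<noteq> 0 \<Longrightarrow> line_projector v *v v = v"
  by (simp add: line_projector_mult sum_sq_cmod3)

lemma rep_cp2_nonzero [simp]: "rep_cp2 p \<noteq> 0"
  using Quotient3_rep_reflp[OF Quotient3_cp2, of p] by (simp add: proj_rel_def)

lemma abs_rep_cp2 [simp]: "abs_cp2 (rep_cp2 p) = p"
  by (rule Quotient3_abs_rep[OF Quotient3_cp2])

lemma abs_cp2_eq_iff:
  "v \<noteq> 0 \<Longrightarrow> w \<noteq> 0 \<Longrightarrow> abs_cp2 v = abs_cp2 w \<longleftrightarrow> (\<exists>c. c \<noteq> 0 \<and> w = c *s v)"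
proof -
  assume nz: "v \<noteq> 0" "w \<noteq> 0"
  have "proj_rel x x" if "x \<noteq> 0" for x
    unfolding proj_rel_def using that by (intro conjI exI[of _ 1]) auto
  then have "abs_cp2 v = abs_cp2 w \<longleftrightarrow> proj_rel v w"
    using Quotient3_rel[OF Quotient3_cp2, of v w] nz by blast
  then show ?thesis unfolding proj_rel_def using nz by blast
qed

lemma abs_cp2_smult: "c \<noteq> 0 \<Longrightarrow> v \<noteq> 0 \<Longrightarrow> abs_cp2 (c *s v) = abs_cp2 v"
  by (subst eq_commute, subst abs_cp2_eq_iff) auto

lemma rep_abs_cp2: "v \<noteq> 0 \<Longrightarrow> \<exists>c. c \<noteq> 0 \<and> rep_cp2 (abs_cp2 v) = c *s v"
  using abs_cp2_eq_iff[of v "rep_cp2 (abs_cp2 v)"] by simp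

lemma line_projector_rep_abs: "v \<noteq> 0 \<Longrightarrow> line_projector (rep_cp2 (abs_cp2 v)) = line_projector v"
  using rep_abs_cp2[of v] by (auto simp: line_projector_smult)

lemma line_projector_rep_inj:
  assumes "line_projector (rep_cp2 p) = line_projector (rep_cp2 q)"
  shows "p = q"
proof -
  let ?v = "rep_cp2 p" and ?w = "rep_cp2 q"
  have "line_projector ?w *v ?v = ?v"
    using line_projector_self[of ?v] assms by simp
  then obtain c where c: "c *s ?w = ?v" by (auto simp: line_projector_mult)
  have "c \<noteq> 0"
  proof
    assume "c = 0"
    with c have "?v = 0" by simp
    then show False by simp
  qed
  then have "abs_cp2 (c *s ?w) = abs_cp2 ?w" by (rule abs_cp2_smult) simp
  with c show ?thesis by simp
qed

instantiation cp2 :: metric_space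
begin

definition dist_cp2 :: "cp2 \<Rightarrow> cp2 \<Rightarrow> real" where
  "dist_cp2 p q = norm (line_projector (rep_cp2 p) - line_projector (rep_cp2 q))"

definition uniformity_cp2 :: "(cp2 \<times> cp2) filter" where
  "uniformity_cp2 = (INF e\<in>{0<..}. principal {(x, y). dist x y < e})"

definition open_cp2 :: "cp2 set \<Rightarrow> bool" where
  "open_cp2 S \<longleftrightarrow> (\<forall>x\<in>S. \<forall>\<^sub>F (x', y) in uniformity. x' = x \<longrightarrow> y \<in> S)"

instance
proof
  show "dist x y = 0 \<longleftrightarrow> x = y" for x y :: cp2
    using line_projector_rep_inj by (auto simp: dist_cp2_def)
  show "dist x y \<le> dist x z + dist y z" for x y z :: cp2
    unfolding dist_cp2_def dist_norm [symmetric] by (rule dist_triangle2)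
qed (rule uniformity_cp2_def open_cp2_def)+

end

lemma open_cp2_iff: "open S \<longleftrightarrow> open {v. v \<noteq> 0 \<and> abs_cp2 v \<in> S}"
proof
  assume S: "open S"
  have "continuous_on {v. v \<noteq> 0} abs_cp2"
  proof -
    have *: "continuous_on {v. v \<noteq> 0} line_projector"
      unfolding line_projector_def by (intro continuous_intros) auto
    show ?thesis
      unfolding continuous_on_iff
    proof (intro ballI allI impI)
      fix x :: "complex^3" and e :: real assume x: "x \<in> {v. v \<noteq> 0}" and "e > 0"
      with * obtain d where "d > 0"
        "\<And>y. y \<noteq> 0 \<Longrightarrow> dist y x < d \<Longrightarrow> dist (line_projector y) (line_projector x) < e"
        unfolding continuous_on_iff by blast
      then show "\<exists>d>0. \<forall>x'\<in>{v. v \<noteq> 0}. dist x' x < d \<longrightarrow> dist (abs_cp2 x') (abs_cp2 x) < e"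
        using x by (intro exI[of _ d]) (auto simp: dist_cp2_def line_projector_rep_abs dist_norm)
    qed
  qed
  moreover have "open {v :: complex^3. v \<noteq> 0}"
    by (simp add: open_Collect_neq)
  ultimately have "open ({v. v \<noteq> 0} \<inter> abs_cp2 -` S)"
    using S by (simp add: continuous_on_open_vimage Int_commute)
  then show "open {v. v \<noteq> 0 \<and> abs_cp2 v \<in> S}"
    by (simp add: Int_def vimage_def)
next
  assume C: "open {v. v \<noteq> 0 \<and> abs_cp2 v \<in> S}" (is "open ?C")
  show "open S"
    unfolding open_dist
  proof
    fix p assume p: "p \<in> S"
    let ?v = "rep_cp2 p"
    have cont: "continuous_on UNIV (\<lambda>M :: complex^3^3. M *v ?v)"
      unfolding matrix_vector_mult_def by (intro continuous_intros)
    have "open ((\<lambda>M :: complex^3^3. M *v ?v) -` ?C)"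
      using C cont by (rule open_vimage)
    moreover have "line_projector ?v \<in> (\<lambda>M :: complex^3^3. M *v ?v) -` ?C"
      using p by (simp add: line_projector_self)
    ultimately obtain e where e: "e > 0"
      "\<And>M. dist M (line_projector ?v) < e \<Longrightarrow> M *v ?v \<in> ?C"
      unfolding open_dist by blast
    have "q \<in> S" if "dist q p < e" for q
    proof -
      have "line_projector (rep_cp2 q) *v ?v \<in> ?C"
        using that by (intro e) (simp add: dist_cp2_def dist_norm)
      then obtain c where c: "c *s rep_cp2 q \<noteq> 0" "abs_cp2 (c *s rep_cp2 q) \<in> S"
        unfolding line_projector_mult by blast
      then have "c \<noteq> 0" by auto
      with c show ?thesis by (simp add: abs_cp2_smult)
    qed
    with e show "\<exists>e>0. \<forall>y. dist y p < e \<longrightarrow> y \<in> S" by blast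
  qed
qed


section \<open>Rational maps\<close>

text \<open>Polynomials in three variables over the complex numbers; the variables are indexed by the
  three-element type \<open>3\<close>, as are the homogeneous coordinates.\<close>

type_synonym poly3 = "(3 \<Rightarrow>\<^sub>0 nat) \<Rightarrow>\<^sub>0 complex"

definition poly3_eval :: "poly3 \<Rightarrow> complex^3 \<Rightarrow> complex" where
  "poly3_eval P v =
     (\<Sum>m\<in>Poly_Mapping.keys P. Poly_Mapping.lookup P m * (\<Prod>i\<in>UNIV. (v $ i) ^ Poly_Mapping.lookup m i))"

definition homogeneous3 :: "nat \<Rightarrow> poly3 \<Rightarrow> bool" where
  "homogeneous3 d P \<longleftrightarrow> (\<forall>m\<in>Poly_Mapping.keys P. (\<Sum>i\<in>UNIV. Poly_Mapping.lookup m i) = d)"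

definition rational_map :: "nat \<Rightarrow> (3 \<Rightarrow> poly3) \<Rightarrow> bool" where
  "rational_map d F \<longleftrightarrow> d \<ge> 2 \<and> (\<forall>i. homogeneous3 d (F i)) \<and> (\<forall>Q. (\<forall>i. Q dvd F i) \<longrightarrow> Q dvd 1)"

definition indeterminacy :: "(3 \<Rightarrow> poly3) \<Rightarrow> cp2 set" where
  "indeterminacy F = {p. \<forall>i. poly3_eval (F i) (rep_cp2 p) = 0}"

text \<open>A total function; its values on \<open>indeterminacy F\<close> are meaningless.\<close>

definition rat_map :: "(3 \<Rightarrow> poly3) \<Rightarrow> cp2 \<Rightarrow> cp2" where
  "rat_map F p = abs_cp2 (\<chi> i. poly3_eval (F i) (rep_cp2 p))"

definition iterate_defined :: "(3 \<Rightarrow> poly3) \<Rightarrow> nat \<Rightarrow> cp2 \<Rightarrow> bool" where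
  "iterate_defined F n p \<longleftrightarrow> (\<forall>k<n. (rat_map F ^^ k) p \<notin> indeterminacy F)"


section \<open>Fatou and Julia sets\<close>

text \<open>Since the projective plane is compact, no divergence to infinity has to be allowed.\<close>

definition normal_family :: "'a::topological_space set \<Rightarrow> ('a \<Rightarrow> 'b::metric_space) set \<Rightarrow> bool" where
  "normal_family W \<F> \<longleftrightarrow> (\<forall>s :: nat \<Rightarrow> 'a \<Rightarrow> 'b. range s \<subseteq> \<F> \<longrightarrow>
     (\<exists>r g. strict_mono r \<and>
        (\<forall>K. compact K \<and> K \<subseteq> W \<longrightarrow> uniform_limit K (\<lambda>k. s (r k)) g sequentially)))"

definition fatou_set :: "(3 \<Rightarrow> poly3) \<Rightarrow> cp2 set" where
  "fatou_set F = \<Union> {W. open W \<and> (\<forall>p\<in>W. \<forall>n. iterate_defined F n p) \<and>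
                      normal_family W (range (\<lambda>n. rat_map F ^^ n))}"

definition julia_set :: "(3 \<Rightarrow> poly3) \<Rightarrow> cp2 set" where
  "julia_set F = - fatou_set F"


section \<open>Herman rings\<close>

text \<open>For \<open>(rep_cp2 p) $ i \<noteq> 0\<close>, the homogeneous coordinates of \<open>p\<close> whose \<open>i\<close>-th entry is 1. The
  other two entries are the affine coordinates of \<open>p\<close> in the standard chart number \<open>i\<close> of the
  complex manifold \<open>cp2\<close>.\<close>

definition affine_coords :: "3 \<Rightarrow> cp2 \<Rightarrow> complex^3" where
  "affine_coords i p = (\<chi> j. rep_cp2 p $ j / rep_cp2 p $ i)"

definition holomorphic_immersion1 :: "complex set \<Rightarrow> (complex \<Rightarrow> cp2) \<Rightarrow> bool" where
  "holomorphic_immersion1 S g \<longleftrightarrow> continuous_on S g \<and>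
     (\<forall>x\<in>S. \<forall>i. rep_cp2 (g x) $ i \<noteq> 0 \<longrightarrow>
        (\<exists>A. ((\<lambda>y. affine_coords i (g y)) has_derivative (\<lambda>a. a *s A)) (at x) \<and> A \<noteq> 0))"

text \<open>Here source and target have the same dimension, so this says that \<open>g\<close> is locally
  biholomorphic: \<open>A\<close> and \<open>B\<close> are the two complex partial derivatives in an affine chart.\<close>

definition holomorphic_immersion2 :: "(complex \<times> complex) set \<Rightarrow> (complex \<times> complex \<Rightarrow> cp2) \<Rightarrow> bool" where
  "holomorphic_immersion2 S g \<longleftrightarrow> continuous_on S g \<and>
     (\<forall>x\<in>S. \<forall>i. rep_cp2 (g x) $ i \<noteq> 0 \<longrightarrow>
        (\<exists>A B. ((\<lambda>y. affine_coords i (g y)) has_derivative (\<lambda>(a, b). a *s A + b *s B)) (at x) \<and>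
               inj (\<lambda>(a, b). a *s A + b *s B)))"

definition strip :: "ereal \<Rightarrow> ereal \<Rightarrow> complex set" where
  "strip h0 h1 = {t. h0 < ereal (Im t) \<and> ereal (Im t) < h1}"

text \<open>Maps out of the cylinder \<open>h0 < Im t < h1\<close> in \<open>\<complex>/\<int>\<close> are written as 1-periodic maps on the
  strip in \<open>\<complex>\<close>. With this convention \<open>\<gamma>\<close> is the inverse of the canonical parameter \<open>t\<close> of the ring
  \<open>H\<close>: the cylinder is mapped biholomorphically onto the embedded annulus \<open>H\<close>, and \<open>f\<close> is
  conjugated to the rotation by \<open>\<alpha>\<close>. The last condition but one says that \<open>\<gamma>\<close> is open onto \<open>H\<close>,
  that is, the inverse is continuous, so that \<open>H\<close> is an embedded and not merely immersed annulus.\<close>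

definition herman_ring ::
  "(3 \<Rightarrow> poly3) \<Rightarrow> cp2 set \<Rightarrow> ereal \<Rightarrow> ereal \<Rightarrow> real \<Rightarrow> (complex \<Rightarrow> cp2) \<Rightarrow> bool" where
  "herman_ring F H h0 h1 \<alpha> \<gamma> \<longleftrightarrow>
     h0 < h1 \<and> \<alpha> \<notin> \<rat> \<and> H = \<gamma> ` strip h0 h1 \<and>
     holomorphic_immersion1 (strip h0 h1) \<gamma> \<and>
     (\<forall>s\<in>strip h0 h1. \<forall>t\<in>strip h0 h1. \<gamma> s = \<gamma> t \<longleftrightarrow> s - t \<in> \<int>) \<and>
     (\<forall>S. open S \<and> S \<subseteq> strip h0 h1 \<longrightarrow> openin (top_of_set H) (\<gamma> ` S)) \<and>
     (\<forall>t\<in>strip h0 h1. \<gamma> t \<notin> indeterminacy F \<and> rat_map F (\<gamma> t) = \<gamma> (t + of_real \<alpha>))"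

definition ring_circle :: "(complex \<Rightarrow> cp2) \<Rightarrow> real \<Rightarrow> cp2 set" where
  "ring_circle \<gamma> h = \<gamma> ` {t. Im t = h}"


section \<open>Coordinates near an invariant circle\<close>

text \<open>Holomorphic coordinates \<open>(t, u)\<close>, with \<open>t\<close> in \<open>\<complex>/\<int>\<close>, on the neighborhood \<open>\<psi> ` D\<close> of
  \<open>ring_circle \<gamma> h\<close>. They are given by their inverse \<open>\<psi>\<close>, again written 1-periodically in \<open>t\<close>.
  The last condition says that \<open>u = 0\<close> on \<open>H\<close> and that \<open>t\<close> restricts to the canonical
  parameter there.\<close>

definition ring_coordinates ::
  "cp2 set \<Rightarrow> ereal \<Rightarrow> ereal \<Rightarrow> (complex \<Rightarrow> cp2) \<Rightarrow> real \<Rightarrow>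
   (complex \<times> complex) set \<Rightarrow> (complex \<times> complex \<Rightarrow> cp2) \<Rightarrow> bool" where
  "ring_coordinates H h0 h1 \<gamma> h D \<psi> \<longleftrightarrow>
     open D \<and> (\<forall>t u. (t + 1, u) \<in> D \<longleftrightarrow> (t, u) \<in> D) \<and>
     holomorphic_immersion2 D \<psi> \<and> open (\<psi> ` D) \<and>
     (\<forall>t u t' u'. (t, u) \<in> D \<and> (t', u') \<in> D \<longrightarrow>
        (\<psi> (t, u) = \<psi> (t', u') \<longleftrightarrow> t - t' \<in> \<int> \<and> u = u')) \<and>
     ring_circle \<gamma> h \<subseteq> \<psi> ` D \<and>
     (\<forall>t u. (t, u) \<in> D \<and> \<psi> (t, u) \<in> H \<longrightarrow> u = 0 \<and> t \<in> strip h0 h1 \<and> \<gamma> t = \<psi> (t, u))"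

definition u_coord :: "(complex \<times> complex) set \<Rightarrow> (complex \<times> complex \<Rightarrow> cp2) \<Rightarrow> cp2 \<Rightarrow> complex" where
  "u_coord D \<psi> p = (THE u. \<exists>t. (t, u) \<in> D \<and> \<psi> (t, u) = p)"

text \<open>The second component \<open>U\<close> of \<open>f\<close> in the coordinates \<open>(t, u)\<close>.\<close>

definition U_component ::
  "(3 \<Rightarrow> poly3) \<Rightarrow> (complex \<times> complex) set \<Rightarrow> (complex \<times> complex \<Rightarrow> cp2) \<Rightarrow> complex \<Rightarrow> complex \<Rightarrow> complex" where
  "U_component F D \<psi> t u = u_coord D \<psi> (rat_map F (\<psi> (t, u)))"


section \<open>The transverse Lyapunov exponent\<close>

definition ln_cmod :: "complex \<Rightarrow> ereal" where
  "ln_cmod z = (if z = 0 then -\<infinity> else ereal (ln (cmod z)))"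

text \<open>Lebesgue integral of an extended real valued function, as the difference of the integrals
  of its positive and negative parts (\<open>e2ennreal\<close> sends negative numbers to 0). In contrast to
  the Bochner integral it takes the value \<open>-\<infinity>\<close> when appropriate.\<close>

definition ereal_integral :: "'a measure \<Rightarrow> ('a \<Rightarrow> ereal) \<Rightarrow> ereal" where
  "ereal_integral M f =
     enn2ereal (\<integral>\<^sup>+ x. e2ennreal (f x) \<partial>M) - enn2ereal (\<integral>\<^sup>+ x. e2ennreal (- f x) \<partial>M)"

definition transverse_lyapunov ::
  "(3 \<Rightarrow> poly3) \<Rightarrow> (complex \<times> complex) set \<Rightarrow> (complex \<times> complex \<Rightarrow> cp2) \<Rightarrow> complex \<Rightarrow> ereal" where
  "transverse_lyapunov F D \<psi> t =
     ereal_integral (restrict_space lborel {0..1})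
       (\<lambda>\<tau>. ln_cmod (deriv (U_component F D \<psi> (t + of_real \<tau>)) 0))"


section \<open>Uniform attraction\<close>

definition uniformly_attracting ::
  "(3 \<Rightarrow> poly3) \<Rightarrow> (complex \<times> complex) set \<Rightarrow> (complex \<times> complex \<Rightarrow> cp2) \<Rightarrow> cp2 set \<Rightarrow> bool" where
  "uniformly_attracting F D \<psi> H0 \<longleftrightarrow>
     (\<exists>V n c. open V \<and> H0 \<subseteq> V \<and> V \<subseteq> \<psi> ` D \<and> n \<ge> 1 \<and> c < (1::real) \<and>
        (\<forall>p\<in>V. iterate_defined F n p \<and> (rat_map F ^^ n) p \<in> \<psi> ` D \<and>
           cmod (u_coord D \<psi> ((rat_map F ^^ n) p)) \<le> c * cmod (u_coord D \<psi> p)))"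

end

theory Submission
  imports Defs "HOL-Complex_Analysis.Complex_Analysis"
begin

text \<open>Near the circle the rational map lifts, in the coordinates \<open>(t, u)\<close>, to a holomorphic map
  \<open>(t, u) \<mapsto> (T, U)\<close> with \<open>(t, 0) \<mapsto> (t + \<alpha>, 0)\<close>. To first order in \<open>u\<close> it multiplies \<open>u\<close> by
  \<open>\<lambda>(t) = \<partial>U/\<partial>u (t, 0)\<close> (called \<open>multiplier\<close> below) while \<open>t\<close> is rotated, so everything is decided
  by the products of \<open>|\<lambda>|\<close> along orbits of an irrational rotation; the transverse exponent is the
  mean of \<open>log |\<lambda>|\<close>.

  Negative exponent. Cutting \<open>log |\<lambda>|\<close> off from below gives a continuous function \<open>\<phi>\<close> which still
  has a negative mean. Birkhoff averages of a continuous function over an irrational rotation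
  converge uniformly, hence \<open>\<phi>\<close> differs from a function bounded above by a negative constant by a
  coboundary \<open>b(x) - b(x + \<alpha>)\<close> (\<open>negative_mean_cohomologous_to_negative\<close>). With the weight
  \<open>w = exp b\<close> the quantity \<open>w(Re t) |u|\<close> therefore shrinks by a fixed factor in every single step
  (\<open>contracting_weight\<close>); the Schwarz lemma extends this from first order to a neighborhood of the
  circle. Another use of the Schwarz lemma shows that \<open>T - t - \<alpha>\<close> is \<open>O(|u|)\<close>, so the total
  deviation of an orbit from the rotation is at most a geometric series, and orbits that start
  close to the circle never leave the coordinates (\<open>attracted_orbits\<close>). This gives uniform
  attraction. It also gives normality: \<open>T\<^sub>n - n \<alpha>\<close> converges uniformly to a limit \<open>s\<close>, so the
  iterates approach \<open>(s + n \<alpha>, 0)\<close> uniformly, and they converge along every subsequence on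
  which \<open>n \<alpha>\<close> converges modulo 1.

  Positive exponent. If a point of the circle were in the Fatou set, then infinitely many iterates
  would map a fixed neighborhood of it into the domain of the coordinates
  (\<open>fatou_iterates_stay_near_circle\<close>), and Cauchy's inequality would bound the product
  \<open>P\<^sub>n(t) = |\<lambda>(t) \<dots> \<lambda>(t + (n-1) \<alpha>)|\<close> for infinitely many \<open>n\<close>, uniformly for \<open>t\<close> in an arc. Finitely
  many rotated copies of the arc cover the circle, and the identity
  \<open>P\<^sub>k(y) P\<^sub>n(y + k \<alpha>) = P\<^sub>n(y) P\<^sub>k(y + n \<alpha>)\<close> carries the bound from one copy to the next. The result is an
  upper bound for \<open>log P\<^sub>n\<close> by an integrable function that does not depend on \<open>n\<close>, although the mean
  of \<open>log P\<^sub>n\<close> is \<open>n\<close> times the exponent (\<open>positive_mean_products_unbounded\<close>).\<close>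


section \<open>Averages over an irrational rotation of the circle\<close>

lemma periodic_add_int:
  fixes g :: "'b::ring_1 \<Rightarrow> 'a"
  assumes per: "\<And>x. g (x + 1) = g x"
  shows "g (x + of_int m) = g x"
proof -
  have nat: "g (x + of_nat n) = g x" for x n
  proof (induction n)
    case (Suc n)
    then show ?case using per[of "x + of_nat n"] by (simp add: add_ac)
  qed simp
  show ?thesis
  proof (cases m)
    case (nonneg n)
    then show ?thesis using nat by simp
  next
    case (neg n)
    then show ?thesis using nat[of "x + of_int m" "Suc n"] by simp
  qed
qed

lemma has_integral_periodic_shift:
  fixes g :: "real \<Rightarrow> real"
  assumes per: "\<And>x. g (x + 1) = g x" and int: "(g has_integral I) {0..1}"
  shows "((\<lambda>x. g (x + a)) has_integral I) {0..1}"
proof -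
  define b where "b = frac a"
  have b: "0 \<le> b" "b < 1" unfolding b_def by (simp_all add: frac_lt_1)
  have eq: "g (x + a) = g (x + b)" for x
    using periodic_add_int[of g "x + b" "\<lfloor>a\<rfloor>", OF per] by (simp add: b_def frac_def)
  have intg: "g integrable_on {0..1}" using int by blast
  have "g integrable_on {0..b}" "g integrable_on {b..1}"
    using b by (auto intro: integrable_subinterval_real[OF intg])
  then obtain I1 I2 where I: "(g has_integral I1) {0..b}" "(g has_integral I2) {b..1}"
    by (auto simp: integrable_on_def)
  have "(g has_integral (I1 + I2)) {0..1}"
    using has_integral_combine[OF _ _ I] b by simp
  then have sum: "I = I1 + I2" using int has_integral_unique by blast
  have im: "(\<lambda>x. x + c) ` {u..v} = {u + c..v + c}" for c u v :: real
    by (metis add.commute image_add_atLeastAtMost image_cong)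
  have "((\<lambda>x. g (x + b)) has_integral I2) {0..1 - b}"
    using has_integral_affinity[of g I2 b 1 1 b] I(2) im[of "-b" b 1]
    by simp
  moreover have "((\<lambda>x. g (x + b)) has_integral I1) {1 - b..1}"
  proof -
    have "((\<lambda>x. g (x + (b - 1))) has_integral I1) {1 - b..1}"
      using has_integral_affinity[of g I1 0 b 1 "b - 1"] I(1) im[of "1 - b" 0 b]
      by (simp add: algebra_simps)
    moreover have "g (x + (b - 1)) = g (x + b)" for x
      using per[of "x + (b - 1)"] by (simp add: algebra_simps)
    ultimately show ?thesis by simp
  qed
  ultimately have "((\<lambda>x. g (x + b)) has_integral (I2 + I1)) {0..1}"
    using b by (intro has_integral_combine[where c = "1 - b"]) auto
  then show ?thesis by (simp add: eq sum add.commute)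
qed

text \<open>Kronecker's theorem gives a number of steps for each point of the circle; that one bound \<open>q\<close> serves
  all points follows by treating a finite grid of mesh less than \<open>\<epsilon> / 2\<close>.\<close>

lemma irrational_rotation_dense:
  fixes \<alpha> \<epsilon> :: real
  assumes "\<alpha> \<notin> \<rat>" "\<epsilon> > 0"
  obtains q :: nat where "\<And>x. \<exists>k\<le>q. \<exists>m::int. \<bar>x - real k * \<alpha> - of_int m\<bar> < \<epsilon>"
proof -
  obtain N :: nat where N: "N > 0" "1 / real N < \<epsilon> / 2"
    by (metis assms(2) half_gt_zero nat_approx_posE zero_less_Suc)
  have "\<exists>k::nat. \<exists>m::int. \<bar>real k * \<alpha> + of_int m - y\<bar> < \<epsilon> / 2" for y
  proof -
    obtain h k where "0 < k" "\<bar>real_of_int k * \<alpha> - real_of_int h - y\<bar> < \<epsilon> / 2"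
      using sequence_of_fractional_parts_is_dense[OF assms(1) half_gt_zero[OF assms(2)]] by blast
    then show ?thesis
      by (intro exI[of _ "nat k"] exI[of _ "-h"]) simp
  qed
  then obtain K M where KM: "\<And>y. \<bar>real (K y) * \<alpha> + of_int (M y) - y\<bar> < \<epsilon> / 2" by metis
  define q where "q = (\<Sum>i\<le>N. K (real i / real N))"
  have "\<exists>k\<le>q. \<exists>m::int. \<bar>x - real k * \<alpha> - of_int m\<bar> < \<epsilon>" for x
  proof -
    define i where "i = nat \<lfloor>real N * frac x\<rfloor>"
    have i: "real i \<le> real N * frac x" "real N * frac x < real i + 1"
      unfolding i_def by (simp_all add: floor_less_iff of_nat_nat)
    have iN: "i \<le> N"
    proof -
      have "real N * frac x \<le> real N * 1" using frac_lt_1[of x] by (intro mult_left_mono) auto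
      then show ?thesis using i(1) by linarith
    qed
    have "K (real i / real N) \<le> q"
      unfolding q_def using iN by (intro member_le_sum) auto
    moreover have "\<bar>frac x - real i / real N\<bar> < \<epsilon> / 2"
    proof -
      have "real i / real N \<le> frac x" "frac x < (real i + 1) / real N"
        using i N(1) by (simp_all add: field_simps)
      then show ?thesis using N(2) by (simp add: add_divide_distrib)
    qed
    then have "\<bar>x - real (K (real i / real N)) * \<alpha> - of_int (\<lfloor>x\<rfloor> + M (real i / real N))\<bar> < \<epsilon>"
      using KM[of "real i / real N"] unfolding frac_def of_int_add by linarith
    ultimately show ?thesis by blast
  qed
  then show ?thesis by (rule that)
qed

lemma periodic_bounded:
  fixes g :: "real \<Rightarrow> real"
  assumes per: "\<And>x. g (x + 1) = g x" and cont: "continuous_on UNIV g"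
  obtains B where "B > 0" "\<And>x. \<bar>g x\<bar> \<le> B"
proof -
  have "compact (g ` {0..1})"
    by (intro compact_continuous_image continuous_on_subset[OF cont]) auto
  then obtain B where B: "B > 0" "\<And>y. y \<in> g ` {0..1} \<Longrightarrow> norm y \<le> B"
    using compact_imp_bounded bounded_pos by metis
  have "\<bar>g x\<bar> \<le> B" for x
  proof -
    have "g x = g (frac x)"
      using periodic_add_int[of g "frac x" "\<lfloor>x\<rfloor>", OF per] by (simp add: frac_def)
    moreover have "frac x \<in> {0..1}" by (simp add: frac_lt_1 less_imp_le)
    ultimately show ?thesis using B(2)[of "g x"] by simp
  qed
  with B(1) show ?thesis by (rule that)
qed

lemma periodic_uniformly_continuous:
  fixes g :: "real \<Rightarrow> real"
  assumes per: "\<And>x. g (x + 1) = g x" and cont: "continuous_on UNIV g" and "e > 0"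
  obtains d where "d > 0" "\<And>x y. \<bar>x - y\<bar> < d \<Longrightarrow> \<bar>g x - g y\<bar> < e"
proof -
  have "uniformly_continuous_on {-1..2} g"
    by (intro compact_uniformly_continuous continuous_on_subset[OF cont]) auto
  then obtain d where d: "d > 0"
    "\<And>x y. x \<in> {-1..2} \<Longrightarrow> y \<in> {-1..2} \<Longrightarrow> dist y x < d \<Longrightarrow> dist (g y) (g x) < e"
    using \<open>e > 0\<close> unfolding uniformly_continuous_on_def by metis
  show ?thesis
  proof (rule that[of "min d 1"])
    show "min d 1 > 0" using d by simp
    fix x y :: real assume xy: "\<bar>x - y\<bar> < min d 1"
    let ?x = "frac x" and ?y = "y - of_int \<lfloor>x\<rfloor>"
    have "g x = g ?x" "g y = g ?y"
      using periodic_add_int[of g ?x "\<lfloor>x\<rfloor>", OF per] periodic_add_int[of g ?y "\<lfloor>x\<rfloor>", OF per]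
      by (simp_all add: frac_def)
    moreover have "?x \<in> {-1..2}" "?y \<in> {-1..2}" "dist ?x ?y < d"
      using xy frac_ge_0[of x] frac_lt_1[of x] unfolding frac_def dist_real_def atLeastAtMost_iff
      by linarith+
    ultimately show "\<bar>g x - g y\<bar> < e" using d(2)[of ?y ?x] by (simp add: dist_real_def)
  qed
qed

definition birkhoff_sum :: "(real \<Rightarrow> real) \<Rightarrow> real \<Rightarrow> nat \<Rightarrow> real \<Rightarrow> real" where
  "birkhoff_sum g \<alpha> n x = (\<Sum>j<n. g (x + real j * \<alpha>))"

lemma birkhoff_sum_shift1:
  "birkhoff_sum g \<alpha> n (x + \<alpha>) - birkhoff_sum g \<alpha> n x = g (x + real n * \<alpha>) - g x"
proof -
  have "birkhoff_sum g \<alpha> n (x + \<alpha>) = (\<Sum>j<n. g (x + real (Suc j) * \<alpha>))"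
    by (simp add: birkhoff_sum_def algebra_simps)
  moreover have "(\<Sum>j<Suc n. g (x + real j * \<alpha>)) = g x + (\<Sum>j<n. g (x + real (Suc j) * \<alpha>))"
    by (subst sum.lessThan_Suc_shift) simp
  ultimately show ?thesis by (simp add: birkhoff_sum_def)
qed

lemma birkhoff_sum_periodic:
  assumes "\<And>x. g (x + 1) = g x"
  shows "birkhoff_sum g \<alpha> n (x + 1) = birkhoff_sum g \<alpha> n x"
proof -
  have "g (x + 1 + real j * \<alpha>) = g (x + real j * \<alpha>)" for j
    using assms[of "x + real j * \<alpha>"] by (simp add: algebra_simps)
  then show ?thesis by (simp add: birkhoff_sum_def)
qed

lemma continuous_on_birkhoff_sum:
  assumes "continuous_on UNIV g"
  shows "continuous_on UNIV (birkhoff_sum g \<alpha> n)"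
  unfolding birkhoff_sum_def[abs_def]
  by (intro continuous_intros continuous_on_compose2[OF assms]) auto

text \<open>Rotations preserve the mean.\<close>

lemma has_integral_birkhoff_sum:
  assumes "\<And>x. g (x + 1) = g x" "(g has_integral I) {0..1}"
  shows "(birkhoff_sum g \<alpha> n has_integral (real n * I)) {0..1}"
proof -
  have "((\<lambda>x. \<Sum>j<n. g (x + real j * \<alpha>)) has_integral (\<Sum>j<n. I)) {0..1}"
    by (intro has_integral_sum has_integral_periodic_shift assms) auto
  then show ?thesis by (simp add: birkhoff_sum_def[abs_def])
qed

text \<open>The averages \<open>S\<^sub>n / n\<close> inherit the modulus of continuity of \<open>\<phi>\<close>, and moving the base point by \<open>k\<close> rotation steps
  changes them by at most \<open>2 k B / n\<close>. Since boundedly many steps reach every point approximately,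
  the averages are nearly constant, and the constant must be the mean.\<close>

lemma birkhoff_average_uniformly_negative:
  fixes \<phi> :: "real \<Rightarrow> real"
  assumes \<alpha>: "\<alpha> \<notin> \<rat>" and per: "\<And>x. \<phi> (x + 1) = \<phi> x" and cont: "continuous_on UNIV \<phi>"
    and int: "(\<phi> has_integral m) {0..1}" and "m < 0"
  obtains n where "n > 0" "\<And>x. birkhoff_sum \<phi> \<alpha> n x / real n \<le> m / 2"
proof -
  obtain B where B: "B > 0" "\<And>x. \<bar>\<phi> x\<bar> \<le> B" using periodic_bounded[OF per cont] by blast
  \<comment> \<open>The oscillation of the average will be at most \<open>2 e = - m / 2\<close>.\<close>
  define e where "e = - m / 4"
  have e: "e > 0" using \<open>m < 0\<close> by (simp add: e_def)
  obtain d where d: "d > 0" "\<And>x y. \<bar>x - y\<bar> < d \<Longrightarrow> \<bar>\<phi> x - \<phi> y\<bar> < e"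
    using periodic_uniformly_continuous[OF per cont e] by blast
  obtain q :: nat where q: "\<And>x. \<exists>k\<le>q. \<exists>m::int. \<bar>x - real k * \<alpha> - of_int m\<bar> < d"
    using irrational_rotation_dense[OF \<alpha> d(1)] by blast
  obtain n0 :: nat where n0: "2 * real q * B / e < real n0" using reals_Archimedean2 by blast
  define n where "n = Suc n0"
  have n: "n > 0" "2 * real q * B \<le> e * real n"
    using n0 e by (simp_all add: n_def field_simps)
  let ?S = "birkhoff_sum \<phi> \<alpha> n"
  have step: "\<bar>?S (x + real k * \<alpha>) - ?S x\<bar> \<le> 2 * real k * B" for x k
  proof (induction k)
    case (Suc k)
    have "?S (x + real k * \<alpha> + \<alpha>) - ?S (x + real k * \<alpha>)
        = \<phi> (x + real k * \<alpha> + real n * \<alpha>) - \<phi> (x + real k * \<alpha>)"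
      by (rule birkhoff_sum_shift1)
    moreover have "x + real (Suc k) * \<alpha> = x + real k * \<alpha> + \<alpha>" by (simp add: algebra_simps)
    ultimately show ?case
      using Suc B(2)[of "x + real k * \<alpha> + real n * \<alpha>"] B(2)[of "x + real k * \<alpha>"]
      by (simp add: algebra_simps)
  qed simp
  have osc: "?S x - 2 * e * real n \<le> ?S y" for x y
  proof -
    obtain k m where k: "k \<le> q" "\<bar>y - x - real k * \<alpha> - of_int m\<bar> < d" using q by blast
    let ?z = "x + real k * \<alpha>"
    have "\<bar>?S y - ?S (?z + of_int m)\<bar> \<le> real n * e"
    proof -
      have "\<bar>?S y - ?S (?z + of_int m)\<bar> \<le> (\<Sum>j<n. \<bar>\<phi> (y + real j * \<alpha>) - \<phi> (?z + of_int m + real j * \<alpha>)\<bar>)"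
        unfolding birkhoff_sum_def sum_subtractf[symmetric] by (rule sum_abs)
      also have "\<dots> \<le> (\<Sum>j<n. e)"
        using k(2) by (intro sum_mono less_imp_le d(2)) (simp add: algebra_simps)
      finally show ?thesis by simp
    qed
    moreover have "?S (?z + of_int m) = ?S ?z"
      by (rule periodic_add_int) (rule birkhoff_sum_periodic[of \<phi>, OF per])
    moreover have "2 * real k * B \<le> 2 * real q * B" using k(1) B(1) by simp
    ultimately show ?thesis using step[of x k] n(2) by (simp add: algebra_simps)
  qed
  have "?S x / real n \<le> m / 2" for x
  proof -
    have 1: "(?S has_integral (real n * m)) {0..1}" by (rule has_integral_birkhoff_sum[OF per int])
    have 2: "((\<lambda>y. ?S x - 2 * e * real n) has_integral (?S x - 2 * e * real n)) {0..1::real}"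
      using has_integral_const_real[of "?S x - 2 * e * real n" 0 1] by simp
    have "?S x - 2 * e * real n \<le> real n * m"
      by (rule has_integral_le[OF 2 1]) (rule osc)
    then show ?thesis using n(1) by (simp add: e_def field_simps)
  qed
  with n(1) show ?thesis by (rule that)
qed

text \<open>With \<open>b\<close> the mean of the Birkhoff sums \<open>S\<^sub>0, \<dots>, S\<^bsub>n-1\<^esub>\<close>, the coboundary \<open>b(x + \<alpha>) - b(x)\<close> is
  \<open>S\<^sub>n(x) / n - \<phi>(x)\<close>; thus \<open>\<phi>\<close> is cohomologous to its own \<open>n\<close>-th average, which is negative.\<close>

lemma negative_mean_cohomologous_to_negative:
  fixes \<phi> :: "real \<Rightarrow> real"
  assumes \<alpha>: "\<alpha> \<notin> \<rat>" and per: "\<And>x. \<phi> (x + 1) = \<phi> x" and cont: "continuous_on UNIV \<phi>"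
    and int: "(\<phi> has_integral m) {0..1}" and "m < 0"
  obtains b where "continuous_on UNIV b" "\<And>x. b (x + 1) = b x"
    "\<And>x. \<phi> x + b (x + \<alpha>) - b x \<le> m / 2"
proof -
  obtain n where n: "n > 0" "\<And>x. birkhoff_sum \<phi> \<alpha> n x / real n \<le> m / 2"
    using birkhoff_average_uniformly_negative[OF assms] by blast
  define b where "b x = (\<Sum>j<n. birkhoff_sum \<phi> \<alpha> j x) / real n" for x
  show ?thesis
  proof (rule that[of b])
    show "continuous_on UNIV b"
      unfolding b_def[abs_def]
      by (intro continuous_intros continuous_on_compose2[OF continuous_on_birkhoff_sum[OF cont]])
        (use n in auto)
    show "b (x + 1) = b x" for x by (simp add: b_def birkhoff_sum_periodic[of \<phi>, OF per])
    show "\<phi> x + b (x + \<alpha>) - b x \<le> m / 2" for x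
    proof -
      have "b (x + \<alpha>) - b x = (\<Sum>j<n. birkhoff_sum \<phi> \<alpha> j (x + \<alpha>) - birkhoff_sum \<phi> \<alpha> j x) / real n"
        by (simp add: b_def sum_subtractf diff_divide_distrib)
      also have "\<dots> = (birkhoff_sum \<phi> \<alpha> n x - real n * \<phi> x) / real n"
        unfolding birkhoff_sum_shift1 by (simp add: sum_subtractf birkhoff_sum_def)
      finally have "b (x + \<alpha>) - b x = birkhoff_sum \<phi> \<alpha> n x / real n - \<phi> x"
        using n(1) by (simp add: diff_divide_distrib)
      then show ?thesis using n(2)[of x] by linarith
    qed
  qed
qed


text \<open>A bound on an arc for the products \<open>P\<^sub>n\<close> would spread over the whole circle by the cocycle identity,
  up to the factors \<open>P\<^sub>k\<close> with \<open>k \<le> q\<close>. Their logarithms are integrable, whereas \<open>ln P\<^sub>n\<close> has the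
  integral \<open>n I\<close>.\<close>

lemma positive_mean_products_unbounded:
  fixes l :: "real \<Rightarrow> real"
  assumes \<alpha>: "\<alpha> \<notin> \<rat>" and per: "\<And>x. l (x + 1) = l x" and cont: "continuous_on UNIV l"
    and nonneg: "\<And>x. l x \<ge> 0" and null: "negligible {x. l x = 0}"
    and int: "((\<lambda>x. ln (l x)) has_integral I) {0..1}"
    and absint: "(\<lambda>x. \<bar>ln (l x)\<bar>) integrable_on {0..1}"
    and "I > 0" "\<rho> > 0"
  obtains n0 where "\<And>n. n \<ge> n0 \<Longrightarrow> \<exists>x. \<bar>x - x0\<bar> < \<rho> \<and> M < (\<Prod>j<n. l (x + real j * \<alpha>))"
proof -
  define g where "g x = ln (l x)" for x
  define a where "a x = \<bar>g x\<bar>" for x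
  define P where "P n x = (\<Prod>j<n. l (x + real j * \<alpha>))" for n x
  have gper: "g (x + 1) = g x" and aper: "a (x + 1) = a x" for x by (simp_all add: g_def a_def per)
  obtain A where A: "(a has_integral A) {0..1}"
    using absint by (auto simp: integrable_on_def a_def[abs_def] g_def)
  obtain q :: nat where q: "\<And>x. \<exists>k\<le>q. \<exists>m::int. \<bar>x - real k * \<alpha> - of_int m\<bar> < \<rho>"
    using irrational_rotation_dense[OF \<alpha> \<open>\<rho> > 0\<close>] by blast
  obtain B where B: "B > 0" "\<And>x. \<bar>l x\<bar> \<le> B" using periodic_bounded[OF per cont] by blast
  define C where "C = max 1 B"
  have C: "C \<ge> 1" "\<And>x. l x \<le> C" using B(2) unfolding C_def by (auto simp: abs_le_iff le_max_iff_disj)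
  define M' where "M' = max 1 M"
  have M': "M' \<ge> 1" "M \<le> M'" by (auto simp: M'_def)
  \<comment> \<open>The cost of moving the bound from the arc to \<open>x\<close>, whatever the number of steps \<open>k \<le> q\<close> is.\<close>
  define h where "h x = (\<Sum>k\<le>q. birkhoff_sum a \<alpha> k (x - real k * \<alpha>))" for x
  define J where "J = (\<Sum>k\<le>q. real k * A)"
  have hint: "(h has_integral J) {0..1}"
    unfolding h_def[abs_def] J_def
  proof (intro has_integral_sum)
    fix k
    show "((\<lambda>x. birkhoff_sum a \<alpha> k (x - real k * \<alpha>)) has_integral real k * A) {0..1}"
      using has_integral_periodic_shift[of "birkhoff_sum a \<alpha> k" _ "- (real k * \<alpha>)",
          OF birkhoff_sum_periodic[of a, OF aper] has_integral_birkhoff_sum[OF aper A]] by simp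
  qed simp
  \<comment> \<open>The points whose full orbit meets a zero of \<open>l\<close>; outside this null set all logarithms are genuine.\<close>
  define Z where "Z = (\<Union>j::int. (\<lambda>x. - (of_int j * \<alpha>) + x) ` {x. l x = 0})"
  have Z: "negligible Z"
    unfolding Z_def
  proof (intro negligible_countable_Union countableI_type countable_image)
    fix S assume "S \<in> range (\<lambda>j::int. (\<lambda>x. - (of_int j * \<alpha>) + x) ` {x. l x = 0})"
    then show "negligible S" using negligible_translation[OF null] by blast
  qed
  have nz: "l (x + of_int j * \<alpha>) > 0" if "x \<notin> Z" for x j
  proof -
    have "l (x + of_int j * \<alpha>) \<noteq> 0"
    proof
      assume "l (x + of_int j * \<alpha>) = 0"
      then have "x \<in> (\<lambda>x. - (of_int j * \<alpha>) + x) ` {x. l x = 0}"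
        by (intro image_eqI[of _ _ "x + of_int j * \<alpha>"]) auto
      with that show False by (auto simp: Z_def)
    qed
    then show ?thesis using nonneg[of "x + of_int j * \<alpha>"] by linarith
  qed
  have Pper: "P n (x + of_int m) = P n x" for n x m
  proof (rule periodic_add_int)
    fix x
    have "l (x + 1 + real j * \<alpha>) = l (x + real j * \<alpha>)" for j
      using per[of "x + real j * \<alpha>"] by (simp add: algebra_simps)
    then show "P n (x + 1) = P n x" by (simp add: P_def)
  qed
  have Padd: "P (n + k) x = P n x * P k (x + real n * \<alpha>)" for n k x
  proof (induction k)
    case (Suc k)
    then show ?case by (simp add: P_def algebra_simps)
  qed (simp add: P_def)
  have PC: "P k x \<le> C ^ k" "P k x \<ge> 0" for k x
    using prod_mono[of "{..<k}" "\<lambda>j. l (x + real j * \<alpha>)" "\<lambda>_. C"] C nonneg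
    by (auto simp: P_def prod_nonneg)
  have key: "birkhoff_sum g \<alpha> n x \<le> ln M' + real q * ln C + h x"
    if bd: "\<And>y. \<bar>y - x0\<bar> < \<rho> \<Longrightarrow> P n y \<le> M" and x: "x \<notin> Z" for n x
  proof -
    obtain k m where k: "k \<le> q" "\<bar>x - x0 - real k * \<alpha> - of_int m\<bar> < \<rho>" using q by blast
    let ?z = "x - real k * \<alpha>"
    \<comment> \<open>Modulo 1 the point \<open>?z\<close> lies in the arc, and \<open>k\<close> steps lead from it to \<open>x\<close>.\<close>
    have "P n ?z \<le> M'"
    proof -
      have "P n ?z = P n (?z + of_int (- m))" using Pper by metis
      also have "\<dots> \<le> M" using k(2) by (intro bd) (simp add: algebra_simps)
      finally show ?thesis using M' by simp
    qed
    then have "P k ?z * P n x \<le> M' * C ^ k"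
    proof -
      have "P k ?z * P n x = P n ?z * P k (?z + real n * \<alpha>)"
        using Padd[of k n ?z] Padd[of n k ?z] by (simp add: add.commute)
      also have "\<dots> \<le> M' * C ^ k" using \<open>P n ?z \<le> M'\<close> PC M' by (intro mult_mono) auto
      finally show ?thesis .
    qed
    moreover have lnP: "ln (P n' y) = birkhoff_sum g \<alpha> n' y \<and> P n' y > 0"
      if "\<And>j::nat. l (y + real j * \<alpha>) > 0" for n' y
      using that by (auto simp: P_def birkhoff_sum_def g_def ln_prod less_imp_neq[THEN not_sym] prod_pos)
    have "l (x + real j * \<alpha>) > 0" for j :: nat using nz[OF x, of "int j"] by simp
    note 1 = lnP[OF this, of n]
    have "l (?z + real j * \<alpha>) > 0" for j :: nat
      using nz[OF x, of "int j - int k"] by (simp add: algebra_simps)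
    note 2 = lnP[OF this, of k]
    ultimately have "ln (P k ?z * P n x) \<le> ln (M' * C ^ k)"
      using 1 by (subst ln_le_cancel_iff) (use M' C in auto)
    then have "birkhoff_sum g \<alpha> k ?z + birkhoff_sum g \<alpha> n x \<le> ln M' + real k * ln C"
      using 1 2 M' C by (simp add: ln_mult ln_realpow)
    moreover have "real k * ln C \<le> real q * ln C" using k C by (intro mult_right_mono) auto
    moreover have "- birkhoff_sum g \<alpha> k ?z \<le> birkhoff_sum a \<alpha> k ?z"
      unfolding birkhoff_sum_def sum_negf[symmetric] by (intro sum_mono) (auto simp: a_def)
    moreover have "birkhoff_sum a \<alpha> k ?z \<le> h x"
      unfolding h_def using k(1)
      by (intro member_le_sum[where f = "\<lambda>k. birkhoff_sum a \<alpha> k (x - real k * \<alpha>)"])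
        (auto simp: birkhoff_sum_def a_def intro!: sum_nonneg)
    ultimately show ?thesis by linarith
  qed
  have bound: "real n * I \<le> ln M' + real q * ln C + J"
    if bd: "\<And>y. \<bar>y - x0\<bar> < \<rho> \<Longrightarrow> P n y \<le> M" for n
  proof -
    let ?c = "ln M' + real q * ln C"
    have "(birkhoff_sum g \<alpha> n has_integral (real n * I)) {0..1}"
      by (rule has_integral_birkhoff_sum) (use gper int in \<open>auto simp: g_def[abs_def]\<close>)
    then have 1: "((\<lambda>x. if x \<in> Z then 0 else birkhoff_sum g \<alpha> n x) has_integral (real n * I)) {0..1}"
      by (rule has_integral_spike[OF Z, rotated]) auto
    have "((\<lambda>x. ?c + h x) has_integral (?c + J)) {0..1}"
      using has_integral_add[OF has_integral_const_real[of ?c 0 1] hint] by simp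
    then have 2: "((\<lambda>x. if x \<in> Z then 0 else ?c + h x) has_integral (?c + J)) {0..1}"
      by (rule has_integral_spike[OF Z, rotated]) auto
    show ?thesis
      using has_integral_le[OF 1 2] key[OF bd] by auto
  qed
  obtain n0 :: nat where n0: "(ln M' + real q * ln C + J) / I < real n0" using reals_Archimedean2 by blast
  show ?thesis
  proof (rule that[of n0], rule ccontr)
    fix n assume "n0 \<le> n" and no: "\<not> (\<exists>x. \<bar>x - x0\<bar> < \<rho> \<and> M < (\<Prod>j<n. l (x + real j * \<alpha>)))"
    have "real n * I \<le> ln M' + real q * ln C + J"
      by (rule bound) (use no in \<open>force simp: P_def not_less\<close>)
    moreover have "ln M' + real q * ln C + J < real n0 * I" using n0 \<open>I > 0\<close> by (simp add: field_simps)
    moreover have "real n0 * I \<le> real n * I" using \<open>n0 \<le> n\<close> \<open>I > 0\<close> by simp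
    ultimately show False by linarith
  qed
qed


section \<open>The extended mean value of the logarithm of a continuous function\<close>

abbreviation unit_measure :: "real measure" where
  "unit_measure \<equiv> restrict_space lborel {0..1}"

lemma integrable_unit_measure_iff:
  fixes g :: "real \<Rightarrow> real"
  shows "integrable unit_measure g \<longleftrightarrow> set_integrable lborel {0..1} g"
  by (subst integrable_restrict_space) (auto simp: set_integrable_def)

lemma integral_unit_measure:
  fixes g :: "real \<Rightarrow> real"
  assumes "integrable unit_measure g"
  shows "(g has_integral (integral\<^sup>L unit_measure g)) {0..1}"
proof -
  have *: "set_integrable lborel {0..1} g" using assms by (simp add: integrable_unit_measure_iff)
  have "integral\<^sup>L unit_measure g = (LINT x:{0..1}|lborel. g x)"
    by (subst integral_restrict_space) (auto simp: set_lebesgue_integral_def)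
  then show ?thesis
    using set_borel_integral_eq_integral[OF *] by (simp add: has_integral_integral)
qed

lemma integrable_unit_measure_continuous:
  fixes g :: "real \<Rightarrow> real"
  assumes "continuous_on UNIV g"
  shows "integrable unit_measure g"
  unfolding integrable_unit_measure_iff
  by (intro borel_integrable_compact[unfolded set_integrable_def[symmetric]]
      continuous_on_subset[OF assms]) (auto simp: set_integrable_def)

lemma nn_integral_unit_measure_continuous:
  fixes g :: "real \<Rightarrow> real"
  assumes "continuous_on UNIV g" "\<And>x. g x \<ge> 0"
  shows "(\<integral>\<^sup>+x. ennreal (g x) \<partial>unit_measure) = ennreal (integral\<^sup>L unit_measure g)"
  by (rule nn_integral_eq_integral) (use integrable_unit_measure_continuous assms in auto)

definition ln_ereal :: "real \<Rightarrow> ereal" where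
  "ln_ereal y = (if y = 0 then -\<infinity> else ereal (ln y))"

lemma ln_cmod_eq: "ln_cmod z = ln_ereal (cmod z)"
  by (simp add: ln_cmod_def ln_ereal_def)

lemma e2ennreal_ln_ereal:
  assumes "y \<ge> 0"
  shows "e2ennreal (ln_ereal y) = ennreal (ln (max y 1))"
proof (cases "y = 0")
  case True
  then show ?thesis by (simp add: ln_ereal_def e2ennreal_neg)
next
  case False
  then have "e2ennreal (ln_ereal y) = ennreal (ln y)" by (simp add: ln_ereal_def ennreal.abs_eq[symmetric] e2ennreal_ereal)
  also have "\<dots> = ennreal (ln (max y 1))"
    using False assms by (auto simp: max_def ennreal_neg)
  finally show ?thesis .
qed

lemma e2ennreal_neg_ln_ereal:
  assumes "y > 0"
  shows "e2ennreal (- ln_ereal y) = ennreal (- ln (min y 1))"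
proof -
  have "e2ennreal (- ln_ereal y) = ennreal (- ln y)"
    using assms by (simp add: ln_ereal_def e2ennreal_ereal)
  also have "\<dots> = ennreal (- ln (min y 1))" using assms by (auto simp: min_def ennreal_neg)
  finally show ?thesis .
qed

text \<open>The negative part of the logarithm is the increasing limit of its truncations, which remain
  continuous at zeros of the argument; monotone convergence will be applied to them.\<close>

lemma e2ennreal_neg_ln_ereal_SUP:
  assumes "y \<ge> 0"
  shows "e2ennreal (- ln_ereal y) = (SUP k::nat. ennreal (- ln (max (min y 1) (exp (- real k)))))"
proof (cases "y = 0")
  case True
  then have "(SUP k::nat. ennreal (- ln (max (min y 1) (exp (- real k))))) = (SUP k::nat. ennreal (real k))"
    by simp
  also have "\<dots> = top" 
    using ennreal_SUP_of_nat_eq_top by (simp only: ennreal_of_nat_eq_real_of_nat)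
  finally have eq: "(SUP k::nat. ennreal (- ln (max (min y 1) (exp (- real k))))) = top" .
  show ?thesis unfolding eq using True by (simp add: ln_ereal_def e2ennreal_infty)
next
  case False
  with assms have y: "y > 0" by simp
  obtain k0 :: nat where k0: "- ln (min y 1) < real k0" using reals_Archimedean2 by blast
  have k0': "exp (- real k0) \<le> min y 1"
    using k0 y by (subst ln_ge_iff[symmetric]) auto
  show ?thesis
    unfolding e2ennreal_neg_ln_ereal[OF y]
  proof (rule antisym)
    have "ennreal (- ln (min y 1)) = ennreal (- ln (max (min y 1) (exp (- real k0))))"
      using k0' by (simp add: max_absorb1)
    also have "\<dots> \<le> (SUP k::nat. ennreal (- ln (max (min y 1) (exp (- real k)))))"
      by (rule SUP_upper) simp
    finally show "ennreal (- ln (min y 1)) \<le> \<dots>" .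
    show "(SUP k::nat. ennreal (- ln (max (min y 1) (exp (- real k))))) \<le> ennreal (- ln (min y 1))"
    proof (rule SUP_least)
      fix k :: nat
      have "ln (min y 1) \<le> ln (max (min y 1) (exp (- real k)))"
        using y by (subst ln_le_cancel_iff) (auto simp: less_max_iff_disj)
      then show "ennreal (- ln (max (min y 1) (exp (- real k)))) \<le> ennreal (- ln (min y 1))"
        by (intro ennreal_leI) simp
    qed
  qed
qed

context
  fixes l :: "real \<Rightarrow> real"
  assumes cont: "continuous_on UNIV l" and nonneg: "\<And>x. l x \<ge> 0"
begin

lemma measurable_l: "l \<in> borel_measurable unit_measure"
  using borel_measurable_continuous_onI[OF cont] by (auto intro: measurable_restrict_space1)

lemma positive_part_ln:
  "(\<integral>\<^sup>+x. e2ennreal (ln_ereal (l x)) \<partial>unit_measure) = ennreal (integral\<^sup>L unit_measure (\<lambda>x. ln (max (l x) 1)))"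
  unfolding e2ennreal_ln_ereal[OF nonneg]
  by (intro nn_integral_unit_measure_continuous continuous_intros cont) (auto simp: less_max_iff_disj)

text \<open>The truncation of the logarithm at \<open>ln e\<close> is continuous. Its mean tends to that of the logarithm as
  \<open>e\<close> decreases, even if the latter is \<open>-\<infinity>\<close>, so it is negative for a suitable \<open>e\<close>.\<close>

lemma negative_log_mean_truncated:
  assumes "ereal_integral unit_measure (\<lambda>x. ln_ereal (l x)) < 0"
  obtains e m where "e > 0" "m < 0" "((\<lambda>x. ln (max (l x) e)) has_integral m) {0..1}"
proof -
  define p where "p x = ln (max (l x) 1)" for x
  define N where "N k x = - ln (max (min (l x) 1) (exp (- real k)))" for k x
  have contN: "continuous_on UNIV (N k)" for k
    unfolding N_def[abs_def] by (intro continuous_intros cont) (auto simp: max_def)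
  have contp: "continuous_on UNIV p"
    unfolding p_def[abs_def] by (intro continuous_intros cont) (auto simp: max_def)
  have N0: "N k x \<ge> 0" for k x
  proof -
    have "0 < max (min (l x) 1) (exp (- real k))" "max (min (l x) 1) (exp (- real k)) \<le> 1"
      by (auto simp: less_max_iff_disj)
    then show ?thesis unfolding N_def using ln_le_zero_iff by fastforce
  qed
  have p0: "p x \<ge> 0" for x unfolding p_def by auto
  have "(\<integral>\<^sup>+x. e2ennreal (- ln_ereal (l x)) \<partial>unit_measure) = (\<integral>\<^sup>+x. (SUP k. ennreal (N k x)) \<partial>unit_measure)"
    unfolding N_def e2ennreal_neg_ln_ereal_SUP[OF nonneg] ..
  also have "\<dots> = (SUP k. \<integral>\<^sup>+x. ennreal (N k x) \<partial>unit_measure)"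
  proof (rule nn_integral_monotone_convergence_SUP)
    show "incseq (\<lambda>k x. ennreal (N k x))"
    proof (intro incseq_SucI le_funI ennreal_leI)
      fix k x
      have "ln (max (min (l x) 1) (exp (- real (Suc k)))) \<le> ln (max (min (l x) 1) (exp (- real k)))"
        by (subst ln_le_cancel_iff)
          (simp_all add: less_max_iff_disj max.coboundedI2 del: of_nat_Suc)
      then show "N k x \<le> N (Suc k) x" by (simp add: N_def)
    qed
    show "(\<lambda>x. ennreal (N k x)) \<in> borel_measurable unit_measure" for k
      unfolding N_def using measurable_l by measurable
  qed
  also have "\<dots> = (SUP k. ennreal (integral\<^sup>L unit_measure (N k)))"
    by (intro SUP_cong refl nn_integral_unit_measure_continuous contN N0)
  finally have neg: "(\<integral>\<^sup>+x. e2ennreal (- ln_ereal (l x)) \<partial>unit_measure) = (SUP k. ennreal (integral\<^sup>L unit_measure (N k)))" .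
  have ip: "integral\<^sup>L unit_measure p \<ge> 0" by (rule Bochner_Integration.integral_nonneg) (rule p0)
  have "\<not> (SUP k. ennreal (integral\<^sup>L unit_measure (N k))) \<le> ennreal (integral\<^sup>L unit_measure p)"
  proof
    assume "(SUP k. ennreal (integral\<^sup>L unit_measure (N k))) \<le> ennreal (integral\<^sup>L unit_measure p)"
    then have "enn2ereal (SUP k. ennreal (integral\<^sup>L unit_measure (N k))) \<le> enn2ereal (ennreal (integral\<^sup>L unit_measure p))"
      by (simp add: less_eq_ennreal.rep_eq)
    then have "0 \<le> enn2ereal (ennreal (integral\<^sup>L unit_measure p)) - enn2ereal (SUP k. ennreal (integral\<^sup>L unit_measure (N k)))"
      by (simp add: ereal_diff_positive)
    then show False
      using assms unfolding ereal_integral_def positive_part_ln neg p_def[abs_def] by simp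
  qed
  then obtain k where "\<not> ennreal (integral\<^sup>L unit_measure (N k)) \<le> ennreal (integral\<^sup>L unit_measure p)"
    by (meson SUP_least)
  then have k: "integral\<^sup>L unit_measure p < integral\<^sup>L unit_measure (N k)"
    using ip by (meson ennreal_leI not_le)
  have eq: "ln (max (l x) (exp (- real k))) = p x - N k x" for x
  proof -
    have "l x \<le> 1" if "l x \<le> exp (- real k)" using order_trans[OF that] by simp
    then show ?thesis unfolding p_def N_def by (auto simp: max_def min_def)
  qed
  show ?thesis
  proof (rule that[of "exp (- real k)" "integral\<^sup>L unit_measure p - integral\<^sup>L unit_measure (N k)"])
    show "((\<lambda>x. ln (max (l x) (exp (- real k)))) has_integral
        (integral\<^sup>L unit_measure p - integral\<^sup>L unit_measure (N k))) {0..1}"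
      unfolding eq by (intro has_integral_diff integral_unit_measure integrable_unit_measure_continuous contN contp)
  qed (use k in auto)
qed

text \<open>The positive part is bounded, so a positive value of the extended integral forces the negative part
  to have a finite integral. In particular zeros form a null set.\<close>

lemma positive_log_mean_integrable:
  assumes "ereal_integral unit_measure (\<lambda>x. ln_ereal (l x)) > 0" and per: "\<And>x. l (x + 1) = l x"
  obtains I where "I > 0" "negligible {x. l x = 0}" "((\<lambda>x. ln (l x)) has_integral I) {0..1}"
    "(\<lambda>x. \<bar>ln (l x)\<bar>) integrable_on {0..1}"
proof -
  define p where "p x = ln (max (l x) 1)" for x
  define n where "n x = (if l x = 0 then 0 else - ln (min (l x) 1))" for x
  have contp: "continuous_on UNIV p"
    unfolding p_def[abs_def] by (intro continuous_intros cont) (auto simp: max_def)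
  have p0: "p x \<ge> 0" for x unfolding p_def by auto
  have n0: "n x \<ge> 0" for x using nonneg[of x] unfolding n_def by (auto simp: min_def)
  have ip: "integral\<^sup>L unit_measure p \<ge> 0" by (rule Bochner_Integration.integral_nonneg) (rule p0)
  let ?neg = "\<integral>\<^sup>+x. e2ennreal (- ln_ereal (l x)) \<partial>unit_measure"
  have less: "?neg < ennreal (integral\<^sup>L unit_measure p)"
  proof (rule ccontr)
    assume "\<not> ?thesis"
    then have "enn2ereal (ennreal (integral\<^sup>L unit_measure p)) \<le> enn2ereal ?neg"
      by (simp add: less_eq_ennreal.rep_eq not_less)
    moreover have "enn2ereal (ennreal (integral\<^sup>L unit_measure p)) = ereal (integral\<^sup>L unit_measure p)"
      using ip by (simp add: enn2ereal_ennreal)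
    ultimately have "enn2ereal (ennreal (integral\<^sup>L unit_measure p)) - enn2ereal ?neg \<le> 0"
      by (cases "enn2ereal ?neg") auto
    then show False
      using assms(1) unfolding ereal_integral_def positive_part_ln p_def[abs_def] by simp
  qed
  have meas: "(\<lambda>x. e2ennreal (- ln_ereal (l x))) \<in> borel_measurable unit_measure"
    unfolding ln_ereal_def using measurable_l by measurable
  have "AE x in unit_measure. e2ennreal (- ln_ereal (l x)) \<noteq> \<infinity>"
    by (rule nn_integral_noteq_infinite[OF meas]) (use less in auto)
  then have AE: "AE x in unit_measure. l x \<noteq> 0"
    by eventually_elim (auto simp: ln_ereal_def e2ennreal_infty)
  then have "AE x in lborel. x \<in> {0..1} \<longrightarrow> l x \<noteq> 0"
    by (simp add: AE_restrict_space_iff)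
  then have "AE x in lebesgue. \<not> (x \<in> {0..1} \<and> l x = 0)"
    by (intro AE_completion) (auto elim: eventually_mono)
  then obtain N where "N \<in> null_sets lebesgue" "{x \<in> {0..1}. l x = 0} \<subseteq> N"
    by (auto simp: eventually_ae_filter)
  then have unit_null: "negligible {x \<in> {0..1}. l x = 0}"
    using negligible_iff_null_sets negligible_subset by blast
  have null: "negligible {x. l x = 0}"
  proof (rule negligible_subset)
    show "negligible (\<Union>k::int. (\<lambda>x. of_int k + x) ` {x \<in> {0..1}. l x = 0})"
    proof (intro negligible_countable_Union countableI_type countable_image)
      fix S assume "S \<in> range (\<lambda>k::int. (\<lambda>x. of_int k + x) ` {x \<in> {0..1}. l x = 0})"
      then show "negligible S" using negligible_translation[OF unit_null] by blast
    qed
    show "{x. l x = 0} \<subseteq> (\<Union>k::int. (\<lambda>x. of_int k + x) ` {x \<in> {0..1}. l x = 0})"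
    proof
      fix x assume "x \<in> {x. l x = 0}"
      then have "l (frac x) = 0"
        using periodic_add_int[of l "frac x" "\<lfloor>x\<rfloor>", OF per] by (simp add: frac_def)
      then have "frac x \<in> {x \<in> {0..1}. l x = 0}" by (simp add: frac_lt_1 less_imp_le)
      moreover have "x = of_int \<lfloor>x\<rfloor> + frac x" by (simp add: frac_def)
      ultimately have "x \<in> (\<lambda>y. of_int \<lfloor>x\<rfloor> + y) ` {x \<in> {0..1}. l x = 0}" by blast
      then show "x \<in> (\<Union>k::int. (\<lambda>x. of_int k + x) ` {x \<in> {0..1}. l x = 0})" by blast
    qed
  qed
  have neg: "?neg = (\<integral>\<^sup>+x. ennreal (n x) \<partial>unit_measure)"
  proof (rule nn_integral_cong_AE)
    show "AE x in unit_measure. e2ennreal (- ln_ereal (l x)) = ennreal (n x)"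
      using AE
    proof eventually_elim
      case (elim x)
      then show ?case using nonneg[of x] e2ennreal_neg_ln_ereal[of "l x"] by (auto simp: n_def)
    qed
  qed
  have mn: "n \<in> borel_measurable unit_measure"
    unfolding n_def[abs_def] using measurable_l by measurable
  have intn: "integrable unit_measure n"
    by (rule integrableI_nonneg[OF mn]) (use n0 less neg in \<open>auto simp: less_top[symmetric] top_unique\<close>)
  have "ennreal (integral\<^sup>L unit_measure n) < ennreal (integral\<^sup>L unit_measure p)"
    using less unfolding neg by (subst (asm) nn_integral_eq_integral[OF intn]) (use n0 in auto)
  then have I: "integral\<^sup>L unit_measure n < integral\<^sup>L unit_measure p"
    by (meson ennreal_leI not_le)
  note hn = integral_unit_measure[OF intn]
  note hp = integral_unit_measure[OF integrable_unit_measure_continuous[OF contp]]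
  have eq: "ln (l x) = p x - n x" for x
    using nonneg[of x] by (auto simp: p_def n_def max_def min_def)
  have eq': "\<bar>ln (l x)\<bar> = p x + n x" for x
    using nonneg[of x] by (auto simp: p_def n_def max_def min_def)
  show ?thesis
  proof (rule that[of "integral\<^sup>L unit_measure p - integral\<^sup>L unit_measure n"])
    show "((\<lambda>x. ln (l x)) has_integral integral\<^sup>L unit_measure p - integral\<^sup>L unit_measure n) {0..1}"
      unfolding eq by (rule has_integral_diff[OF hp hn])
    show "(\<lambda>x. \<bar>ln (l x)\<bar>) integrable_on {0..1}"
      unfolding eq' using has_integral_add[OF hp hn] by blast
  qed (use I null in auto)
qed

end


section \<open>Holomorphic maps into the projective plane\<close>

text \<open>Complex differentiability at a point for functions of two variables.\<close>

definition cdiff :: "(complex \<times> complex \<Rightarrow> complex) \<Rightarrow> complex \<times> complex \<Rightarrow> bool" where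
  "cdiff f z \<longleftrightarrow> (\<exists>a b. (f has_derivative (\<lambda>v. a * fst v + b * snd v)) (at z))"

lemma cdiffI:
  assumes "(f has_derivative f') (at z)" "\<And>v. f' v = a * fst v + b * snd v"
  shows "cdiff f z"
  using assms unfolding cdiff_def by (metis (no_types, lifting) ext)

lemma cdiffE:
  assumes "cdiff f z"
  obtains a b where "(f has_derivative (\<lambda>v. a * fst v + b * snd v)) (at z)"
  using assms unfolding cdiff_def by blast

lemma cdiff_const: "cdiff (\<lambda>_. c) z"
  by (rule cdiffI[where a = 0 and b = 0, OF has_derivative_const]) simp

lemma cdiff_fst: "cdiff fst z"
  by (rule cdiffI[OF has_derivative_fst[OF has_derivative_ident], of 1 0]) simp

lemma cdiff_snd: "cdiff snd z"
  by (rule cdiffI[OF has_derivative_snd[OF has_derivative_ident], of 0 1]) simp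

lemma cdiff_add:
  assumes "cdiff f z" "cdiff g z"
  shows "cdiff (\<lambda>x. f x + g x) z"
proof -
  obtain a b c d where "(f has_derivative (\<lambda>v. a * fst v + b * snd v)) (at z)"
    "(g has_derivative (\<lambda>v. c * fst v + d * snd v)) (at z)"
    using assms by (elim cdiffE)
  from has_derivative_add[OF this] show ?thesis
    by (rule cdiffI[where a = "a + c" and b = "b + d"]) (simp add: algebra_simps)
qed

lemma cdiff_mult:
  assumes "cdiff f z" "cdiff g z"
  shows "cdiff (\<lambda>x. f x * g x) z"
proof -
  obtain a b c d where "(f has_derivative (\<lambda>v. a * fst v + b * snd v)) (at z)"
    "(g has_derivative (\<lambda>v. c * fst v + d * snd v)) (at z)"
    using assms by (elim cdiffE)
  from has_derivative_mult[OF this] show ?thesis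
    by (rule cdiffI[where a = "f z * c + a * g z" and b = "f z * d + b * g z"]) (simp add: algebra_simps)
qed

lemma cdiff_divide:
  assumes "cdiff f z" "cdiff g z" "g z \<noteq> 0"
  shows "cdiff (\<lambda>x. f x / g x) z"
proof -
  obtain a b c d where "(f has_derivative (\<lambda>v. a * fst v + b * snd v)) (at z)"
    "(g has_derivative (\<lambda>v. c * fst v + d * snd v)) (at z)"
    using assms by (elim cdiffE)
  from has_derivative_divide[OF this assms(3)] show ?thesis
    by (rule cdiffI[where a = "a / g z - f z * c / (g z)\<^sup>2" and b = "b / g z - f z * d / (g z)\<^sup>2"])
      (use assms(3) in \<open>simp add: field_simps power2_eq_square\<close>)
qed

lemma cdiff_power: "cdiff f z \<Longrightarrow> cdiff (\<lambda>x. f x ^ n) z"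
  by (induction n) (auto intro: cdiff_const cdiff_mult)

lemma cdiff_prod: "(\<And>i. i \<in> I \<Longrightarrow> cdiff (f i) z) \<Longrightarrow> cdiff (\<lambda>x. \<Prod>i\<in>I. f i x) z"
  by (induction I rule: infinite_finite_induct) (auto intro: cdiff_const cdiff_mult)

lemma cdiff_sum: "(\<And>i. i \<in> I \<Longrightarrow> cdiff (f i) z) \<Longrightarrow> cdiff (\<lambda>x. \<Sum>i\<in>I. f i x) z"
  by (induction I rule: infinite_finite_induct) (auto intro: cdiff_const cdiff_add)

lemma cdiff_isCont: "cdiff f z \<Longrightarrow> isCont f z"
  by (auto elim!: cdiffE intro: has_derivative_continuous)

lemma cdiff_cong_eventually:
  assumes "cdiff f z" "\<forall>\<^sub>F x in nhds z. f x = g x"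
  shows "cdiff g z"
proof -
  obtain a b where "(f has_derivative (\<lambda>v. a * fst v + b * snd v)) (at z)"
    using assms(1) by (elim cdiffE)
  moreover have "f z = g z" by (rule eventually_nhds_x_imp_x[OF assms(2)])
  moreover have "\<forall>\<^sub>F x in at z. f x = g x"
    using assms(2) by (auto simp: eventually_at_filter elim: eventually_mono)
  ultimately have "(g has_derivative (\<lambda>v. a * fst v + b * snd v)) (at z)"
    using has_derivative_transform_eventually[of f _ z UNIV g] by auto
  then show ?thesis by (rule cdiffI) simp
qed

lemma cdiff_compose:
  assumes "cdiff f z" "cdiff g z" "cdiff k (f z, g z)"
  shows "cdiff (\<lambda>x. k (f x, g x)) z"
proof -
  obtain a b c d where fg: "(f has_derivative (\<lambda>v. a * fst v + b * snd v)) (at z)"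
    "(g has_derivative (\<lambda>v. c * fst v + d * snd v)) (at z)"
    using assms by (elim cdiffE)
  obtain p q where k: "(k has_derivative (\<lambda>v. p * fst v + q * snd v)) (at (f z, g z))"
    using assms by (elim cdiffE)
  from has_derivative_compose[OF has_derivative_Pair[OF fg] k] show ?thesis
    by (rule cdiffI[where a = "p * a + q * c" and b = "p * b + q * d"]) (simp add: algebra_simps)
qed

lemma cdiff_field_differentiable_snd:
  assumes "cdiff f (t, u)"
  shows "(\<lambda>v. f (t, v)) field_differentiable (at u)"
proof -
  obtain a b where f: "(f has_derivative (\<lambda>v. a * fst v + b * snd v)) (at (t, u))"
    using assms by (elim cdiffE)
  have "((\<lambda>v. (t, v)) has_derivative (\<lambda>h. (0, h))) (at u)"
    by (auto intro!: derivative_eq_intros)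
  from has_derivative_compose[OF this f] have "((\<lambda>v. f (t, v)) has_field_derivative b) (at u)"
    by (simp add: has_field_derivative_def)
  then show ?thesis by (auto simp: field_differentiable_def)
qed


lemma affine_coords_abs_cp2:
  assumes "v \<noteq> 0"
  shows "affine_coords i (abs_cp2 v) $ j = v $ j / v $ i"
proof -
  obtain c where "c \<noteq> 0" "rep_cp2 (abs_cp2 v) = c *s v" using rep_abs_cp2[OF assms] by blast
  then show ?thesis by (simp add: affine_coords_def)
qed

lemma rep_abs_cp2_nth_eq_0: "v \<noteq> 0 \<Longrightarrow> rep_cp2 (abs_cp2 v) $ i = 0 \<longleftrightarrow> v $ i = 0"
  using rep_abs_cp2[of v] by auto

lemma affine_coords_smult: "affine_coords i p = (1 / rep_cp2 p $ i) *s rep_cp2 p"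
  by (simp add: affine_coords_def vec_eq_iff)

lemma affine_coords_nth_self: "rep_cp2 p $ i \<noteq> 0 \<Longrightarrow> affine_coords i p $ i = 1"
  by (simp add: affine_coords_def)

lemma abs_affine_coords:
  assumes "rep_cp2 p $ i \<noteq> 0"
  shows "abs_cp2 (affine_coords i p) = p" and "affine_coords i p \<noteq> 0"
proof -
  show "affine_coords i p \<noteq> 0" using affine_coords_nth_self[OF assms] by auto
  show "abs_cp2 (affine_coords i p) = p"
    unfolding affine_coords_smult using assms by (simp add: abs_cp2_smult)
qed

lemma open_nonzero: "open {v::complex^3. v \<noteq> 0}"
  by (simp add: open_Collect_neq)

lemma continuous_on_abs_cp2: "continuous_on {v. v \<noteq> 0} abs_cp2"
  unfolding continuous_on_open_vimage[OF open_nonzero]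
proof (intro allI impI)
  fix B :: "cp2 set" assume "open B"
  then show "open (abs_cp2 -` B \<inter> {v. v \<noteq> 0})"
    using open_cp2_iff[of B] by (simp add: Int_def vimage_def conj_commute)
qed

lemma open_chart: "open {p. rep_cp2 p $ i \<noteq> 0}"
proof -
  have "v \<noteq> 0" if "v $ i \<noteq> 0" for v :: "complex^3" using that by auto
  then have "{v. v \<noteq> 0 \<and> abs_cp2 v \<in> {p. rep_cp2 p $ i \<noteq> 0}} = {v. v $ i \<noteq> 0}"
    by (auto simp: rep_abs_cp2_nth_eq_0)
  moreover have "open {v::complex^3. v $ i \<noteq> 0}" by (intro open_Collect_neq continuous_intros)
  ultimately show ?thesis by (simp add: open_cp2_iff)
qed

lemma continuous_on_affine_coords: "continuous_on {p. rep_cp2 p $ i \<noteq> 0} (affine_coords i)"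
  unfolding continuous_on_open_vimage[OF open_chart]
proof (intro allI impI)
  fix B :: "(complex^3) set" assume "open B"
  have "{v. v \<noteq> 0 \<and> abs_cp2 v \<in> affine_coords i -` B \<inter> {p. rep_cp2 p $ i \<noteq> 0}}
      = (\<lambda>v. \<chi> j. v $ j / v $ i) -` B \<inter> {v. v $ i \<noteq> 0}"
  proof -
    have "affine_coords i (abs_cp2 v) = (\<chi> j. v $ j / v $ i)" if "v \<noteq> 0" for v
      using that by (simp add: vec_eq_iff affine_coords_abs_cp2)
    moreover have "v \<noteq> 0" if "v $ i \<noteq> 0" for v :: "complex^3" using that by auto
    ultimately show ?thesis by (auto simp: rep_abs_cp2_nth_eq_0)
  qed
  moreover have "open ((\<lambda>v. \<chi> j. v $ j / v $ i) -` B \<inter> {v::complex^3. v $ i \<noteq> 0})"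
  proof -
    have o: "open {v::complex^3. v $ i \<noteq> 0}" by (intro open_Collect_neq continuous_intros)
    have "continuous_on {v::complex^3. v $ i \<noteq> 0} (\<lambda>v. \<chi> j. v $ j / v $ i)"
      by (intro continuous_intros) auto
    then show ?thesis using \<open>open B\<close> unfolding continuous_on_open_vimage[OF o] by blast
  qed
  ultimately show "open (affine_coords i -` B \<inter> {p. rep_cp2 p $ i \<noteq> 0})"
    by (simp add: open_cp2_iff)
qed

text \<open>Holomorphy at a point for maps into the projective plane, in all affine charts around the image
  point. Continuity is a consequence (lemma \<open>hol_cp2_isCont\<close>): the \<open>i\<close>-th affine coordinate in chart
  \<open>i\<close> is the indicator function of the domain of the chart, so its continuity keeps nearby values in
  this domain.\<close>

definition hol_cp2 :: "(complex \<times> complex \<Rightarrow> cp2) \<Rightarrow> complex \<times> complex \<Rightarrow> bool" where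
  "hol_cp2 k z \<longleftrightarrow>
     (\<forall>i. rep_cp2 (k z) $ i \<noteq> 0 \<longrightarrow> (\<forall>j. cdiff (\<lambda>y. affine_coords i (k y) $ j) z))"

lemma exists_chart: "\<exists>i. rep_cp2 p $ i \<noteq> 0"
  by (metis rep_cp2_nonzero vec_eq_iff zero_index)

lemma hol_cp2_isCont:
  assumes "hol_cp2 k z"
  shows "isCont k z"
proof -
  obtain i where i: "rep_cp2 (k z) $ i \<noteq> 0" using exists_chart by blast
  have cont: "isCont (\<lambda>y. affine_coords i (k y) $ j) z" for j
    using assms i cdiff_isCont unfolding hol_cp2_def by blast
  have "\<forall>\<^sub>F y in nhds z. affine_coords i (k y) $ i \<noteq> 0"
  proof -
    have "affine_coords i (k z) $ i \<noteq> 0" using affine_coords_nth_self[OF i] by simp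
    then show ?thesis
      using cont[of i] by (simp add: isCont_def tendsto_imp_eventually_ne eventually_nhds_conv_at)
  qed
  then have ev: "\<forall>\<^sub>F y in nhds z. abs_cp2 (affine_coords i (k y)) = k y"
  proof eventually_elim
    case (elim y)
    then have "rep_cp2 (k y) $ i \<noteq> 0" by (auto simp: affine_coords_def)
    then show ?case by (rule abs_affine_coords)
  qed
  have "isCont (\<lambda>y. affine_coords i (k y)) z"
    using cont unfolding isCont_def by (rule vec_tendstoI)
  then have c: "isCont (\<lambda>y. abs_cp2 (affine_coords i (k y))) z"
    using continuous_on_abs_cp2 abs_affine_coords(2)[OF i]
    by (intro isCont_o2[of z _ abs_cp2]) (auto simp: continuous_on_eq_continuous_at[OF open_nonzero])
  show ?thesis using isCont_cong[OF ev] c by simp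
qed

lemma isCont_eventually_in_open:
  assumes "isCont k z" "open N" "k z \<in> N"
  shows "\<forall>\<^sub>F y in nhds z. k y \<in> N"
  using topological_tendstoD[OF assms(1)[unfolded isCont_def] assms(2,3)] assms(3)
  by (simp add: eventually_nhds_conv_at)

lemma poly3_eval_smult:
  assumes "homogeneous3 d P"
  shows "poly3_eval P (c *s v) = c ^ d * poly3_eval P v"
proof -
  have "(\<Prod>i\<in>UNIV. (c * v $ i) ^ Poly_Mapping.lookup m i) = c ^ d * (\<Prod>i\<in>UNIV. (v $ i) ^ Poly_Mapping.lookup m i)"
    if "m \<in> Poly_Mapping.keys P" for m
    using assms that
    by (simp add: homogeneous3_def power_mult_distrib prod.distrib power_sum[symmetric])
  then show ?thesis
    unfolding poly3_eval_def sum_distrib_left by (intro sum.cong) (auto simp: mult_ac)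
qed

lemma cdiff_poly3_eval:
  fixes v :: "complex \<times> complex \<Rightarrow> complex^3"
  assumes "\<And>i. cdiff (\<lambda>y. v y $ i) z"
  shows "cdiff (\<lambda>y. poly3_eval P (v y)) z"
  unfolding poly3_eval_def by (intro cdiff_sum cdiff_mult cdiff_const cdiff_prod cdiff_power assms)

text \<open>By homogeneity the image has affine coordinates \<open>F\<^sub>m(v) / F\<^sub>i(v)\<close>, where \<open>v\<close> are the affine
  coordinates of the argument in any chart.\<close>

lemma hol_cp2_rat_map:
  assumes F: "rational_map d F" and k: "hol_cp2 k z" and ind: "k z \<notin> indeterminacy F"
  shows "hol_cp2 (\<lambda>y. rat_map F (k y)) z"
  unfolding hol_cp2_def
proof (intro allI impI)
  fix i m assume i: "rep_cp2 (rat_map F (k z)) $ i \<noteq> 0"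
  obtain j where j: "rep_cp2 (k z) $ j \<noteq> 0" using exists_chart by blast
  have hom: "homogeneous3 d (F n)" for n using F by (simp add: rational_map_def)
  define v where "v y = affine_coords j (k y)" for y
  have v: "cdiff (\<lambda>y. v y $ n) z" for n using k j by (simp add: hol_cp2_def v_def)
  have eq: "affine_coords i (rat_map F (k y)) $ m = poly3_eval (F m) (v y) / poly3_eval (F i) (v y)"
    if y: "rep_cp2 (k y) $ j \<noteq> 0" and nz: "k y \<notin> indeterminacy F" for y m
  proof -
    let ?w = "\<chi> i. poly3_eval (F i) (rep_cp2 (k y))"
    have "?w \<noteq> 0" using nz by (auto simp: indeterminacy_def vec_eq_iff)
    then have "affine_coords i (rat_map F (k y)) $ m = ?w $ m / ?w $ i"
      unfolding rat_map_def by (rule affine_coords_abs_cp2)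
    moreover have "poly3_eval (F n) (v y) = (1 / rep_cp2 (k y) $ j) ^ d * ?w $ n" for n
      unfolding v_def affine_coords_smult poly3_eval_smult[OF hom] by simp
    ultimately show ?thesis using y by simp
  qed
  have Fi: "poly3_eval (F i) (v z) \<noteq> 0"
  proof
    assume "poly3_eval (F i) (v z) = 0"
    then have "affine_coords i (rat_map F (k z)) $ i = 0" using eq[OF j ind, of i] by simp
    then show False using affine_coords_nth_self[OF i] by simp
  qed
  have "cdiff (\<lambda>y. poly3_eval (F m) (v y) / poly3_eval (F i) (v y)) z"
    by (intro cdiff_divide cdiff_poly3_eval v Fi)
  moreover have "\<forall>\<^sub>F y in nhds z. poly3_eval (F m) (v y) / poly3_eval (F i) (v y) = affine_coords i (rat_map F (k y)) $ m"
  proof -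
    have "isCont (\<lambda>y. poly3_eval (F i) (v y)) z" by (intro cdiff_isCont cdiff_poly3_eval v)
    then have "\<forall>\<^sub>F y in nhds z. poly3_eval (F i) (v y) \<noteq> 0"
      using Fi by (simp add: isCont_def tendsto_imp_eventually_ne eventually_nhds_conv_at)
    moreover have "\<forall>\<^sub>F y in nhds z. k y \<in> {p. rep_cp2 p $ j \<noteq> 0}"
      by (rule isCont_eventually_in_open[OF hol_cp2_isCont[OF k] open_chart]) (simp add: j)
    ultimately show ?thesis
    proof eventually_elim
      case (elim y)
      have "poly3_eval (F i) (v y) = (1 / rep_cp2 (k y) $ j) ^ d * poly3_eval (F i) (rep_cp2 (k y))"
        unfolding v_def affine_coords_smult poly3_eval_smult[OF hom] ..
      then have "k y \<notin> indeterminacy F" using elim by (auto simp: indeterminacy_def)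
      then show ?case using eq elim by simp
    qed
  qed
  ultimately show "cdiff (\<lambda>y. affine_coords i (rat_map F (k y)) $ m) z" by (rule cdiff_cong_eventually)
qed

lemma holomorphic_immersion2_hol_cp2:
  assumes "holomorphic_immersion2 S g" "z \<in> S"
  shows "hol_cp2 g z"
  unfolding hol_cp2_def
proof (intro allI impI)
  fix i j assume "rep_cp2 (g z) $ i \<noteq> 0"
  then obtain A B where "((\<lambda>y. affine_coords i (g y)) has_derivative (\<lambda>(a, b). a *s A + b *s B)) (at z)"
    using assms unfolding holomorphic_immersion2_def by blast
  from bounded_linear.has_derivative[OF bounded_linear_vec_nth this, of j]
  show "cdiff (\<lambda>y. affine_coords i (g y) $ j) z"
    by (rule cdiffI[where a = "A $ j" and b = "B $ j"]) (simp add: case_prod_beta mult.commute)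
qed


text \<open>Forgetting the constant affine coordinate turns \<open>\<psi>\<close> into a map between open subsets of \<open>\<complex>\<^sup>2\<close>.
  Its image is open by invariance of domain, and the derivative of its inverse is complex linear
  because it is the inverse of a complex linear map.\<close>

lemma local_holomorphic_inverse:
  assumes D: "open D" and imm: "holomorphic_immersion2 D \<psi>" and z0: "z0 \<in> D" and "r > 0"
    and inj: "inj_on \<psi> (ball z0 r \<inter> D)"
  obtains N g where "open N" "\<psi> z0 \<in> N" "g (\<psi> z0) = z0"
    "\<And>p. p \<in> N \<Longrightarrow> g p \<in> D \<and> dist (g p) z0 < r \<and> \<psi> (g p) = p"
    "\<And>k y. hol_cp2 k y \<Longrightarrow> k y \<in> N \<Longrightarrow>
       cdiff (\<lambda>y. fst (g (k y))) y \<and> cdiff (\<lambda>y. snd (g (k y))) y"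
proof -
  obtain i where i: "rep_cp2 (\<psi> z0) $ i \<noteq> 0" using exists_chart by blast
  obtain j1 j2 :: 3 where all: "\<And>j. j = i \<or> j = j1 \<or> j = j2"
    using exhaust_3[of i] exhaust_3 by metis
  define aff where "aff = affine_coords i"
  define \<chi>' where "\<chi>' p = (aff p $ j1, aff p $ j2)" for p
  define chart where "chart = {p. rep_cp2 p $ i \<noteq> 0}"
  define E where "E = (ball z0 r \<inter> D) \<inter> \<psi> -` chart"
  have cont\<psi>: "continuous_on D \<psi>" using imm by (simp add: holomorphic_immersion2_def)
  have openE: "open E"
    unfolding E_def chart_def
    by (intro continuous_open_preimage open_Int open_ball D open_chart continuous_on_subset[OF cont\<psi>]) auto
  have z0E: "z0 \<in> E" using z0 i \<open>r > 0\<close> by (simp add: E_def chart_def)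
  have aff_i: "aff p $ i = 1" if "p \<in> chart" for p
    using that by (simp add: aff_def chart_def affine_coords_nth_self)
  have \<chi>_inj: "p = q" if "p \<in> chart" "q \<in> chart" "\<chi>' p = \<chi>' q" for p q
  proof -
    have "aff p $ j = aff q $ j" for j
      using all[of j] that aff_i by (auto simp: \<chi>'_def)
    then have "abs_cp2 (aff p) = abs_cp2 (aff q)" by (metis vec_eq_iff)
    then show ?thesis using that abs_affine_coords(1)[of _ i] by (simp add: aff_def chart_def)
  qed
  have cont\<chi>: "continuous_on chart \<chi>'"
    unfolding \<chi>'_def[abs_def] aff_def chart_def
    by (intro continuous_intros continuous_on_affine_coords)
  define \<Phi> where "\<Phi> = (\<lambda>z. \<chi>' (\<psi> z))"
  have cont\<Phi>: "continuous_on E \<Phi>"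
    unfolding \<Phi>_def
    by (intro continuous_on_compose2[OF cont\<chi>] continuous_on_subset[OF cont\<psi>]) (auto simp: E_def)
  have inj\<Phi>: "inj_on \<Phi> E"
    using inj \<chi>_inj by (auto simp: inj_on_def \<Phi>_def E_def)
  define W where "W = \<Phi> ` E"
  have W: "open W" unfolding W_def by (rule invariance_of_domain[OF cont\<Phi> openE inj\<Phi>])
  define g0 where "g0 = inv_into E \<Phi>"
  have g0: "g0 (\<Phi> z) = z" if "z \<in> E" for z using inj\<Phi> that by (simp add: g0_def)
  have dg0: "\<exists>p q p' q'. (g0 has_derivative (\<lambda>v. (p * fst v + q * snd v, p' * fst v + q' * snd v))) (at (\<Phi> z))"
    if z: "z \<in> E" for z
  proof -
    have "rep_cp2 (\<psi> z) $ i \<noteq> 0" "z \<in> D" using z by (auto simp: E_def chart_def)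
    then obtain A B where AB: "((\<lambda>y. aff (\<psi> y)) has_derivative (\<lambda>(a, b). a *s A + b *s B)) (at z)"
      and injAB: "inj (\<lambda>(a, b). a *s A + b *s B)"
      using imm unfolding holomorphic_immersion2_def aff_def by blast
    have comp: "((\<lambda>y. aff (\<psi> y) $ j) has_derivative (\<lambda>v. fst v * A $ j + snd v * B $ j)) (at z)" for j
      using bounded_linear.has_derivative[OF bounded_linear_vec_nth AB, of j]
      by (simp add: case_prod_beta)
    have "((\<lambda>y. 1) has_derivative (\<lambda>v. fst v * A $ i + snd v * B $ i)) (at z)"
      by (rule has_derivative_transform_within_open[OF comp[of i] openE z]) (auto simp: E_def aff_i)
    then have "(\<lambda>v. fst v * A $ i + snd v * B $ i) = (\<lambda>_. 0)"
      using has_derivative_unique has_derivative_const by blast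
    then have zero: "fst v * A $ i + snd v * B $ i = 0" for v by meson
    \<comment> \<open>The \<open>i\<close>-th affine coordinate is constantly 1 in this chart.\<close>
    have ABi: "A $ i = 0" "B $ i = 0" using zero[of "(1, 0)"] zero[of "(0, 1)"] by simp_all
    have ker: "a = 0 \<and> b = 0" if "a * A $ j1 + b * B $ j1 = 0" "a * A $ j2 + b * B $ j2 = 0" for a b
    proof -
      have "a * A $ j + b * B $ j = 0" for j using all[of j] ABi that by auto
      then have "a *s A + b *s B = 0 *s A + 0 *s B" by (simp add: vec_eq_iff)
      then have "(a, b) = (0, 0)" using injD[OF injAB, of "(a, b)" "(0, 0)"] by simp
      then show ?thesis by simp
    qed
    define det where "det = A $ j1 * B $ j2 - A $ j2 * B $ j1"
    have det: "det \<noteq> 0"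
    proof
      assume "det = 0"
      \<comment> \<open>With vanishing determinant the vectors \<open>(B $ j, - A $ j)\<close> would be in the kernel.\<close>
      then have "B $ j1 = 0 \<and> - A $ j1 = 0" "B $ j2 = 0 \<and> - A $ j2 = 0"
        by (intro ker; simp add: det_def algebra_simps)+
      then show False using ker[of 1 1] by simp
    qed
    define g' where "g' v = (B $ j2 / det * fst v + - B $ j1 / det * snd v,
        - A $ j2 / det * fst v + A $ j1 / det * snd v)" for v
    have "(g0 has_derivative g') (at (\<Phi> z))"
    proof (rule has_derivative_inverse_strong[OF openE z cont\<Phi> g0])
      show "(\<Phi> has_derivative (\<lambda>v. (fst v * A $ j1 + snd v * B $ j1, fst v * A $ j2 + snd v * B $ j2))) (at z)"
        unfolding \<Phi>_def \<chi>'_def by (intro has_derivative_Pair comp)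
      have "(fst (g' v) * A $ j1 + snd (g' v) * B $ j1, fst (g' v) * A $ j2 + snd (g' v) * B $ j2) = v" for v
      proof -
        have "fst (g' v) * A $ j1 + snd (g' v) * B $ j1 = (A $ j1 * B $ j2 - A $ j2 * B $ j1) * fst v / det"
          by (simp add: g'_def diff_divide_distrib add_divide_distrib algebra_simps)
        moreover have "fst (g' v) * A $ j2 + snd (g' v) * B $ j2 = (A $ j1 * B $ j2 - A $ j2 * B $ j1) * snd v / det"
          by (simp add: g'_def diff_divide_distrib add_divide_distrib algebra_simps)
        ultimately show ?thesis using det by (simp add: det_def[symmetric])
      qed
      then show "(\<lambda>v. (fst v * A $ j1 + snd v * B $ j1, fst v * A $ j2 + snd v * B $ j2)) \<circ> g' = id"
        by (simp add: fun_eq_iff)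
    qed
    then show ?thesis unfolding g'_def[abs_def] by blast
  qed
  define N where "N = chart \<inter> \<chi>' -` W"
  define g where "g = (\<lambda>p. g0 (\<chi>' p))"
  have gN: "g p \<in> E \<and> \<psi> (g p) = p" if p: "p \<in> N" for p
  proof -
    obtain z where z: "z \<in> E" "\<chi>' p = \<Phi> z" using p by (auto simp: N_def W_def)
    then have "g p = z" by (simp add: g_def g0)
    moreover have "\<psi> z = p"
      by (rule \<chi>_inj) (use z p in \<open>auto simp: E_def N_def \<Phi>_def\<close>)
    ultimately show ?thesis using z by simp
  qed
  show ?thesis
  proof (rule that[of N g])
    show "open N" unfolding N_def
      by (rule continuous_open_preimage[OF cont\<chi> _ W]) (simp add: chart_def open_chart)
    show "\<psi> z0 \<in> N" using z0E by (auto simp: N_def W_def E_def \<Phi>_def)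
    show "g (\<psi> z0) = z0" using g0[OF z0E] by (simp add: g_def \<Phi>_def)
    show "g p \<in> D \<and> dist (g p) z0 < r \<and> \<psi> (g p) = p" if "p \<in> N" for p
      using gN[OF that] by (auto simp: E_def dist_commute)
    fix k y assume k: "hol_cp2 k y" "k y \<in> N"
    have kc: "cdiff (\<lambda>y. aff (k y) $ j) y" for j
      using k by (auto simp: hol_cp2_def N_def chart_def aff_def)
    obtain a1 b1 where 1: "((\<lambda>y. aff (k y) $ j1) has_derivative (\<lambda>v. a1 * fst v + b1 * snd v)) (at y)"
      using kc[of j1] by (elim cdiffE)
    obtain a2 b2 where 2: "((\<lambda>y. aff (k y) $ j2) has_derivative (\<lambda>v. a2 * fst v + b2 * snd v)) (at y)"
      using kc[of j2] by (elim cdiffE)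
    have "\<chi>' (k y) = \<Phi> (g (k y))" using gN[OF k(2)] by (simp add: \<Phi>_def)
    then obtain p q p' q' where
      "(g0 has_derivative (\<lambda>v. (p * fst v + q * snd v, p' * fst v + q' * snd v))) (at (aff (k y) $ j1, aff (k y) $ j2))"
      using dg0[of "g (k y)"] gN[OF k(2)] unfolding \<chi>'_def by auto
    from has_derivative_compose[OF has_derivative_Pair[OF 1 2] this]
    have *: "((\<lambda>x. g (k x)) has_derivative
        (\<lambda>v. (p * (a1 * fst v + b1 * snd v) + q * (a2 * fst v + b2 * snd v),
              p' * (a1 * fst v + b1 * snd v) + q' * (a2 * fst v + b2 * snd v)))) (at y)"
      by (simp add: g_def \<chi>'_def)
    show "cdiff (\<lambda>y. fst (g (k y))) y \<and> cdiff (\<lambda>y. snd (g (k y))) y"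
    proof
      show "cdiff (\<lambda>y. fst (g (k y))) y"
        by (rule cdiffI[OF has_derivative_fst[OF *], of "p * a1 + q * a2" "p * b1 + q * b2"])
          (simp add: algebra_simps)
      show "cdiff (\<lambda>y. snd (g (k y))) y"
        by (rule cdiffI[OF has_derivative_snd[OF *], of "p' * a1 + q' * a2" "p' * b1 + q' * b2"])
          (simp add: algebra_simps)
    qed
  qed
qed


lemma open_compl_indeterminacy:
  assumes "rational_map d F"
  shows "open (- indeterminacy F)"
proof -
  have hom: "homogeneous3 d (F n)" for n using assms by (simp add: rational_map_def)
  have "abs_cp2 v \<notin> indeterminacy F \<longleftrightarrow> (\<exists>i. poly3_eval (F i) v \<noteq> 0)" if v: "v \<noteq> 0" for v
  proof -
    obtain c where c: "c \<noteq> 0" "rep_cp2 (abs_cp2 v) = c *s v" using rep_abs_cp2[OF v] by blast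
    then show ?thesis by (simp add: indeterminacy_def poly3_eval_smult[OF hom])
  qed
  then have "{v. v \<noteq> 0 \<and> abs_cp2 v \<in> - indeterminacy F}
      = (\<Union>i. {v. v \<noteq> 0} \<inter> {v. poly3_eval (F i) v \<noteq> 0})" by auto
  moreover have "open \<dots>"
    unfolding poly3_eval_def
    by (intro open_UN ballI open_Int open_nonzero open_Collect_neq continuous_intros)
  ultimately show ?thesis by (simp add: open_cp2_iff)
qed


section \<open>Collars of a horizontal line and slices of holomorphic maps\<close>

lemma Schwarz_lemma_scaled:
  assumes hol: "f holomorphic_on ball 0 r" and "f 0 = 0" and "r > 0" "M > 0"
    and bd: "\<And>z. cmod z < r \<Longrightarrow> cmod (f z) < M" and z: "cmod z < r"
  shows "cmod (f z) \<le> M / r * cmod z"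
proof -
  define g where "g w = f (of_real r * w) / of_real M" for w
  have "(\<lambda>w. of_real r * w) ` ball 0 1 \<subseteq> ball (0::complex) r"
    using \<open>r > 0\<close> by (auto simp: norm_mult)
  then have "g holomorphic_on ball 0 1"
    unfolding g_def[abs_def] using \<open>M > 0\<close>
    by (intro holomorphic_intros holomorphic_on_compose_gen[OF _ hol, unfolded o_def]) auto
  moreover have "cmod (g w) < 1" if "cmod w < 1" for w
    using bd[of "of_real r * w"] that \<open>r > 0\<close> \<open>M > 0\<close> by (simp add: g_def norm_divide norm_mult)
  moreover have "cmod (z / of_real r) < 1" using z \<open>r > 0\<close> by (simp add: norm_divide)
  moreover have "g 0 = 0" by (simp add: g_def \<open>f 0 = 0\<close>)
  ultimately have "cmod (g (z / of_real r)) \<le> cmod (z / of_real r)"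
    using Schwarz_Lemma(1)[of g "z / of_real r"] by blast
  then show ?thesis using \<open>r > 0\<close> \<open>M > 0\<close> by (simp add: g_def norm_divide field_simps)
qed

lemma uniformly_close_slices:
  fixes f :: "complex \<times> complex \<Rightarrow> complex"
  assumes cont: "continuous_on (cball t0 r \<times> cball 0 r) f" and "r > 0" "e > 0"
  shows "\<forall>\<^sub>F t in nhds t0. \<forall>u. cmod u \<le> r \<longrightarrow> cmod (f (t, u) - f (t0, u)) < e"
proof -
  have "uniformly_continuous_on (cball t0 r \<times> cball 0 r) f"
    using cont by (intro compact_uniformly_continuous compact_Times) auto
  then obtain d where d: "d > 0" "\<And>x y. x \<in> cball t0 r \<times> cball 0 r \<Longrightarrow> y \<in> cball t0 r \<times> cball 0 r \<Longrightarrow>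
      dist y x < d \<Longrightarrow> dist (f y) (f x) < e"
    using \<open>e > 0\<close> unfolding uniformly_continuous_on_def by metis
  have "\<forall>\<^sub>F t in nhds t0. dist t t0 < min d r"
    using d(1) \<open>r > 0\<close> by (intro eventually_nhds_metric[THEN iffD2] exI[of _ "min d r"]) auto
  then show ?thesis
  proof eventually_elim
    case (elim t)
    show ?case
    proof (intro allI impI)
      fix u :: complex assume u: "cmod u \<le> r"
      have "dist (t, u) (t0, u) < d" using elim by (simp add: dist_Pair_Pair)
      then have "dist (f (t, u)) (f (t0, u)) < e"
        using elim u \<open>r > 0\<close> by (intro d(2)) (auto simp: dist_commute)
      then show "cmod (f (t, u) - f (t0, u)) < e" by (simp add: dist_norm)
    qed
  qed
qed

text \<open>A neighborhood of the circle \<open>Im t = h\<close>, \<open>u = 0\<close>, seen in the universal cover.\<close>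

definition collar :: "real \<Rightarrow> real \<Rightarrow> (complex \<times> complex) set" where
  "collar h \<rho> = {(t, u). \<bar>Im t - h\<bar> < \<rho> \<and> cmod u < \<rho>}"

lemma collar_iff [simp]: "(t, u) \<in> collar h \<rho> \<longleftrightarrow> \<bar>Im t - h\<bar> < \<rho> \<and> cmod u < \<rho>"
  by (simp add: collar_def)

lemma collar_mono: "\<rho> \<le> \<rho>' \<Longrightarrow> collar h \<rho> \<subseteq> collar h \<rho>'"
  by (auto simp: collar_def)

lemma open_collar: "open (collar h \<rho>)"
  unfolding collar_def case_prod_beta
  by (intro open_Collect_conj open_Collect_less continuous_intros)

text \<open>Compactness of the circle in the cylinder \<open>\<complex>/\<int>\<close>, expressed for 1-periodic properties.\<close>

lemma periodic_neighborhood_contains_collar: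
  fixes P :: "complex \<times> complex \<Rightarrow> bool"
  assumes near: "\<And>t. Im t = h \<Longrightarrow> \<forall>\<^sub>F y in nhds (t, 0). P y"
    and per: "\<And>t u. P (t + 1, u) = P (t, u)"
  obtains \<rho> where "\<rho> > 0" "\<And>y. y \<in> collar h \<rho> \<Longrightarrow> P y"
proof -
  define K where "K = (\<lambda>x. (Complex x h, 0::complex)) ` {0..1}"
  have "continuous_on {0..1} (\<lambda>x. (Complex x h, 0::complex))"
    by (intro continuous_on_Pair continuous_on_const) (auto simp: Complex_eq intro!: continuous_intros)
  then have "compact K" unfolding K_def by (rule compact_continuous_image) simp
  moreover have "K \<subseteq> interior {y. P y}"
    using near by (force simp: K_def eventually_nhds interior_def)
  ultimately obtain e where e: "e > 0" "(\<Union>x\<in>K. ball x e) \<subseteq> interior {y. P y}"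
    using compact_subset_open_imp_ball_epsilon_subset[of K "interior {y. P y}"] by auto
  show ?thesis
  proof (rule that[of "e / 2"])
    fix y assume y: "y \<in> collar h (e / 2)"
    obtain t u where tu: "y = (t, u)" by (cases y)
    define n where "n = \<lfloor>Re t\<rfloor>"
    define s where "s = t - of_int n"
    have s: "Re s \<in> {0..1}" unfolding s_def n_def by (simp; linarith)
    have "dist (Complex (Re s) h, 0) (s, u) \<le> dist (Complex (Re s) h) s + dist 0 u"
      unfolding dist_Pair_Pair by (rule sqrt_sum_squares_le_sum) auto
    also have "dist (Complex (Re s) h) s = \<bar>Im t - h\<bar>"
      by (simp add: dist_norm s_def cmod_def complex_eq_iff)
    also have "\<bar>Im t - h\<bar> + dist 0 u < e" using y tu by simp
    finally have "(s, u) \<in> (\<Union>x\<in>K. ball x e)" using s unfolding K_def by auto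
    then have "P (s, u)" using e(2) interior_subset by blast
    moreover have "P (s + of_int n, u) = P (s, u)"
      by (rule periodic_add_int[of "\<lambda>t. P (t, u)"]) (rule per)
    ultimately show "P y" by (simp add: tu s_def)
  qed (use e in auto)
qed

lemma cdiff_shift:
  assumes "cdiff f (t, u)"
  shows "cdiff (\<lambda>z. f (fst z + c, snd z)) (t - c, u)"
  by (rule cdiff_compose) (auto intro: cdiff_add cdiff_fst cdiff_snd cdiff_const simp: assms)

lemma small_int_zero:
  assumes "t \<in> \<int>" "cmod t < 1"
  shows "t = 0"
proof -
  obtain n where n: "t = of_int n" using assms(1) by (elim Ints_cases)
  then have "\<bar>n\<bar> < 1" using assms(2) by (simp flip: of_int_abs)
  then show ?thesis using n by simp
qed


section \<open>The rational map in coordinates near an invariant circle\<close>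

locale herman_circle =
  fixes F :: "3 \<Rightarrow> poly3" and d :: nat
    and H :: "cp2 set" and h0 h1 :: ereal and \<alpha> :: real and \<gamma> :: "complex \<Rightarrow> cp2"
    and h :: real and D :: "(complex \<times> complex) set" and \<psi> :: "complex \<times> complex \<Rightarrow> cp2"
  assumes rational: "rational_map d F"
    and herman: "herman_ring F H h0 h1 \<alpha> \<gamma>"
    and above: "h0 < ereal h" and below: "ereal h < h1"
    and coords: "ring_coordinates H h0 h1 \<gamma> h D \<psi>"
begin

abbreviation "f \<equiv> rat_map F"

lemma irrational: "\<alpha> \<notin> \<rat>"
  and H_eq: "H = \<gamma> ` strip h0 h1"
  and \<gamma>_cont: "continuous_on (strip h0 h1) \<gamma>"
  and \<gamma>_eq_iff: "s \<in> strip h0 h1 \<Longrightarrow> t \<in> strip h0 h1 \<Longrightarrow> \<gamma> s = \<gamma> t \<longleftrightarrow> s - t \<in> \<int>"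
  and \<gamma>_determinate: "t \<in> strip h0 h1 \<Longrightarrow> \<gamma> t \<notin> indeterminacy F"
  and f_\<gamma>: "t \<in> strip h0 h1 \<Longrightarrow> f (\<gamma> t) = \<gamma> (t + of_real \<alpha>)"
  using herman by (auto simp: herman_ring_def holomorphic_immersion1_def)

lemma open_D: "open D"
  and D_periodic: "(t + 1, u) \<in> D \<longleftrightarrow> (t, u) \<in> D"
  and \<psi>_immersion: "holomorphic_immersion2 D \<psi>"
  and open_image_\<psi>: "open (\<psi> ` D)"
  and \<psi>_eq_iff: "(t, u) \<in> D \<Longrightarrow> (t', u') \<in> D \<Longrightarrow> \<psi> (t, u) = \<psi> (t', u') \<longleftrightarrow> t - t' \<in> \<int> \<and> u = u'"
  and circle_subset: "ring_circle \<gamma> h \<subseteq> \<psi> ` D"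
  and \<psi>_in_H: "(t, u) \<in> D \<Longrightarrow> \<psi> (t, u) \<in> H \<Longrightarrow> u = 0 \<and> t \<in> strip h0 h1 \<and> \<gamma> t = \<psi> (t, u)"
  using coords unfolding ring_coordinates_def by blast+

lemma \<psi>_cont: "continuous_on D \<psi>"
  using \<psi>_immersion by (simp add: holomorphic_immersion2_def)

lemma hol_\<psi>: "y \<in> D \<Longrightarrow> hol_cp2 \<psi> y"
  by (rule holomorphic_immersion2_hol_cp2[OF \<psi>_immersion])

lemma \<psi>_periodic:
  assumes "(t, u) \<in> D"
  shows "\<psi> (t + 1, u) = \<psi> (t, u)"
  using \<psi>_eq_iff[of "t + 1" u t u] assms D_periodic by simp

lemma open_strip: "open (strip h0 h1)"
proof -
  have "strip h0 h1 = {t. h0 < ereal (Im t)} \<inter> {t. ereal (Im t) < h1}" by (auto simp: strip_def)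
  moreover have "open {t. h0 < ereal (Im t)}" "open {t. ereal (Im t) < h1}"
    by (auto intro!: open_Collect_less continuous_intros continuous_on_ereal)
  ultimately show ?thesis by (simp add: open_Int)
qed

lemma line_in_strip: "Im t = h \<Longrightarrow> t \<in> strip h0 h1"
  using above below by (simp add: strip_def)

text \<open>The parametrization \<open>\<gamma>\<close> of the ring and the zero section of the coordinates agree wherever both are
  defined, not only modulo 1, because \<open>D\<close> is invariant under integer translations.\<close>

lemma \<gamma>_eq_\<psi>:
  assumes "t \<in> strip h0 h1" "\<gamma> t \<in> \<psi> ` D"
  shows "(t, 0) \<in> D \<and> \<psi> (t, 0) = \<gamma> t"
proof -
  obtain t' u' where tu: "(t', u') \<in> D" "\<gamma> t = \<psi> (t', u')" using assms(2) by auto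
  have "\<gamma> t \<in> H" using assms(1) H_eq by blast
  then have *: "u' = 0" "t' \<in> strip h0 h1" "\<gamma> t' = \<gamma> t" using \<psi>_in_H[OF tu(1)] tu(2) by auto
  then obtain n where "t - t' = of_int n" using \<gamma>_eq_iff[OF assms(1), of t'] by (auto elim: Ints_cases)
  then have t: "t = t' + of_int n" by (simp add: algebra_simps)
  have "((t', 0) \<in> D) = ((t, 0) \<in> D)"
    using periodic_add_int[of "\<lambda>t. (t, 0) \<in> D" t' n] D_periodic t by auto
  then have D: "(t, 0) \<in> D" using tu * by simp
  then have "\<psi> (t, 0) = \<psi> (t', 0)" using \<psi>_eq_iff tu * t by auto
  then show ?thesis using D tu * by simp
qed

lemma line_in_D:
  assumes "Im t = h"
  shows "(t, 0) \<in> D" "\<psi> (t, 0) = \<gamma> t"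
  using \<gamma>_eq_\<psi>[OF line_in_strip[OF assms]] circle_subset assms by (auto simp: ring_circle_def)

lemma near_line:
  assumes "Im t = h"
  shows "\<forall>\<^sub>F s in nhds t. s \<in> strip h0 h1 \<and> (s, 0) \<in> D \<and> \<psi> (s, 0) = \<gamma> s"
proof -
  have t: "t \<in> strip h0 h1" by (rule line_in_strip[OF assms])
  have "isCont \<gamma> t" using \<gamma>_cont t by (simp add: continuous_on_eq_continuous_at[OF open_strip])
  then have "\<forall>\<^sub>F s in nhds t. \<gamma> s \<in> \<psi> ` D"
    by (rule isCont_eventually_in_open[OF _ open_image_\<psi>])
      (use circle_subset assms in \<open>auto simp: ring_circle_def\<close>)
  moreover have "\<forall>\<^sub>F s in nhds t. s \<in> strip h0 h1"
    using eventually_nhds_in_open[OF open_strip t] .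
  ultimately show ?thesis by eventually_elim (use \<gamma>_eq_\<psi> in auto)
qed

text \<open>The map in coordinates. The coordinate \<open>t\<close> is only determined modulo 1; the condition on the
  distance to \<open>t + \<alpha>\<close> selects the representative for which the circle is rotated by \<open>\<alpha>\<close> itself.\<close>

definition lift :: "complex \<times> complex \<Rightarrow> complex \<times> complex" where
  "lift y = (THE z. z \<in> D \<and> \<psi> z = f (\<psi> y) \<and> cmod (fst z - fst y - of_real \<alpha>) < 1 / 2)"

definition liftable :: "complex \<times> complex \<Rightarrow> bool" where
  "liftable y \<longleftrightarrow> y \<in> D \<and> \<psi> y \<notin> indeterminacy F \<and>
     (\<exists>z\<in>D. \<psi> z = f (\<psi> y) \<and> cmod (fst z - fst y - of_real \<alpha>) < 1 / 2)"

lemma lift_eqI: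
  assumes "z \<in> D" "\<psi> z = f (\<psi> y)" "cmod (fst z - fst y - of_real \<alpha>) < 1 / 2"
  shows "lift y = z"
  unfolding lift_def
proof (rule the_equality)
  fix w assume w: "w \<in> D \<and> \<psi> w = f (\<psi> y) \<and> cmod (fst w - fst y - of_real \<alpha>) < 1 / 2"
  have "fst w - fst z \<in> \<int> \<and> snd w = snd z"
    using \<psi>_eq_iff[of "fst w" "snd w" "fst z" "snd z"] w assms by simp
  moreover have "cmod (fst w - fst z) < 1"
    using norm_triangle_ineq4[of "fst w - fst y - of_real \<alpha>" "fst z - fst y - of_real \<alpha>"] w assms(3) by simp
  ultimately show "w = z" using small_int_zero[of "fst w - fst z"] by (simp add: prod_eq_iff)
qed (use assms in auto)

lemma lift_props:
  assumes "liftable y"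
  shows "lift y \<in> D" "\<psi> (lift y) = f (\<psi> y)" "cmod (fst (lift y) - fst y - of_real \<alpha>) < 1 / 2"
  using assms lift_eqI unfolding liftable_def by metis+

lemma liftable_shift:
  assumes "liftable (t, u)"
  shows "liftable (t + 1, u)" "lift (t + 1, u) = (fst (lift (t, u)) + 1, snd (lift (t, u)))"
proof -
  let ?z = "lift (t, u)" and ?w = "(fst (lift (t, u)) + 1, snd (lift (t, u)))"
  have D: "(t, u) \<in> D" "\<psi> (t, u) \<notin> indeterminacy F" using assms by (auto simp: liftable_def)
  note z = lift_props[OF assms]
  have w: "?w \<in> D" using z D_periodic by simp
  have "\<psi> ?w = \<psi> ?z" using \<psi>_periodic[of "fst ?z" "snd ?z"] z by simp
  then have w': "\<psi> ?w = f (\<psi> (t + 1, u))" using z \<psi>_periodic[OF D(1)] by simp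
  have w'': "cmod (fst ?w - fst (t + 1, u) - of_real \<alpha>) < 1 / 2" using z by simp
  show "liftable (t + 1, u)"
    using w w' w'' D D_periodic \<psi>_periodic[OF D(1)] unfolding liftable_def by auto
  show "lift (t + 1, u) = ?w" by (rule lift_eqI[OF w w' w''])
qed

lemma liftable_shift_back:
  assumes "liftable (t + 1, u)"
  shows "liftable (t, u)"
proof -
  let ?z = "lift (t + 1, u)" and ?w = "(fst (lift (t + 1, u)) - 1, snd (lift (t + 1, u)))"
  have D: "(t, u) \<in> D" using assms D_periodic by (auto simp: liftable_def)
  note z = lift_props[OF assms]
  have w: "?w \<in> D" using z(1) D_periodic[of "fst ?z - 1" "snd ?z"] by simp
  have "\<psi> ?w = \<psi> ?z" using \<psi>_periodic[of "fst ?z - 1" "snd ?z"] w by simp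
  then have w': "\<psi> ?w = f (\<psi> (t, u))" using z \<psi>_periodic[OF D] by simp
  have "cmod (fst ?w - fst (t, u) - of_real \<alpha>) < 1 / 2" using z(3) by (simp add: algebra_simps)
  then show ?thesis using w w' D assms \<psi>_periodic[OF D] unfolding liftable_def by auto
qed

lemma \<psi>_inj_small_ball: "inj_on \<psi> (ball z (1 / 2) \<inter> D)"
proof (rule inj_onI)
  fix x y assume xy: "x \<in> ball z (1 / 2) \<inter> D" "y \<in> ball z (1 / 2) \<inter> D" "\<psi> x = \<psi> y"
  have *: "fst x - fst y \<in> \<int> \<and> snd x = snd y"
    using \<psi>_eq_iff[of "fst x" "snd x" "fst y" "snd y"] xy by simp
  have "cmod (fst x - fst y) \<le> dist x y" using dist_fst_le[of x y] by (simp add: dist_norm)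
  also have "\<dots> < 1" using dist_triangle2[of x y z] xy by (simp add: dist_commute)
  finally show "x = y" using small_int_zero[of "fst x - fst y"] * by (simp add: prod_eq_iff)
qed

lemma lift_locally_holomorphic:
  assumes t: "Im t = h"
  shows "\<forall>\<^sub>F y in nhds (t, 0). liftable y \<and> cdiff (\<lambda>y. fst (lift y)) y \<and> cdiff (\<lambda>y. snd (lift y)) y"
proof -
  let ?z = "(t + of_real \<alpha>, 0)"
  have t': "Im (t + of_real \<alpha>) = h" using t by simp
  obtain N g where N: "open N" "\<psi> ?z \<in> N" "g (\<psi> ?z) = ?z"
    "\<And>p. p \<in> N \<Longrightarrow> g p \<in> D \<and> dist (g p) ?z < 1 / 4 \<and> \<psi> (g p) = p"
    "\<And>k y. hol_cp2 k y \<Longrightarrow> k y \<in> N \<Longrightarrow>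
       cdiff (\<lambda>y. fst (g (k y))) y \<and> cdiff (\<lambda>y. snd (g (k y))) y"
    using local_holomorphic_inverse[OF open_D \<psi>_immersion line_in_D(1)[OF t'], of "1 / 4"]
      inj_on_subset[OF \<psi>_inj_small_ball[of ?z], of "ball ?z (1 / 4) \<inter> D"]
    by (auto simp: subset_iff)
  have det: "\<psi> (t, 0) \<notin> indeterminacy F"
    using line_in_D[OF t] \<gamma>_determinate[OF line_in_strip[OF t]] by simp
  have fz: "f (\<psi> (t, 0)) = \<psi> ?z"
    using line_in_D(2)[OF t] line_in_D(2)[OF t'] f_\<gamma>[OF line_in_strip[OF t]] by simp
  have hol: "hol_cp2 (\<lambda>y. f (\<psi> y)) y" if "y \<in> D" "\<psi> y \<notin> indeterminacy F" for y
    using hol_cp2_rat_map[OF rational hol_\<psi>[OF that(1)] that(2)] .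
  have "\<forall>\<^sub>F y in nhds (t, 0). y \<in> D \<and> \<psi> y \<in> - indeterminacy F \<and> f (\<psi> y) \<in> N \<and> dist y (t, 0) < 1 / 4"
  proof (intro eventually_conj)
    show "\<forall>\<^sub>F y in nhds (t, 0). y \<in> D" by (rule eventually_nhds_in_open[OF open_D line_in_D(1)[OF t]])
    show "\<forall>\<^sub>F y in nhds (t, 0). \<psi> y \<in> - indeterminacy F"
      by (rule isCont_eventually_in_open[OF hol_cp2_isCont[OF hol_\<psi>] open_compl_indeterminacy[OF rational]])
        (use det line_in_D(1)[OF t] in auto)
    show "\<forall>\<^sub>F y in nhds (t, 0). f (\<psi> y) \<in> N"
      by (rule isCont_eventually_in_open[OF hol_cp2_isCont[OF hol] N(1)])
        (use det line_in_D(1)[OF t] N fz in auto)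
    show "\<forall>\<^sub>F y in nhds (t, 0). dist y (t, 0) < 1 / 4"
      by (rule eventually_nhds_metric[THEN iffD2]) (auto intro!: exI[of _ "1/4"])
  qed
  then have ev: "\<forall>\<^sub>F y in nhds (t, 0). y \<in> D \<and> \<psi> y \<notin> indeterminacy F \<and> f (\<psi> y) \<in> N \<and>
      liftable y \<and> lift y = g (f (\<psi> y))"
  proof eventually_elim
    case (elim y)
    let ?w = "g (f (\<psi> y))"
    have w: "?w \<in> D" "dist ?w ?z < 1 / 4" "\<psi> ?w = f (\<psi> y)" using N(4) elim by auto
    have 1: "cmod (fst ?w - (t + of_real \<alpha>)) < 1 / 4"
      using dist_fst_le[of ?w ?z] w(2) by (simp add: dist_norm)
    have 2: "cmod (fst y - t) < 1 / 4"
      using dist_fst_le[of y "(t, 0)"] elim by (simp add: dist_norm)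
    have "cmod (fst ?w - fst y - of_real \<alpha>) \<le> cmod (fst ?w - (t + of_real \<alpha>)) + cmod (fst y - t)"
      using norm_triangle_ineq4[of "fst ?w - (t + of_real \<alpha>)" "fst y - t"] by (simp add: algebra_simps)
    then have "cmod (fst ?w - fst y - of_real \<alpha>) < 1 / 2" using 1 2 by simp
    then show ?case using w elim lift_eqI unfolding liftable_def by auto
  qed
  have "\<forall>\<^sub>F y in nhds (t, 0). \<forall>\<^sub>F x in nhds y. g (f (\<psi> x)) = lift x"
    unfolding eventually_eventually using ev by eventually_elim simp
  with ev show ?thesis
  proof eventually_elim
    case (elim y)
    have "cdiff (\<lambda>y. fst (g (f (\<psi> y)))) y \<and> cdiff (\<lambda>y. snd (g (f (\<psi> y)))) y"
      using N(5)[of "\<lambda>y. f (\<psi> y)" y] hol elim by auto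
    moreover have "cdiff (\<lambda>y. fst (lift y)) y" if "cdiff (\<lambda>y. fst (g (f (\<psi> y)))) y"
      by (rule cdiff_cong_eventually[OF that eventually_mono[OF elim(2)]]) simp
    moreover have "cdiff (\<lambda>y. snd (lift y)) y" if "cdiff (\<lambda>y. snd (g (f (\<psi> y)))) y"
      by (rule cdiff_cong_eventually[OF that eventually_mono[OF elim(2)]]) simp
    ultimately show ?case using elim by auto
  qed
qed

text \<open>Holomorphy of the lift and its behavior on the ring hold near every point of the circle; by
  compactness there is one collar on which they hold, the collar of radius \<open>width\<close> from here on.\<close>

lemma exists_width:
  "\<exists>\<rho>>0. (\<forall>y\<in>collar h \<rho>. liftable y \<and> cdiff (\<lambda>y. fst (lift y)) y \<and> cdiff (\<lambda>y. snd (lift y)) y) \<and>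
     (\<forall>t. \<bar>Im t - h\<bar> < \<rho> \<longrightarrow> t \<in> strip h0 h1 \<and> (t, 0) \<in> D \<and> \<psi> (t, 0) = \<gamma> t)"
proof -
  obtain r1 where r1: "r1 > 0" "\<And>y. y \<in> collar h r1 \<Longrightarrow> liftable y"
  proof (rule periodic_neighborhood_contains_collar[of h liftable])
    show "\<forall>\<^sub>F y in nhds (t, 0). liftable y" if "Im t = h" for t
      using lift_locally_holomorphic[OF that] by eventually_elim simp
    show "liftable (t + 1, u) = liftable (t, u)" for t u
      using liftable_shift liftable_shift_back by blast
  qed (blast intro: that)
  let ?hol = "\<lambda>y. cdiff (\<lambda>y. fst (lift y)) y \<and> cdiff (\<lambda>y. snd (lift y)) y"
  obtain r2 where r2: "r2 > 0" "\<And>y. y \<in> collar h r2 \<Longrightarrow> y \<in> collar h r1 \<and> ?hol y"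
  proof (rule periodic_neighborhood_contains_collar[of h "\<lambda>y. y \<in> collar h r1 \<and> ?hol y"])
    show "\<forall>\<^sub>F y in nhds (t, 0). y \<in> collar h r1 \<and> ?hol y" if "Im t = h" for t
      using lift_locally_holomorphic[OF that] eventually_nhds_in_open[OF open_collar, of "(t, 0)" h r1] that r1(1)
      by (simp add: eventually_conj_iff)
    fix t u
    have ev: "\<forall>\<^sub>F y in nhds (t, u). y \<in> collar h r1" if "(t, u) \<in> collar h r1" for t u
      by (rule eventually_nhds_in_open[OF open_collar that])
    have shift: "lift (fst y + 1, snd y) = (fst (lift y) + 1, snd (lift y))" if "y \<in> collar h r1" for y
      using liftable_shift(2)[of "fst y" "snd y"] r1(2)[OF that] by simp
    show "((t + 1, u) \<in> collar h r1 \<and> ?hol (t + 1, u)) = ((t, u) \<in> collar h r1 \<and> ?hol (t, u))"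
    proof (intro iffI conjI; elim conjE)
      assume a: "(t + 1, u) \<in> collar h r1" "cdiff (\<lambda>y. fst (lift y)) (t + 1, u)" "cdiff (\<lambda>y. snd (lift y)) (t + 1, u)"
      show c: "(t, u) \<in> collar h r1" using a by simp
      show "cdiff (\<lambda>y. fst (lift y)) (t, u)"
        by (rule cdiff_cong_eventually[OF cdiff_add[OF cdiff_shift[OF a(2), of 1, simplified] cdiff_const[of "-1"]]])
          (rule eventually_mono[OF ev[OF c]], simp add: shift)
      show "cdiff (\<lambda>y. snd (lift y)) (t, u)"
        by (rule cdiff_cong_eventually[OF cdiff_shift[OF a(3), of 1, simplified]])
          (rule eventually_mono[OF ev[OF c]], simp add: shift)
    next
      assume a: "(t, u) \<in> collar h r1" "cdiff (\<lambda>y. fst (lift y)) (t, u)" "cdiff (\<lambda>y. snd (lift y)) (t, u)"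
      show c: "(t + 1, u) \<in> collar h r1" using a by simp
      have shift': "lift y = (fst (lift (fst y - 1, snd y)) + 1, snd (lift (fst y - 1, snd y)))"
        if "y \<in> collar h r1" for y
        using shift[of "(fst y - 1, snd y)"] that by (cases y) simp
      show "cdiff (\<lambda>y. fst (lift y)) (t + 1, u)"
        by (rule cdiff_cong_eventually[OF cdiff_add[OF cdiff_shift[OF a(2), of "-1", simplified] cdiff_const[of 1]]])
          (rule eventually_mono[OF ev[OF c]], simp add: shift')
      show "cdiff (\<lambda>y. snd (lift y)) (t + 1, u)"
        by (rule cdiff_cong_eventually[OF cdiff_shift[OF a(3), of "-1", simplified]])
          (rule eventually_mono[OF ev[OF c]], simp add: shift')
    qed
  qed (blast intro: that)
  let ?ax = "\<lambda>t. t \<in> strip h0 h1 \<and> (t, 0) \<in> D \<and> \<psi> (t, 0) = \<gamma> t"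
  obtain r3 where r3: "r3 > 0" "\<And>y. y \<in> collar h r3 \<Longrightarrow> ?ax (fst y)"
  proof (rule periodic_neighborhood_contains_collar[of h "\<lambda>y. ?ax (fst y)"])
    show "\<forall>\<^sub>F y in nhds (t, 0::complex). ?ax (fst y)" if "Im t = h" for t
    proof -
      have "filterlim fst (nhds t) (nhds (t, 0::complex))"
        using tendsto_fst[OF filterlim_ident, of "(t, 0::complex)"] by simp
      from filterlim_iff[THEN iffD1, OF this, rule_format, OF near_line[OF that]] show ?thesis .
    qed
    fix t u :: complex
    have "t + 1 \<in> strip h0 h1 \<longleftrightarrow> t \<in> strip h0 h1" by (simp add: strip_def)
    moreover have "\<gamma> (t + 1) = \<gamma> t" if "t \<in> strip h0 h1"
      using \<gamma>_eq_iff[of "t + 1" t] that calculation by simp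
    ultimately show "?ax (fst (t + 1, u)) = ?ax (fst (t, u))"
      using D_periodic \<psi>_periodic by auto
  qed (blast intro: that)
  show ?thesis
  proof (intro exI[of _ "min r2 r3"] conjI ballI allI impI)
    fix y assume "y \<in> collar h (min r2 r3)"
    then have "y \<in> collar h r2" using collar_mono[of "min r2 r3" r2 h] by auto
    then show "liftable y" "cdiff (\<lambda>y. fst (lift y)) y" "cdiff (\<lambda>y. snd (lift y)) y"
      using r2(2) r1(2) by auto
  next
    fix t assume "\<bar>Im t - h\<bar> < min r2 r3"
    then have "(t, 0) \<in> collar h r3" using r3(1) by simp
    from r3(2)[OF this] show "t \<in> strip h0 h1" "(t, 0) \<in> D" "\<psi> (t, 0) = \<gamma> t" by auto
  qed (use r2 r3 in auto)
qed

definition width :: real where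
  "width = (SOME \<rho>. \<rho> > 0 \<and>
     (\<forall>y\<in>collar h \<rho>. liftable y \<and> cdiff (\<lambda>y. fst (lift y)) y \<and> cdiff (\<lambda>y. snd (lift y)) y) \<and>
     (\<forall>t. \<bar>Im t - h\<bar> < \<rho> \<longrightarrow> t \<in> strip h0 h1 \<and> (t, 0) \<in> D \<and> \<psi> (t, 0) = \<gamma> t))"

lemma width_pos: "width > 0"
  and collar_liftable: "y \<in> collar h width \<Longrightarrow> liftable y"
  and collar_holomorphic: "y \<in> collar h width \<Longrightarrow> cdiff (\<lambda>y. fst (lift y)) y"
     "y \<in> collar h width \<Longrightarrow> cdiff (\<lambda>y. snd (lift y)) y"
  and near_axis: "\<bar>Im t - h\<bar> < width \<Longrightarrow> t \<in> strip h0 h1"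
     "\<bar>Im t - h\<bar> < width \<Longrightarrow> (t, 0) \<in> D"
     "\<bar>Im t - h\<bar> < width \<Longrightarrow> \<psi> (t, 0) = \<gamma> t"
  using someI_ex[OF exists_width] unfolding width_def[symmetric] by blast+

lemma collar_in_D: "y \<in> collar h width \<Longrightarrow> y \<in> D"
  using collar_liftable by (simp add: liftable_def)

lemma lift_axis:
  assumes "\<bar>Im t - h\<bar> < width"
  shows "lift (t, 0) = (t + of_real \<alpha>, 0)"
proof (rule lift_eqI)
  have "\<bar>Im (t + of_real \<alpha>) - h\<bar> < width" using assms by simp
  from near_axis[OF this] near_axis[OF assms]
  show "(t + of_real \<alpha>, 0) \<in> D" "\<psi> (t + of_real \<alpha>, 0) = f (\<psi> (t, 0))" using f_\<gamma> by auto
qed simp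

lemma slice_holomorphic:
  assumes "\<bar>Im t - h\<bar> < width"
  shows "(\<lambda>u. fst (lift (t, u))) holomorphic_on ball 0 width"
    and "(\<lambda>u. snd (lift (t, u))) holomorphic_on ball 0 width"
  unfolding holomorphic_on_def
  using assms collar_holomorphic
  by (auto intro!: field_differentiable_at_within
      cdiff_field_differentiable_snd[of "\<lambda>y. fst (lift y)"] cdiff_field_differentiable_snd[of "\<lambda>y. snd (lift y)"])

text \<open>On the ring the lift is exactly the rotation, so the deviation vanishes at \<open>u = 0\<close>; it is bounded by
  the choice of the lift, and the Schwarz lemma makes it \<open>O(|u|)\<close>.\<close>

lemma lift_fst_bound:
  assumes "y \<in> collar h width"
  shows "cmod (fst (lift y) - fst y - of_real \<alpha>) \<le> cmod (snd y) / width"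
proof -
  obtain t u where y: "y = (t, u)" by (cases y)
  have tu: "\<bar>Im t - h\<bar> < width" "cmod u < width" using assms y by auto
  have "cmod (fst (lift (t, u)) - t - of_real \<alpha>) \<le> (1 / 2) / width * cmod u"
  proof (rule Schwarz_lemma_scaled[where f = "\<lambda>u. fst (lift (t, u)) - t - of_real \<alpha>"])
    show "(\<lambda>u. fst (lift (t, u)) - t - of_real \<alpha>) holomorphic_on ball 0 width"
      by (intro holomorphic_intros slice_holomorphic tu)
    show "fst (lift (t, 0)) - t - of_real \<alpha> = 0" by (simp add: lift_axis[OF tu(1)])
    show "cmod (fst (lift (t, z)) - t - of_real \<alpha>) < 1 / 2" if "cmod z < width" for z
      using lift_props(3)[OF collar_liftable[of "(t, z)"]] that tu by simp
  qed (use width_pos tu in auto)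
  also have "\<dots> \<le> cmod u / width" using width_pos by (simp add: field_simps)
  finally show ?thesis by (simp add: y)
qed

definition multiplier :: "complex \<Rightarrow> complex" where
  "multiplier t = deriv (U_component F D \<psi> t) 0"

lemma u_coord_\<psi>:
  assumes "z \<in> D"
  shows "u_coord D \<psi> (\<psi> z) = snd z"
proof -
  obtain t u where z: "z = (t, u)" by (cases z)
  show ?thesis
    unfolding u_coord_def z using assms z \<psi>_eq_iff by (intro the_equality) auto
qed

lemma U_component_eq:
  assumes "(t, u) \<in> collar h width"
  shows "U_component F D \<psi> t u = snd (lift (t, u))"
  using lift_props[OF collar_liftable[OF assms]] u_coord_\<psi>[of "lift (t, u)"]
  by (simp add: U_component_def)

lemma eventually_collar_snd:
  assumes "\<bar>Im t - h\<bar> < width"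
  shows "\<forall>\<^sub>F u in nhds 0. (t, u) \<in> collar h width"
  using width_pos assms
  by (intro eventually_nhds_metric[THEN iffD2] exI[of _ width]) auto

lemma multiplier_eq_deriv:
  assumes "\<bar>Im t - h\<bar> < width"
  shows "multiplier t = deriv (\<lambda>u. snd (lift (t, u))) 0"
  unfolding multiplier_def
  by (intro deriv_cong_ev eventually_mono[OF eventually_collar_snd[OF assms]]) (auto intro: U_component_eq)

lemma has_field_derivative_multiplier:
  assumes "\<bar>Im t - h\<bar> < width"
  shows "((\<lambda>u. snd (lift (t, u))) has_field_derivative multiplier t) (at 0)"
  unfolding multiplier_eq_deriv[OF assms]
  by (rule holomorphic_derivI[OF slice_holomorphic(2)[OF assms] open_ball]) (use width_pos in auto)

text \<open>The first column of the derivative is known since the lift is the rotation on the ring. Only the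
  entry \<open>\<tau>\<close> of the upper right corner remains unspecified; being triangular, such matrices multiply
  without it entering the lower right corner.\<close>

lemma has_derivative_lift_axis:
  assumes t: "\<bar>Im t - h\<bar> < width"
  shows "\<exists>\<tau>. (lift has_derivative (\<lambda>v. (fst v + \<tau> * snd v, multiplier t * snd v))) (at (t, 0))"
proof -
  have c: "(t, 0) \<in> collar h width" using t width_pos by simp
  obtain a b where 1: "((\<lambda>y. fst (lift y)) has_derivative (\<lambda>v. a * fst v + b * snd v)) (at (t, 0))"
    using collar_holomorphic(1)[OF c] by (elim cdiffE)
  obtain p q where 2: "((\<lambda>y. snd (lift y)) has_derivative (\<lambda>v. p * fst v + q * snd v)) (at (t, 0))"
    using collar_holomorphic(2)[OF c] by (elim cdiffE)
  have ax: "((\<lambda>s. (s, 0::complex)) has_derivative (\<lambda>v. (v, 0))) (at t)"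
    by (auto intro!: derivative_eq_intros)
  have ev: "\<forall>\<^sub>F s in nhds t. \<bar>Im s - h\<bar> < width"
    using t by (intro eventually_nhds_in_open[of "{s. \<bar>Im s - h\<bar> < width}", simplified] open_Collect_less continuous_intros)
  have "((\<lambda>s. fst (lift (s, 0))) has_field_derivative a) (at t)"
    using has_derivative_compose[OF ax 1] by (simp add: has_field_derivative_def)
  moreover have "((\<lambda>s. fst (lift (s, 0))) has_field_derivative 1) (at t)"
  proof (subst DERIV_cong_ev[OF refl _ refl])
    show "\<forall>\<^sub>F s in nhds t. fst (lift (s, 0)) = s + of_real \<alpha>"
      using ev by eventually_elim (simp add: lift_axis)
    show "((\<lambda>s. s + of_real \<alpha>) has_field_derivative 1) (at t)" by (auto intro!: derivative_eq_intros)
  qed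
  ultimately have a: "a = 1" by (rule DERIV_unique)
  have "((\<lambda>s. snd (lift (s, 0))) has_field_derivative p) (at t)"
    using has_derivative_compose[OF ax 2] by (simp add: has_field_derivative_def)
  moreover have "((\<lambda>s. snd (lift (s, 0))) has_field_derivative 0) (at t)"
  proof (subst DERIV_cong_ev[OF refl _ refl])
    show "\<forall>\<^sub>F s in nhds t. snd (lift (s, 0)) = 0"
      using ev by eventually_elim (simp add: lift_axis)
  qed simp
  ultimately have p: "p = 0" by (rule DERIV_unique)
  have "((\<lambda>v. (t, v)) has_derivative (\<lambda>h. (0, h))) (at 0)"
    by (auto intro!: derivative_eq_intros)
  from has_derivative_compose[OF this 2] have "((\<lambda>u. snd (lift (t, u))) has_field_derivative q) (at 0)"
    by (simp add: has_field_derivative_def)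
  then have q: "q = multiplier t" using has_field_derivative_multiplier[OF t] by (rule DERIV_unique)
  show ?thesis
    using has_derivative_Pair[OF 1 2] by (auto simp: a p q)
qed

lemma continuous_on_snd_lift:
  assumes "\<bar>Im t - h\<bar> + r < width"
  shows "continuous_on (cball t r \<times> cball 0 r) (\<lambda>y. snd (lift y))"
proof (rule continuous_at_imp_continuous_on, rule ballI)
  fix y assume y: "y \<in> cball t r \<times> cball (0::complex) r"
  have "\<bar>Im (fst y) - Im t\<bar> \<le> cmod (t - fst y)" using abs_Im_le_cmod[of "t - fst y"] by simp
  also have "\<dots> \<le> r" using y by (auto simp: dist_norm)
  finally have "y \<in> collar h width" using y assms by (cases y) auto
  then show "isCont (\<lambda>y. snd (lift y)) y" using collar_holomorphic(2) cdiff_isCont by blast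
qed

lemma snd_lift_close:
  assumes t: "\<bar>Im t - h\<bar> < width" and "e > 0" and r: "r > 0" "\<bar>Im t - h\<bar> + r < width"
  shows "\<forall>\<^sub>F s in nhds t. \<forall>u. cmod u \<le> r \<longrightarrow> cmod (snd (lift (s, u)) - snd (lift (t, u))) < e"
  by (rule uniformly_close_slices[OF continuous_on_snd_lift]) (use assms in auto)

text \<open>Slices \<open>u \<mapsto> U(s, u)\<close> for nearby \<open>s\<close> are uniformly close, hence so are their derivatives at 0, by
  Cauchy's inequality.\<close>

lemma isCont_multiplier:
  assumes t: "\<bar>Im t - h\<bar> < width"
  shows "isCont multiplier t"
  unfolding isCont_def tendsto_iff
proof (intro allI impI)
  fix e :: real assume "e > 0"
  obtain r where r: "r > 0" "\<bar>Im t - h\<bar> + r < width"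
    using t by (intro that[of "(width - \<bar>Im t - h\<bar>) / 2"]) (auto simp: field_simps)
  then have rw: "r < width" by linarith
  have ev: "\<forall>\<^sub>F s in nhds t. \<bar>Im s - h\<bar> < width"
    using t by (intro eventually_nhds_in_open[of "{s. \<bar>Im s - h\<bar> < width}", simplified] open_Collect_less continuous_intros)
  have er: "e * r / 2 > 0" using r \<open>e > 0\<close> by simp
  have "\<forall>\<^sub>F s in nhds t. dist (multiplier s) (multiplier t) < e"
    using ev snd_lift_close[OF t er r]
  proof eventually_elim
    case (elim s)
    let ?g = "\<lambda>u. snd (lift (s, u)) - snd (lift (t, u))"
    have hol: "?g holomorphic_on ball 0 width"
      by (intro holomorphic_intros slice_holomorphic elim t)
    have "(?g has_field_derivative (multiplier s - multiplier t)) (at 0)"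
      by (intro derivative_intros has_field_derivative_multiplier elim t)
    then have "multiplier s - multiplier t = deriv ?g 0" by (simp add: DERIV_imp_deriv)
    moreover have "cmod ((deriv ^^ 1) ?g 0) \<le> fact 1 * (e * r / 2) / r ^ 1"
    proof (rule Cauchy_inequality)
      show "?g holomorphic_on ball 0 r" by (rule holomorphic_on_subset[OF hol]) (use rw in auto)
      show "continuous_on (cball 0 r) ?g"
        by (rule continuous_on_subset[OF holomorphic_on_imp_continuous_on[OF hol]]) (use rw in auto)
      show "cmod (?g x) \<le> e * r / 2" if "cmod (0 - x) = r" for x
        using elim that by (auto intro!: less_imp_le)
    qed (use r in auto)
    ultimately show ?case using r \<open>e > 0\<close> by (simp add: dist_norm)
  qed
  then show "\<forall>\<^sub>F s in at t. dist (multiplier s) (multiplier t) < e"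
    by (auto simp: eventually_at_filter elim: eventually_mono)
qed

text \<open>The estimate \<open>|U(t, u)| < K |u|\<close> holds on a small circle \<open>|u| = r\<close> by the definition of the
  derivative and persists there for nearby \<open>t\<close>; the Schwarz lemma extends it to all \<open>|u| < r\<close>.\<close>

lemma snd_lift_bound:
  assumes t: "\<bar>Im t - h\<bar> < width" and K: "cmod (multiplier t) < K"
  shows "\<forall>\<^sub>F y in nhds (t, 0). cmod (snd (lift y)) \<le> K * cmod (snd y)"
proof -
  define \<eta> where "\<eta> = (K - cmod (multiplier t)) / 3"
  have \<eta>: "\<eta> > 0" using K by (simp add: \<eta>_def)
  let ?U = "\<lambda>t u. snd (lift (t, u))"
  have U0: "?U t 0 = 0" by (simp add: lift_axis[OF t])
  have "((\<lambda>u. ?U t u / u) \<longlongrightarrow> multiplier t) (at 0)"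
    using has_field_derivative_multiplier[OF t] by (simp add: has_field_derivative_iff U0)
  then have "\<forall>\<^sub>F u in at 0. dist (?U t u / u) (multiplier t) < \<eta>"
    using \<eta> by (rule tendstoD)
  then obtain r0 where r0: "r0 > 0" "\<And>u. u \<noteq> 0 \<Longrightarrow> cmod u < r0 \<Longrightarrow> dist (?U t u / u) (multiplier t) < \<eta>"
    by (auto simp: eventually_at)
  obtain r where r: "r > 0" "r < r0" "\<bar>Im t - h\<bar> + r < width"
    using t r0(1) by (intro that[of "min (r0 / 2) ((width - \<bar>Im t - h\<bar>) / 2)"]) (auto simp: min_def field_simps)
  have rw: "r < width" using r by linarith
  have Ut: "cmod (?U t u) \<le> (cmod (multiplier t) + \<eta>) * r" if "cmod u \<le> r" for u
  proof (cases "u = 0")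
    case True
    then show ?thesis using U0 r \<eta> by simp
  next
    case False
    then have "dist (?U t u / u) (multiplier t) < \<eta>" using r0(2) that r by auto
    then have "cmod (?U t u / u) \<le> cmod (multiplier t) + \<eta>"
      using norm_triangle_sub[of "?U t u / u" "multiplier t"] by (simp add: dist_norm)
    then have "cmod (?U t u) \<le> (cmod (multiplier t) + \<eta>) * cmod u"
      using False by (simp add: norm_divide field_simps)
    also have "\<dots> \<le> (cmod (multiplier t) + \<eta>) * r" using that \<eta> by (intro mult_left_mono) auto
    finally show ?thesis .
  qed
  have ev: "\<forall>\<^sub>F s in nhds t. \<bar>Im s - h\<bar> < width"
    using t by (intro eventually_nhds_in_open[of "{s. \<bar>Im s - h\<bar> < width}", simplified] open_Collect_less continuous_intros)
  have evt: "\<forall>\<^sub>F s in nhds t. \<forall>u. cmod u < r \<longrightarrow> cmod (?U s u) \<le> K * cmod u"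
    using ev snd_lift_close[OF t mult_pos_pos[OF \<eta> r(1)] r(1,3)]
  proof eventually_elim
    case (elim s)
    show ?case
    proof (intro allI impI)
      fix u :: complex assume u: "cmod u < r"
      have "cmod (?U s u) \<le> (K * r) / r * cmod u"
      proof (rule Schwarz_lemma_scaled[where f = "?U s"])
        show "?U s holomorphic_on ball 0 r"
          by (rule holomorphic_on_subset[OF slice_holomorphic(2)[OF elim(1)]]) (use rw in auto)
        show "?U s 0 = 0" by (simp add: lift_axis[OF elim(1)])
        show "cmod (?U s z) < K * r" if "cmod z < r" for z
        proof -
          have "cmod (?U s z) \<le> cmod (?U t z) + cmod (?U s z - ?U t z)" by (rule norm_triangle_sub)
          also have "\<dots> < (cmod (multiplier t) + \<eta>) * r + \<eta> * r"
            using Ut[of z] elim(2) that by (intro add_le_less_mono) auto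
          also have "\<dots> \<le> K * r"
          proof -
            have "K - cmod (multiplier t) = 3 * \<eta>" by (simp add: \<eta>_def)
            then have "cmod (multiplier t) + \<eta> + \<eta> \<le> K" using \<eta> by linarith
            then have "(cmod (multiplier t) + \<eta> + \<eta>) * r \<le> K * r" using r by (intro mult_right_mono) auto
            then show ?thesis by (simp add: algebra_simps)
          qed
          finally show ?thesis .
        qed
        show "K * r > 0" using r K by (intro mult_pos_pos) (auto intro: le_less_trans[OF norm_ge_zero])
      qed (use r u in auto)
      then show "cmod (?U s u) \<le> K * cmod u" using r by simp
    qed
  qed
  have "filterlim fst (nhds t) (nhds (t, 0::complex))"
    using tendsto_fst[OF filterlim_ident, of "(t, 0::complex)"] by simp
  from filterlim_iff[THEN iffD1, OF this, rule_format, OF evt]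
  have "\<forall>\<^sub>F y in nhds (t, 0::complex). \<forall>u. cmod u < r \<longrightarrow> cmod (?U (fst y) u) \<le> K * cmod u" .
  moreover have "\<forall>\<^sub>F y in nhds (t, 0::complex). cmod (snd y) < r"
    using r by (intro eventually_nhds_in_open[of "{y. cmod (snd y) < r}", simplified] open_Collect_less continuous_intros) auto
  ultimately show ?thesis by eventually_elim auto
qed

lemma multiplier_periodic:
  assumes t: "\<bar>Im t - h\<bar> < width"
  shows "multiplier (t + 1) = multiplier t"
proof -
  have "\<bar>Im (t + 1) - h\<bar> < width" using t by simp
  then have "multiplier (t + 1) = deriv (\<lambda>u. snd (lift (t + 1, u))) 0" by (rule multiplier_eq_deriv)
  also have "\<dots> = deriv (\<lambda>u. snd (lift (t, u))) 0"
  proof (rule deriv_cong_ev[OF _ refl])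
    show "\<forall>\<^sub>F u in nhds 0. snd (lift (t + 1, u)) = snd (lift (t, u))"
      using eventually_collar_snd[OF t] by eventually_elim (simp add: liftable_shift(2)[OF collar_liftable])
  qed
  finally show ?thesis by (simp add: multiplier_eq_deriv[OF t])
qed

definition expansion :: "real \<Rightarrow> real" where
  "expansion x = cmod (multiplier (Complex x h))"

lemma expansion_nonneg: "expansion x \<ge> 0"
  by (simp add: expansion_def)

lemma expansion_periodic: "expansion (x + 1) = expansion x"
proof -
  have "Complex (x + 1) h = Complex x h + 1" by (simp add: complex_eq_iff)
  then show ?thesis
    using multiplier_periodic[of "Complex x h"] width_pos by (simp add: expansion_def)
qed

lemma expansion_continuous: "continuous_on UNIV expansion"
proof -
  have "isCont (\<lambda>x. Complex x h) x" for x unfolding Complex_eq by (intro continuous_intros)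
  then have "isCont expansion x" for x
    unfolding expansion_def[abs_def]
    by (intro continuous_intros isCont_o2[OF _ isCont_multiplier]) (use width_pos in auto)
  then show ?thesis by (simp add: continuous_at_imp_continuous_on)
qed

lemma transverse_lyapunov_eq:
  "transverse_lyapunov F D \<psi> (Complex 0 h) = ereal_integral unit_measure (\<lambda>x. ln_ereal (expansion x))"
proof -
  have "Complex 0 h + of_real x = Complex x h" for x by (simp add: complex_eq_iff)
  then show ?thesis
    by (simp add: transverse_lyapunov_def expansion_def multiplier_def ln_cmod_eq)
qed

end


section \<open>Negative exponent: attraction and normality\<close>

lemma uniform_limit_Pair:
  assumes "uniform_limit S f l F" "uniform_limit S g m F"
  shows "uniform_limit S (\<lambda>n x. (f n x, g n x)) (\<lambda>x. (l x, m x)) F"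
proof (rule uniform_limitI)
  fix e :: real assume "e > 0"
  then have "\<forall>\<^sub>F n in F. \<forall>x\<in>S. dist (f n x) (l x) < e / 2" "\<forall>\<^sub>F n in F. \<forall>x\<in>S. dist (g n x) (m x) < e / 2"
    using assms[unfolded uniform_limit_iff, rule_format, of "e / 2"] by simp_all
  then show "\<forall>\<^sub>F n in F. \<forall>x\<in>S. dist (f n x, g n x) (l x, m x) < e"
  proof eventually_elim
    case (elim n)
    show ?case
    proof
      fix x assume "x \<in> S"
      have "dist (f n x, g n x) (l x, m x) \<le> dist (f n x) (l x) + dist (g n x) (m x)"
        unfolding dist_Pair_Pair by (rule sqrt_sum_squares_le_sum) auto
      then show "dist (f n x, g n x) (l x, m x) < e" using elim \<open>x \<in> S\<close> by fastforce
    qed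
  qed
qed

text \<open>To be applied to the exponents of a sequence of iterates: the two alternatives lead to limits of
  different kinds.\<close>

lemma nat_sequence_constant_or_divergent:
  fixes m :: "nat \<Rightarrow> nat"
  shows "(\<exists>(r :: nat \<Rightarrow> nat) v. strict_mono r \<and> (\<forall>k. m (r k) = v)) \<or> filterlim m at_top sequentially"
proof (cases "\<exists>v. infinite {k. m k = v}")
  case True
  then obtain v where "infinite {k. m k = v}" by blast
  then show ?thesis using infinite_enumerate[of "{k. m k = v}"] by blast
next
  case False
  have "\<forall>\<^sub>F k in sequentially. N \<le> m k" for N
  proof -
    have "finite (\<Union>v<N. {k. m k = v})" using False by auto
    then have "\<forall>\<^sub>F k in sequentially. k \<notin> (\<Union>v<N. {k. m k = v})"
      unfolding cofinite_eq_sequentially[symmetric] eventually_cofinite not_not Collect_mem_eq .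
    then show ?thesis by eventually_elim (auto simp: not_less)
  qed
  then show ?thesis by (simp add: filterlim_at_top)
qed

context herman_circle
begin

lemma open_image:
  assumes "open S" "S \<subseteq> D"
  shows "open (\<psi> ` S)"
proof (subst open_subopen, rule ballI)
  fix p assume "p \<in> \<psi> ` S"
  then obtain z where z: "z \<in> S" "p = \<psi> z" by blast
  obtain r where r: "r > 0" "ball z r \<subseteq> S" using assms(1) z(1) by (auto simp: open_contains_ball)
  let ?r = "min r (1 / 2)"
  have inj: "inj_on \<psi> (ball z ?r \<inter> D)"
    by (rule inj_on_subset[OF \<psi>_inj_small_ball[of z]]) auto
  have pos: "?r > 0" using r(1) by simp
  show "\<exists>T. open T \<and> p \<in> T \<and> T \<subseteq> \<psi> ` S"
  proof (rule local_holomorphic_inverse[OF open_D \<psi>_immersion subsetD[OF assms(2) z(1)] pos inj])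
    fix N g
    assume N: "open N" "\<psi> z \<in> N" "\<And>p. p \<in> N \<Longrightarrow> g p \<in> D \<and> dist (g p) z < ?r \<and> \<psi> (g p) = p"
    have "N \<subseteq> \<psi> ` S"
    proof
      fix q assume "q \<in> N"
      then have "g q \<in> S" "\<psi> (g q) = q" using N(3)[of q] r(2) by (auto simp: dist_commute)
      then show "q \<in> \<psi> ` S" by force
    qed
    then show ?thesis using N z by blast
  qed
qed

text \<open>The lift is only trusted inside the collar, so orbits are required to stay there.\<close>

lemma iterate_lift:
  assumes "y \<in> D" "\<And>k. k < n \<Longrightarrow> (lift ^^ k) y \<in> collar h width"
  shows "(f ^^ n) (\<psi> y) = \<psi> ((lift ^^ n) y)" "iterate_defined F n (\<psi> y)" "(lift ^^ n) y \<in> D"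
proof -
  have "(f ^^ n) (\<psi> y) = \<psi> ((lift ^^ n) y) \<and> iterate_defined F n (\<psi> y) \<and> (lift ^^ n) y \<in> D"
    using assms(2)
  proof (induction n)
    case 0
    then show ?case using assms(1) by (simp add: iterate_defined_def)
  next
    case (Suc n)
    then have IH: "(f ^^ n) (\<psi> y) = \<psi> ((lift ^^ n) y)" "iterate_defined F n (\<psi> y)" by auto
    have l: "liftable ((lift ^^ n) y)" using Suc.prems[of n] by (intro collar_liftable) simp
    then have "(f ^^ n) (\<psi> y) \<notin> indeterminacy F" using IH by (simp add: liftable_def)
    then have "iterate_defined F (Suc n) (\<psi> y)"
      using IH(2) by (auto simp: iterate_defined_def less_Suc_eq)
    then show ?case using lift_props[OF l] IH(1) by simp
  qed
  then show "(f ^^ n) (\<psi> y) = \<psi> ((lift ^^ n) y)" "iterate_defined F n (\<psi> y)" "(lift ^^ n) y \<in> D" by auto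
qed

lemma circle_in_image:
  assumes "\<delta> > 0"
  shows "ring_circle \<gamma> h \<subseteq> H \<inter> \<psi> ` collar h \<delta>"
proof
  fix p assume "p \<in> ring_circle \<gamma> h"
  then obtain t where t: "Im t = h" "p = \<gamma> t" by (auto simp: ring_circle_def)
  have "p \<in> H" using t line_in_strip H_eq by auto
  moreover have "p = \<psi> (t, 0)" using line_in_D[OF t(1)] t by simp
  moreover have "(t, 0) \<in> collar h \<delta>" using t assms by simp
  ultimately show "p \<in> H \<inter> \<psi> ` collar h \<delta>" by blast
qed

text \<open>One step multiplies \<open>|u|\<close> by about \<open>|\<lambda>|\<close> and the weight by \<open>w(x + \<alpha>) / w(x)\<close>; the weight is chosen
  such that the product of both is at most \<open>exp (m / 2)\<close> on the circle, where \<open>m < 0\<close> is the mean of the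
  truncated logarithm. The weaker factor \<open>exp (m / 4)\<close> then leaves room for a neighborhood.\<close>

lemma contracting_weight:
  assumes neg: "transverse_lyapunov F D \<psi> (Complex 0 h) < 0"
  obtains w :: "real \<Rightarrow> real" and c \<rho> where
    "continuous_on UNIV w" "\<And>x. w (x + 1) = w x" "\<And>x. w x > 0" "0 < c" "c < 1"
    "\<rho> > 0" "\<rho> \<le> width"
    "\<And>y. y \<in> collar h \<rho> \<Longrightarrow>
       w (Re (fst (lift y))) * cmod (snd (lift y)) \<le> c * (w (Re (fst y)) * cmod (snd y))"
proof -
  obtain e m where em: "e > 0" "m < 0" "((\<lambda>x. ln (max (expansion x) e)) has_integral m) {0..1}"
    using negative_log_mean_truncated[OF expansion_continuous expansion_nonneg] neg
    unfolding transverse_lyapunov_eq by blast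
  let ?\<phi> = "\<lambda>x. ln (max (expansion x) e)"
  have "continuous_on UNIV ?\<phi>"
    by (intro continuous_intros expansion_continuous) (use em(1) in \<open>auto simp: max_def\<close>)
  then obtain b where b: "continuous_on UNIV b" "\<And>x. b (x + 1) = b x"
    "\<And>x. ?\<phi> x + b (x + \<alpha>) - b x \<le> m / 2"
    using negative_mean_cohomologous_to_negative[OF irrational _ _ em(3,2)] expansion_periodic by auto
  define w where "w x = exp (b x)" for x
  define c where "c = exp (m / 4)"
  have wpos: "w x > 0" for x by (simp add: w_def)
  have wcont: "continuous_on UNIV w" unfolding w_def[abs_def] by (intro continuous_intros b)
  have wper: "w (x + 1) = w x" for x by (simp add: w_def b)
  have c: "0 < c" "c < 1" using em(2) by (auto simp: c_def)
  have strict: "expansion x * w (x + \<alpha>) < c * w x" for x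
  proof -
    have "expansion x * w (x + \<alpha>) \<le> exp (?\<phi> x) * w (x + \<alpha>)"
      using em(1) wpos[of "x + \<alpha>"] by (intro mult_right_mono) (auto simp: less_max_iff_disj)
    also have "\<dots> = exp (?\<phi> x + b (x + \<alpha>) - b x) * w x"
      by (simp add: w_def exp_add exp_diff)
    also have "\<dots> \<le> exp (m / 2) * w x" using b(3)[of x] wpos[of x] by (intro mult_right_mono) auto
    also have "\<dots> < c * w x" using em(2) wpos[of x] by (simp add: c_def)
    finally show ?thesis .
  qed
  let ?P = "\<lambda>y. y \<in> collar h width \<and>
    w (Re (fst (lift y))) * cmod (snd (lift y)) \<le> c * (w (Re (fst y)) * cmod (snd y))"
  obtain \<rho> where \<rho>: "\<rho> > 0" "\<And>y. y \<in> collar h \<rho> \<Longrightarrow> ?P y"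
  proof (rule periodic_neighborhood_contains_collar[of h ?P])
    fix t :: complex assume t: "Im t = h"
    define x where "x = Re t"
    have tx: "t = Complex x h" using t by (simp add: x_def complex_eq_iff)
    have tw: "\<bar>Im t - h\<bar> < width" using t width_pos by simp
    have "expansion x < c * w x / w (x + \<alpha>)" using strict[of x] wpos by (simp add: pos_less_divide_eq)
    then obtain K where K: "expansion x < K" "K < c * w x / w (x + \<alpha>)" using dense by blast
    then have Kw: "K * w (x + \<alpha>) < c * w x" using wpos by (simp add: pos_less_divide_eq)
    have ev1: "\<forall>\<^sub>F y in nhds (t, 0). cmod (snd (lift y)) \<le> K * cmod (snd y)"
      by (rule snd_lift_bound[OF tw]) (use K in \<open>simp add: expansion_def tx\<close>)
    have collar0: "(t, 0) \<in> collar h width" using tw width_pos by simp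
    have wat: "isCont w z" for z using wcont by (simp add: continuous_on_eq_continuous_at)
    have "isCont (\<lambda>y. w (Re (fst (lift y)))) (t, 0)"
      by (rule isCont_o2[where g = w, OF _ wat]) (intro isCont_Re cdiff_isCont collar_holomorphic collar0)
    moreover have "isCont (\<lambda>y. w (Re (fst y))) (t, 0::complex)"
      by (rule isCont_o2[where g = w, OF _ wat]) (intro isCont_Re continuous_intros)
    ultimately have "isCont (\<lambda>y. c * w (Re (fst y)) - K * w (Re (fst (lift y)))) (t, 0)"
      by (intro continuous_intros)
    from isCont_eventually_in_open[OF this, of "{0<..}"]
    have ev2: "\<forall>\<^sub>F y in nhds (t, 0). c * w (Re (fst y)) - K * w (Re (fst (lift y))) \<in> {0<..}"
      using Kw by (simp add: lift_axis[OF tw] x_def)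
    show "\<forall>\<^sub>F y in nhds (t, 0). ?P y"
      using eventually_nhds_in_open[OF open_collar collar0] ev1 ev2
    proof eventually_elim
      case (elim y)
      have "w (Re (fst (lift y))) * cmod (snd (lift y)) \<le> w (Re (fst (lift y))) * (K * cmod (snd y))"
        using elim(2) wpos by (intro mult_left_mono) (auto intro: less_imp_le)
      also have "\<dots> = (K * w (Re (fst (lift y)))) * cmod (snd y)" by simp
      also have "\<dots> \<le> (c * w (Re (fst y))) * cmod (snd y)"
        using elim(3) by (intro mult_right_mono) auto
      finally show ?case using elim(1) by simp
    qed
  next
    fix t u
    show "?P (t + 1, u) = ?P (t, u)"
    proof (cases "(t, u) \<in> collar h width")
      case True
      have "w (Re s + 1) = w (Re s)" for s by (rule wper)
      then show ?thesis using True liftable_shift(2)[OF collar_liftable[OF True]] by simp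
    qed auto
  qed (blast intro: that)
  show ?thesis
  proof (rule that[of w c "min \<rho> width"])
    show "w (Re (fst (lift y))) * cmod (snd (lift y)) \<le> c * (w (Re (fst y)) * cmod (snd y))"
      if "y \<in> collar h (min \<rho> width)" for y
    proof -
      have "y \<in> collar h \<rho>" using that collar_mono[of "min \<rho> width" \<rho> h] by auto
      then show ?thesis using \<rho>(2) by blast
    qed
  qed (use wcont wper wpos c \<rho>(1) width_pos in auto)
qed

text \<open>Contraction of the weighted norm and control of the \<open>t\<close>-coordinate depend on each other: the former
  holds as long as the orbit is in the collar, and the drift of \<open>Im t\<close> is summable because \<open>|u|\<close>
  decays geometrically. The radius \<open>\<delta>\<close> is chosen such that the sum of all drifts is at most \<open>r / 2\<close>.\<close>

lemma attracted_orbits: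
  assumes neg: "transverse_lyapunov F D \<psi> (Complex 0 h) < 0"
  obtains r \<delta> K L c :: real where "0 < r" "r < width" "0 < \<delta>" "\<delta> \<le> r" "0 < c" "c < 1" "K > 0"
    "\<And>y n. y \<in> collar h \<delta> \<Longrightarrow> (lift ^^ n) y \<in> collar h r"
    "\<And>y n. y \<in> collar h \<delta> \<Longrightarrow> cmod (snd ((lift ^^ n) y)) \<le> K * c ^ n * cmod (snd y)"
    "\<And>y n. y \<in> collar h \<delta> \<Longrightarrow>
       cmod (fst ((lift ^^ Suc n) y) - fst ((lift ^^ n) y) - of_real \<alpha>) \<le> L * c ^ n"
    "\<And>y n. y \<in> collar h \<delta> \<Longrightarrow> cmod (fst ((lift ^^ n) y) - fst y - of_nat n * of_real \<alpha>) \<le> 1"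
proof -
  obtain w c \<rho> where w: "continuous_on UNIV w" "\<And>x. w (x + 1) = w x" "\<And>x. w x > 0"
    and c: "0 < c" "c < 1" and \<rho>: "\<rho> > 0" "\<rho> \<le> width"
    and contr: "\<And>y. y \<in> collar h \<rho> \<Longrightarrow>
       w (Re (fst (lift y))) * cmod (snd (lift y)) \<le> c * (w (Re (fst y)) * cmod (snd y))"
    using contracting_weight[OF neg] by blast
  obtain A where A: "A > 0" "\<And>x. \<bar>w x\<bar> \<le> A" using periodic_bounded[OF w(2,1)] by blast
  have "continuous_on UNIV (\<lambda>x. inverse (w x))"
    by (intro continuous_intros w) (use w(3) in \<open>auto simp: less_imp_neq[THEN not_sym]\<close>)
  then obtain B where B: "B > 0" "\<And>x. \<bar>inverse (w x)\<bar> \<le> B"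
    using periodic_bounded[of "\<lambda>x. inverse (w x)"] w(2) by auto
  \<comment> \<open>The ratio of the largest to the smallest weight is at most \<open>K\<close>.\<close>
  define K where "K = A * B"
  have K: "K > 0" using A B by (simp add: K_def)
  define r where "r = min (\<rho> / 2) 1"
  have r: "0 < r" "r < width" "r < \<rho>" "r \<le> 1" using \<rho> by (auto simp: r_def min_def)
  define \<delta> where "\<delta> = min (r / 2) (min (r / (2 * K)) (r * width * (1 - c) / (2 * K)))"
  have \<delta>: "\<delta> > 0" using r K c width_pos by (simp add: \<delta>_def)
  have \<delta>r: "\<delta> \<le> r / 2" by (simp add: \<delta>_def)
  have \<delta>K: "K * \<delta> < r"
  proof -
    have "\<delta> \<le> r / (2 * K)" by (simp add: \<delta>_def)
    then have "K * \<delta> \<le> r / 2" using K by (simp add: field_simps)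
    then show ?thesis using r by simp
  qed
  define L where "L = K * \<delta> / width"
  have L0: "L \<ge> 0" using K \<delta> width_pos by (simp add: L_def)
  have L: "L / (1 - c) \<le> r / 2"
  proof -
    have "\<delta> \<le> r * width * (1 - c) / (2 * K)" by (simp add: \<delta>_def)
    then have "K * \<delta> \<le> r / 2 * width * (1 - c)" using K by (simp add: field_simps)
    then have "L \<le> r / 2 * (1 - c)" using width_pos by (simp add: L_def pos_divide_le_eq mult_ac)
    then show ?thesis using c by (simp add: pos_divide_le_eq)
  qed
  have geo: "L * (\<Sum>j<n. c ^ j) \<le> r / 2" for n
  proof -
    have "(\<Sum>j<n. c ^ j) = (1 - c ^ n) / (1 - c)" using c by (simp add: sum_gp_strict)
    also have "\<dots> \<le> 1 / (1 - c)" using c by (intro divide_right_mono) auto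
    finally have "L * (\<Sum>j<n. c ^ j) \<le> L * (1 / (1 - c))" using L0 by (rule mult_left_mono)
    then show ?thesis using L by (simp only: times_divide_eq_right mult_1_right)
  qed
  have main: "w (Re (fst ((lift ^^ n) y))) * cmod (snd ((lift ^^ n) y)) \<le> c ^ n * (w (Re (fst y)) * cmod (snd y)) \<and>
      cmod (fst ((lift ^^ n) y) - fst y - of_nat n * of_real \<alpha>) \<le> L * (\<Sum>j<n. c ^ j) \<and>
      (lift ^^ n) y \<in> collar h r \<and> cmod (snd ((lift ^^ n) y)) \<le> K * c ^ n * cmod (snd y) \<and>
      cmod (fst ((lift ^^ Suc n) y) - fst ((lift ^^ n) y) - of_real \<alpha>) \<le> L * c ^ n"
    if y: "y \<in> collar h \<delta>" for y n
  proof (induction n rule: nat_less_induct)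
    case (1 n)
    let ?z = "\<lambda>n. (lift ^^ n) y"
    have sy: "cmod (snd y) < \<delta>" "\<bar>Im (fst y) - h\<bar> < \<delta>" using y by (cases y; auto)+
    have a: "w (Re (fst (?z n))) * cmod (snd (?z n)) \<le> c ^ n * (w (Re (fst y)) * cmod (snd y)) \<and>
      cmod (fst (?z n) - fst y - of_nat n * of_real \<alpha>) \<le> L * (\<Sum>j<n. c ^ j)"
    proof (cases n)
      case (Suc k)
      then have IH: "w (Re (fst (?z k))) * cmod (snd (?z k)) \<le> c ^ k * (w (Re (fst y)) * cmod (snd y))"
        "cmod (fst (?z k) - fst y - of_nat k * of_real \<alpha>) \<le> L * (\<Sum>j<k. c ^ j)"
        "?z k \<in> collar h r" "cmod (fst (?z (Suc k)) - fst (?z k) - of_real \<alpha>) \<le> L * c ^ k"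
        using 1[rule_format, of k] by auto
      have "?z k \<in> collar h \<rho>" using IH(3) collar_mono[of r \<rho> h] r by auto
      from contr[OF this]
      have "w (Re (fst (?z n))) * cmod (snd (?z n)) \<le> c * (w (Re (fst (?z k))) * cmod (snd (?z k)))"
        by (simp add: Suc)
      also have "\<dots> \<le> c * (c ^ k * (w (Re (fst y)) * cmod (snd y)))"
        using IH(1) c by (intro mult_left_mono) auto
      finally have 1: "w (Re (fst (?z n))) * cmod (snd (?z n)) \<le> c ^ n * (w (Re (fst y)) * cmod (snd y))"
        by (simp add: Suc mult_ac)
      have "cmod (fst (?z n) - fst y - of_nat n * of_real \<alpha>)
          \<le> cmod (fst (?z k) - fst y - of_nat k * of_real \<alpha>) + cmod (fst (?z (Suc k)) - fst (?z k) - of_real \<alpha>)"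
        using norm_triangle_ineq[of "fst (?z k) - fst y - of_nat k * of_real \<alpha>" "fst (?z (Suc k)) - fst (?z k) - of_real \<alpha>"]
        by (simp add: Suc algebra_simps)
      also have "\<dots> \<le> L * (\<Sum>j<n. c ^ j)" using IH(2,4) by (simp add: Suc algebra_simps)
      finally show ?thesis using 1 by blast
    qed simp
    have s: "cmod (snd (?z n)) \<le> K * c ^ n * cmod (snd y)"
    proof -
      have "cmod (snd (?z n)) = inverse (w (Re (fst (?z n)))) * (w (Re (fst (?z n))) * cmod (snd (?z n)))"
        using w(3)[of "Re (fst (?z n))"] by simp
      also have "\<dots> \<le> B * (c ^ n * (w (Re (fst y)) * cmod (snd y)))"
      proof (rule mult_mono)
        show "inverse (w (Re (fst (?z n)))) \<le> B" using B(2)[of "Re (fst (?z n))"] by linarith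
      qed (use a B(1) less_imp_le[OF w(3)] in auto)
      also have "\<dots> \<le> B * (c ^ n * (A * cmod (snd y)))"
        using A(2)[of "Re (fst y)"] B(1) c by (intro mult_left_mono mult_right_mono) auto
      finally show ?thesis by (simp add: K_def mult_ac)
    qed
    have cn: "c ^ n \<le> 1" "c ^ n > 0" using c by (auto intro: power_le_one)
    have su: "cmod (snd (?z n)) \<le> K * \<delta> * c ^ n"
    proof -
      have "K * c ^ n * cmod (snd y) \<le> K * c ^ n * \<delta>" using sy K cn by (intro mult_left_mono) auto
      then show ?thesis using s by (simp add: mult_ac)
    qed
    also have "\<dots> \<le> K * \<delta> * 1" using cn K \<delta> by (intro mult_left_mono) auto
    finally have "cmod (snd (?z n)) < r" using \<delta>K by simp
    moreover have "\<bar>Im (fst (?z n)) - h\<bar> < r"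
    proof -
      have "\<bar>Im (fst (?z n)) - Im (fst y)\<bar> \<le> cmod (fst (?z n) - fst y - of_nat n * of_real \<alpha>)"
        using abs_Im_le_cmod[of "fst (?z n) - fst y - of_nat n * of_real \<alpha>"] by simp
      also have "\<dots> \<le> r / 2" using a geo order_trans by blast
      finally show ?thesis using sy \<delta>r by linarith
    qed
    ultimately have z: "?z n \<in> collar h r" by (cases "?z n") auto
    have "?z n \<in> collar h width" using z collar_mono[of r width h] r by auto
    from lift_fst_bound[OF this]
    have "cmod (fst (?z (Suc n)) - fst (?z n) - of_real \<alpha>) \<le> cmod (snd (?z n)) / width" by simp
    also have "\<dots> \<le> L * c ^ n"
      using su width_pos by (simp add: L_def divide_right_mono)
    finally show ?case using a z s by blast
  qed
  show ?thesis
  proof (rule that[of r \<delta> c K L])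
    show "cmod (fst ((lift ^^ n) y) - fst y - of_nat n * of_real \<alpha>) \<le> 1" if "y \<in> collar h \<delta>" for y n
      using main[OF that, of n] geo[of n] r by linarith
    show "(lift ^^ n) y \<in> collar h r"
      "cmod (snd ((lift ^^ n) y)) \<le> K * c ^ n * cmod (snd y)"
      "cmod (fst ((lift ^^ Suc n) y) - fst ((lift ^^ n) y) - of_real \<alpha>) \<le> L * c ^ n"
      if "y \<in> collar h \<delta>" for y n
      using main[OF that, of n] by blast+
  qed (insert r \<delta> \<delta>r c K, linarith+)
qed

text \<open>For normality, the \<open>n\<close>-th iterate of a point with first coordinate \<open>t\<close> is uniformly asymptotic to
  \<open>\<psi> (t + \<theta> + n \<alpha>, 0)\<close>, where \<open>\<theta>\<close> is the total deviation of its orbit from the rotation. Hence a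
  subsequence of iterates along which \<open>n \<alpha>\<close> converges modulo 1 converges uniformly.\<close>

lemma negative_exponent_uniformly_attracting:
  assumes neg: "transverse_lyapunov F D \<psi> (Complex 0 h) < 0"
  shows "\<exists>H0. openin (top_of_set H) H0 \<and> ring_circle \<gamma> h \<subseteq> H0 \<and>
    uniformly_attracting F D \<psi> H0 \<and> H0 \<subseteq> fatou_set F"
proof -
  obtain r \<delta> K L c :: real where r: "0 < r" "r < width" "0 < \<delta>" "\<delta> \<le> r" and c: "0 < c" "c < 1" and "K > 0"
    and stay: "\<And>y n. y \<in> collar h \<delta> \<Longrightarrow> (lift ^^ n) y \<in> collar h r"
    and contract: "\<And>y n. y \<in> collar h \<delta> \<Longrightarrow> cmod (snd ((lift ^^ n) y)) \<le> K * c ^ n * cmod (snd y)"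
    and step: "\<And>y n. y \<in> collar h \<delta> \<Longrightarrow>
       cmod (fst ((lift ^^ Suc n) y) - fst ((lift ^^ n) y) - of_real \<alpha>) \<le> L * c ^ n"
    and drift: "\<And>y n. y \<in> collar h \<delta> \<Longrightarrow> cmod (fst ((lift ^^ n) y) - fst y - of_nat n * of_real \<alpha>) \<le> 1"
    using attracted_orbits[OF neg] by metis
  define V where "V = \<psi> ` collar h \<delta>"
  have sub: "collar h \<delta> \<subseteq> collar h width" "collar h r \<subseteq> collar h width"
    using r by (auto intro!: collar_mono)
  have subD: "collar h \<delta> \<subseteq> D" using sub collar_in_D by blast
  have openV: "open V" unfolding V_def by (rule open_image[OF open_collar subD])
  have iter: "(f ^^ n) (\<psi> y) = \<psi> ((lift ^^ n) y)" "iterate_defined F n (\<psi> y)" "(lift ^^ n) y \<in> D"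
    if "y \<in> collar h \<delta>" for y n
    using iterate_lift[of y n] stay[OF that] sub subD that by blast+
  have "uniformly_attracting F D \<psi> (H \<inter> V)"
  proof -
    obtain n0 where n0: "c ^ n0 < 1 / K" using real_arch_pow_inv[of "1 / K" c] c \<open>K > 0\<close> by auto
    have "c ^ Suc n0 \<le> c ^ n0" using c by (intro power_decreasing) auto
    then have "K * c ^ Suc n0 \<le> K * c ^ n0" using \<open>K > 0\<close> by (intro mult_left_mono) auto
    also have "K * c ^ n0 < 1" using n0 \<open>K > 0\<close> by (simp add: pos_less_divide_eq mult.commute)
    finally have Kc: "K * c ^ Suc n0 < 1" .
    show ?thesis
      unfolding uniformly_attracting_def
    proof (intro exI[of _ V] exI[of _ "Suc n0"] exI[of _ "K * c ^ Suc n0"] conjI ballI)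
      show "V \<subseteq> \<psi> ` D" using subD by (auto simp: V_def)
    next
      fix p assume "p \<in> V"
      then obtain y where y: "y \<in> collar h \<delta>" "p = \<psi> y" by (auto simp: V_def)
      show "iterate_defined F (Suc n0) p" "(f ^^ Suc n0) p \<in> \<psi> ` D"
        using iter[OF y(1), of "Suc n0"] y(2) by auto
      show "cmod (u_coord D \<psi> ((f ^^ Suc n0) p)) \<le> K * c ^ Suc n0 * cmod (u_coord D \<psi> p)"
        unfolding y(2) iter(1)[OF y(1)] u_coord_\<psi>[OF iter(3)[OF y(1)]] u_coord_\<psi>[OF subsetD[OF subD y(1)]]
        by (rule contract[OF y(1)])
    qed (use openV Kc in auto)
  qed
  moreover have "V \<subseteq> fatou_set F"
  proof -
    have "normal_family V (range (\<lambda>n. f ^^ n))"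
      unfolding normal_family_def
    proof (intro allI impI)
      fix s :: "nat \<Rightarrow> cp2 \<Rightarrow> cp2" assume "range s \<subseteq> range (\<lambda>n. f ^^ n)"
      then have "\<forall>k. \<exists>n. s k = f ^^ n" by blast
      then obtain m where m: "\<And>k. s k = f ^^ (m k)" by metis
      have "\<exists>r g. strict_mono r \<and> uniform_limit V (\<lambda>k. s (r k)) g sequentially"
        using nat_sequence_constant_or_divergent[of m]
      proof
        assume "\<exists>(r :: nat \<Rightarrow> nat) v. strict_mono r \<and> (\<forall>k. m (r k) = v)"
        then obtain r :: "nat \<Rightarrow> nat" and v where "strict_mono r" "\<And>k. m (r k) = v" by blast
        then show ?thesis by (intro exI[of _ r] exI[of _ "f ^^ v"]) (simp add: m uniform_limit_const)
      next
        assume div: "filterlim m at_top sequentially"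
        have "\<forall>k. frac (real (m k) * \<alpha>) \<in> {0..1}" by (simp add: frac_lt_1 less_imp_le)
        then obtain \<beta> q where q: "strict_mono q" "((\<lambda>k. frac (real (m k) * \<alpha>)) \<circ> q) \<longlonglongrightarrow> \<beta>"
          using compact_Icc[of 0 "1::real", unfolded compact_def, rule_format, of "\<lambda>k. frac (real (m k) * \<alpha>)"] by blast
        define n where "n k = m (q k)" for k
        have n: "filterlim n at_top sequentially"
          unfolding n_def by (rule filterlim_compose[OF div filterlim_subseq[OF q(1)]])
        have "\<exists>y. y \<in> collar h \<delta> \<and> \<psi> y = p \<and> Re (fst y) \<in> {0..1}" if pV: "p \<in> V" for p
        proof -
          obtain t u where tu: "(t, u) \<in> collar h \<delta>" "p = \<psi> (t, u)" using pV unfolding V_def by fast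
          let ?y = "(t - of_int \<lfloor>Re t\<rfloor>, u)"
          have y: "?y \<in> collar h \<delta>" using tu by simp
          moreover have "\<psi> ?y = p"
            using \<psi>_eq_iff[of "fst ?y" u t u] subsetD[OF subD y] subsetD[OF subD tu(1)] tu(2) by simp
          moreover have "Re (fst ?y) \<in> {0..1}" by (simp; linarith)
          ultimately show ?thesis by blast
        qed
        then obtain Y where Y: "\<And>p. p \<in> V \<Longrightarrow> Y p \<in> collar h \<delta>" "\<And>p. p \<in> V \<Longrightarrow> \<psi> (Y p) = p"
          "\<And>p. p \<in> V \<Longrightarrow> Re (fst (Y p)) \<in> {0..1}" by metis
        \<comment> \<open>Base points are lifted with real part in \<open>[0, 1]\<close>. The drift is at most 1 and the fractional
          part of \<open>n \<alpha>\<close> lies in \<open>[0, 1)\<close>, so all normalized orbit points are in this compact box.\<close>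
        define B where "B = cbox (Complex (-2) (h - r)) (Complex 4 (h + r)) \<times> cball (0::complex) r"
        have B: "compact B" by (simp add: B_def compact_Times)
        have BD: "B \<subseteq> D"
        proof
          fix y assume "y \<in> B"
          then have "y \<in> collar h width" using r by (cases y) (auto simp: B_def in_cbox_complex_iff)
          then show "y \<in> D" by (rule collar_in_D)
        qed
        have uc: "uniformly_continuous_on B \<psi>"
          by (rule compact_uniformly_continuous[OF continuous_on_subset[OF \<psi>_cont BD] B])
        define g where "g j p = fst ((lift ^^ Suc j) (Y p)) - fst ((lift ^^ j) (Y p)) - of_real \<alpha>" for j p
        define \<theta> where "\<theta> p = suminf (\<lambda>j. g j p)" for p
        have "uniform_limit V (\<lambda>n p. \<Sum>j<n. g j p) \<theta> sequentially"
          unfolding \<theta>_def[abs_def]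
        proof (rule Weierstrass_m_test)
          show "norm (g j p) \<le> L * c ^ j" if "p \<in> V" for j p
            using step[OF Y(1)[OF that]] by (simp add: g_def)
          show "summable (\<lambda>j. L * c ^ j)" using c by (intro summable_mult summable_geometric) auto
        qed
        moreover have tele: "(\<Sum>j<n. g j p) = fst ((lift ^^ n) (Y p)) - fst (Y p) - of_nat n * of_real \<alpha>" for n p
          by (induction n) (auto simp: g_def algebra_simps)
        ultimately have ul1: "uniform_limit V (\<lambda>k p. fst ((lift ^^ n k) (Y p)) - fst (Y p) - of_nat (n k) * of_real \<alpha>)
            \<theta> sequentially"
          using n filterlim_compose[of "\<lambda>n. \<lambda>p. \<Sum>j<n. g j p" _ sequentially n sequentially]
          by (simp add: tele)
        have ul2: "uniform_limit V (\<lambda>k p. complex_of_real (frac (real (n k) * \<alpha>))) (\<lambda>p. of_real \<beta>) sequentially"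
        proof (rule uniform_limitI)
          fix e :: real assume "e > 0"
          have "\<forall>\<^sub>F k in sequentially. dist (frac (real (n k) * \<alpha>)) \<beta> < e"
            using tendstoD[OF q(2) \<open>e > 0\<close>] by (simp add: n_def)
          then show "\<forall>\<^sub>F k in sequentially. \<forall>p\<in>V. dist (complex_of_real (frac (real (n k) * \<alpha>))) (of_real \<beta>) < e"
            by eventually_elim (simp add: dist_of_real)
        qed
        have ul3: "uniform_limit V (\<lambda>k p. snd ((lift ^^ n k) (Y p))) (\<lambda>p. 0) sequentially"
        proof (rule uniform_limitI)
          fix e :: real assume "e > 0"
          have "(\<lambda>k. K * c ^ n k * \<delta>) \<longlonglongrightarrow> K * 0 * \<delta>"
            using c by (intro tendsto_intros filterlim_compose[OF LIMSEQ_realpow_zero n]) auto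
          then have "\<forall>\<^sub>F k in sequentially. K * c ^ n k * \<delta> < e"
            using \<open>e > 0\<close> by (intro order_tendstoD(2)[of _ 0]) simp_all
          then show "\<forall>\<^sub>F k in sequentially. \<forall>p\<in>V. dist (snd ((lift ^^ n k) (Y p))) 0 < e"
          proof eventually_elim
            case (elim k)
            show ?case
            proof
              fix p assume p: "p \<in> V"
              have "cmod (snd (Y p)) \<le> \<delta>" using Y(1)[OF p] by (cases "Y p") auto
              then have "K * c ^ n k * cmod (snd (Y p)) \<le> K * c ^ n k * \<delta>"
                using \<open>K > 0\<close> c by (intro mult_left_mono) auto
              then show "dist (snd ((lift ^^ n k) (Y p))) 0 < e"
                using contract[OF Y(1)[OF p], of "n k"] elim by simp
            qed
          qed
        qed
        \<comment> \<open>The orbit point after removing the integer part of \<open>n \<alpha>\<close>, which \<open>\<psi>\<close> does not see.\<close>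
        define X where "X k p = (fst ((lift ^^ n k) (Y p)) - of_int \<lfloor>real (n k) * \<alpha>\<rfloor>, snd ((lift ^^ n k) (Y p)))" for k p
        have "uniform_limit V X (\<lambda>p. (\<theta> p + of_real \<beta> + fst (Y p), 0)) sequentially"
        proof -
          have "fst ((lift ^^ n k) (Y p)) - of_int \<lfloor>real (n k) * \<alpha>\<rfloor>
              = (fst ((lift ^^ n k) (Y p)) - fst (Y p) - of_nat (n k) * of_real \<alpha>)
                + complex_of_real (frac (real (n k) * \<alpha>)) + fst (Y p)" for k p
            by (simp add: frac_def)
          then show ?thesis
            unfolding X_def[abs_def]
            by (simp only:) (intro uniform_limit_Pair uniform_limit_add ul1 ul2 ul3 uniform_limit_const)
        qed
        moreover have XB: "X k p \<in> B" if p: "p \<in> V" for k p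
        proof -
          let ?z = "(lift ^^ n k) (Y p)"
          have "?z \<in> collar h r" by (rule stay[OF Y(1)[OF p]])
          then have 1: "\<bar>Im (fst ?z) - h\<bar> < r" "cmod (snd ?z) < r" by (cases ?z; auto)+
          have "\<bar>Re (fst ?z) - Re (fst (Y p)) - real (n k) * \<alpha>\<bar> \<le> 1"
            using abs_Re_le_cmod[of "fst ?z - fst (Y p) - of_nat (n k) * of_real \<alpha>"] drift[OF Y(1)[OF p], of "n k"] by simp
          moreover have "0 \<le> frac (real (n k) * \<alpha>)" "frac (real (n k) * \<alpha>) < 1" by (auto simp: frac_lt_1)
          ultimately have "-2 \<le> Re (fst ?z) - of_int \<lfloor>real (n k) * \<alpha>\<rfloor>" "Re (fst ?z) - of_int \<lfloor>real (n k) * \<alpha>\<rfloor> \<le> 4"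
            using Y(3)[OF p] unfolding frac_def atLeastAtMost_iff by linarith+
          then show ?thesis using 1 by (auto simp: X_def B_def in_cbox_complex_iff)
        qed
        ultimately have "uniform_limit V (\<lambda>k p. \<psi> (X k p)) (\<lambda>p. \<psi> (\<theta> p + of_real \<beta> + fst (Y p), 0)) sequentially"
          by (intro uniform_limit_compose_uniformly_continuous_on[OF _ uc]) (auto intro: compact_imp_closed[OF B])
        moreover have "\<psi> (X k p) = s (q k) p" if p: "p \<in> V" for k p
        proof -
          let ?z = "(lift ^^ n k) (Y p)"
          have "\<psi> (X k p) = \<psi> ?z"
            using \<psi>_eq_iff[of "fst (X k p)" "snd (X k p)" "fst ?z" "snd ?z"] XB[OF p, of k] BD iter(3)[OF Y(1)[OF p]]
            by (auto simp: X_def)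
          then show ?thesis using iter(1)[OF Y(1)[OF p], of "n k"] Y(2)[OF p] by (simp add: m n_def)
        qed
        ultimately have "uniform_limit V (\<lambda>k. s (q k)) (\<lambda>p. \<psi> (\<theta> p + of_real \<beta> + fst (Y p), 0)) sequentially"
          by (auto elim!: uniform_limit_cong'[THEN iffD1, rotated 2])
        then show ?thesis using q(1) by blast
      qed
      then show "\<exists>r g. strict_mono r \<and>
        (\<forall>K. compact K \<and> K \<subseteq> V \<longrightarrow> uniform_limit K (\<lambda>k. s (r k)) g sequentially)"
        using uniform_limit_on_subset by blast
    qed
    moreover have "\<forall>p\<in>V. \<forall>n. iterate_defined F n p" using iter(2) by (auto simp: V_def)
    ultimately show ?thesis using openV unfolding fatou_set_def by blast
  qed
  moreover have "ring_circle \<gamma> h \<subseteq> H \<inter> V" using circle_in_image[OF r(3)] by (simp add: V_def)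
  ultimately show ?thesis
    using openin_open_Int[OF openV, of H] by blast
qed


section \<open>Positive exponent: failure of normality\<close>

lemma lift_iterate_axis:
  assumes "\<bar>Im t - h\<bar> < width"
  shows "(lift ^^ n) (t, 0) = (t + of_nat n * of_real \<alpha>, 0)"
proof (induction n)
  case (Suc n)
  have "\<bar>Im (t + of_nat n * of_real \<alpha>) - h\<bar> < width" using assms by simp
  from lift_axis[OF this] show ?case using Suc by (simp add: algebra_simps)
qed simp

lemma has_derivative_lift_iterate:
  assumes t: "\<bar>Im t - h\<bar> < width"
  shows "\<exists>\<tau>. (lift ^^ n has_derivative
      (\<lambda>v. (fst v + \<tau> * snd v, (\<Prod>j<n. multiplier (t + of_nat j * of_real \<alpha>)) * snd v))) (at (t, 0))"
proof (induction n)
  case 0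
  have "((\<lambda>y. y) has_derivative (\<lambda>v. v)) (at (t, 0::complex))" by (rule has_derivative_ident)
  then show ?case by (intro exI[of _ 0]) (simp add: id_def)
next
  case (Suc n)
  let ?P = "\<Prod>j<n. multiplier (t + of_nat j * of_real \<alpha>)"
  obtain \<tau> where 1: "(lift ^^ n has_derivative (\<lambda>v. (fst v + \<tau> * snd v, ?P * snd v))) (at (t, 0))"
    using Suc by blast
  have "\<bar>Im (t + of_nat n * of_real \<alpha>) - h\<bar> < width" using t by simp
  from has_derivative_lift_axis[OF this] obtain \<sigma> where
    "(lift has_derivative (\<lambda>v. (fst v + \<sigma> * snd v, multiplier (t + of_nat n * of_real \<alpha>) * snd v))) (at ((lift ^^ n) (t, 0)))"
    unfolding lift_iterate_axis[OF t] by blast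
  from has_derivative_compose[OF 1 this] show ?case
    by (intro exI[of _ "\<tau> + \<sigma> * ?P"]) (simp add: o_def algebra_simps)
qed

text \<open>The chain rule along the orbit \<open>t + j \<alpha>\<close> of the rotation.\<close>

lemma has_derivative_u_coord_iterate:
  assumes t: "\<bar>Im t - h\<bar> < width"
  shows "((\<lambda>u. u_coord D \<psi> ((f ^^ n) (\<psi> (t, u)))) has_field_derivative
    (\<Prod>j<n. multiplier (t + of_nat j * of_real \<alpha>))) (at 0)"
proof -
  let ?P = "\<Prod>j<n. multiplier (t + of_nat j * of_real \<alpha>)"
  obtain \<tau> where 1: "(lift ^^ n has_derivative (\<lambda>v. (fst v + \<tau> * snd v, ?P * snd v))) (at (t, 0))"
    using has_derivative_lift_iterate[OF t] by blast
  have "((\<lambda>v. (t, v)) has_derivative (\<lambda>h. (0, h))) (at 0)"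
    by (auto intro!: derivative_eq_intros)
  from has_derivative_snd[OF has_derivative_compose[OF this 1]]
  have deriv: "((\<lambda>u. snd ((lift ^^ n) (t, u))) has_field_derivative ?P) (at 0)"
    by (simp add: has_field_derivative_def)
  have tD: "(t, 0) \<in> D" by (rule near_axis(2)[OF t])
  have "\<forall>\<^sub>F y in nhds (t, 0). y \<in> D \<and> (\<forall>k\<in>{..<n}. (lift ^^ k) y \<in> collar h width)"
  proof (intro eventually_conj eventually_ball_finite ballI)
    show "\<forall>\<^sub>F y in nhds (t, 0). y \<in> D" by (rule eventually_nhds_in_open[OF open_D tD])
    fix k
    obtain \<sigma> Q where "(lift ^^ k has_derivative (\<lambda>v. (fst v + \<sigma> * snd v, Q * snd v))) (at (t, 0))"
      using has_derivative_lift_iterate[OF t] by blast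
    then have "isCont (lift ^^ k) (t, 0)" by (rule has_derivative_continuous)
    then show "\<forall>\<^sub>F y in nhds (t, 0). (lift ^^ k) y \<in> collar h width"
      by (rule isCont_eventually_in_open[OF _ open_collar])
        (use t width_pos in \<open>simp add: lift_iterate_axis[OF t]\<close>)
  qed simp
  then have "\<forall>\<^sub>F y in nhds (t, 0). u_coord D \<psi> ((f ^^ n) (\<psi> y)) = snd ((lift ^^ n) y)"
  proof eventually_elim
    case (elim y)
    then have "(f ^^ n) (\<psi> y) = \<psi> ((lift ^^ n) y)" "(lift ^^ n) y \<in> D" using iterate_lift[of y n] by auto
    then show ?case by (simp add: u_coord_\<psi>)
  qed
  moreover have "filterlim (\<lambda>u. (t, u)) (nhds (t, 0)) (nhds (0::complex))"
    by (intro tendsto_Pair tendsto_const filterlim_ident)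
  ultimately have ev: "\<forall>\<^sub>F u in nhds 0. u_coord D \<psi> ((f ^^ n) (\<psi> (t, u))) = snd ((lift ^^ n) (t, u))"
    unfolding filterlim_iff by blast
  show ?thesis using DERIV_cong_ev[OF refl ev refl] deriv by simp
qed

lemma hol_cp2_iterate:
  assumes "y \<in> D" "iterate_defined F n (\<psi> y)"
  shows "hol_cp2 (\<lambda>y. (f ^^ n) (\<psi> y)) y"
  using assms(2)
proof (induction n)
  case 0
  then show ?case using hol_\<psi>[OF assms(1)] by simp
next
  case (Suc n)
  then have "hol_cp2 (\<lambda>y. (f ^^ n) (\<psi> y)) y" "(f ^^ n) (\<psi> y) \<notin> indeterminacy F"
    by (auto simp: iterate_defined_def)
  then show ?case using hol_cp2_rat_map[OF rational] by simp
qed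

text \<open>Locally \<open>u_coord\<close> is the second component of a holomorphic inverse of \<open>\<psi>\<close>.\<close>

lemma cdiff_u_coord:
  assumes k: "hol_cp2 k y" "k y \<in> \<psi> ` D"
  shows "cdiff (\<lambda>y. u_coord D \<psi> (k y)) y"
proof -
  obtain z where z: "z \<in> D" "k y = \<psi> z" using k(2) by blast
  show ?thesis
  proof (rule local_holomorphic_inverse[OF open_D \<psi>_immersion z(1) _ \<psi>_inj_small_ball])
    fix N g
    assume N: "open N" "\<psi> z \<in> N" "\<And>p. p \<in> N \<Longrightarrow> g p \<in> D \<and> dist (g p) z < 1 / 2 \<and> \<psi> (g p) = p"
      "\<And>k y. hol_cp2 k y \<Longrightarrow> k y \<in> N \<Longrightarrow>
       cdiff (\<lambda>y. fst (g (k y))) y \<and> cdiff (\<lambda>y. snd (g (k y))) y"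
    have "cdiff (\<lambda>y. snd (g (k y))) y" using N(4)[OF k(1)] N(2) z by simp
    moreover have "\<forall>\<^sub>F x in nhds y. k x \<in> N"
      by (rule isCont_eventually_in_open[OF hol_cp2_isCont[OF k(1)] N(1)]) (use N(2) z in simp)
    then have "\<forall>\<^sub>F x in nhds y. snd (g (k x)) = u_coord D \<psi> (k x)"
      by eventually_elim (metis N(3) u_coord_\<psi>)
    ultimately show ?thesis by (rule cdiff_cong_eventually)
  qed simp
qed

text \<open>A uniform neighborhood, by compactness of the circle.\<close>

lemma circle_neighborhood:
  obtains e where "e > 0" "\<And>p q. p \<in> ring_circle \<gamma> h \<Longrightarrow> dist p q < e \<Longrightarrow> q \<in> \<psi> ` collar h width"
proof -
  have "ring_circle \<gamma> h = (\<lambda>x. \<gamma> (Complex x h)) ` {0..1}"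
  proof
    show "ring_circle \<gamma> h \<subseteq> (\<lambda>x. \<gamma> (Complex x h)) ` {0..1}"
    proof
      fix p assume "p \<in> ring_circle \<gamma> h"
      then obtain t where t: "Im t = h" "p = \<gamma> t" by (auto simp: ring_circle_def)
      have eq: "Complex (frac (Re t)) h - t = of_int (- \<lfloor>Re t\<rfloor>)"
        using t by (simp add: complex_eq_iff frac_def)
      have "\<gamma> (Complex (frac (Re t)) h) = \<gamma> t"
        using \<gamma>_eq_iff[OF line_in_strip line_in_strip, of "Complex (frac (Re t)) h" t] t
        unfolding eq by simp
      then have "p = \<gamma> (Complex (frac (Re t)) h)" using t by simp
      moreover have "frac (Re t) \<in> {0..1}" by (simp add: frac_lt_1 less_imp_le)
      ultimately show "p \<in> (\<lambda>x. \<gamma> (Complex x h)) ` {0..1}" by blast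
    qed
    show "(\<lambda>x. \<gamma> (Complex x h)) ` {0..1} \<subseteq> ring_circle \<gamma> h" by (auto simp: ring_circle_def)
  qed
  moreover have "continuous_on {0..1} (\<lambda>x. \<gamma> (Complex x h))"
    by (rule continuous_on_compose2[OF \<gamma>_cont]) (auto simp: Complex_eq line_in_strip intro!: continuous_intros)
  ultimately have "compact (ring_circle \<gamma> h)" by (simp add: compact_continuous_image)
  moreover have "ring_circle \<gamma> h \<subseteq> \<psi> ` collar h width" using circle_in_image[OF width_pos] by blast
  moreover have "open (\<psi> ` collar h width)" by (rule open_image[OF open_collar]) (use collar_in_D in blast)
  ultimately obtain e where e: "e > 0" "(\<Union>x\<in>ring_circle \<gamma> h. ball x e) \<subseteq> \<psi> ` collar h width"
    using compact_subset_open_imp_ball_epsilon_subset by metis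
  then have "q \<in> \<psi> ` collar h width" if "p \<in> ring_circle \<gamma> h" "dist p q < e" for p q
    using that by (meson UN_I mem_ball subsetD)
  with e(1) show ?thesis by (rule that)
qed

text \<open>A locally uniform limit of iterates is continuous, so the iterates of the subsequence vary by less
  than \<open>e\<close> over a small ball around \<open>(t0, 0)\<close>. The iterates of the center remain on the circle, and
  the \<open>e\<close>-neighborhood of the circle is covered by the coordinates.\<close>

lemma fatou_iterates_stay_near_circle:
  assumes W: "open W" "\<forall>p\<in>W. \<forall>n. iterate_defined F n p" "normal_family W (range (\<lambda>n. f ^^ n))"
    and t0: "Im t0 = h" "\<gamma> t0 \<in> W"
  obtains \<rho> :: real and r :: "nat \<Rightarrow> nat" where "\<rho> > 0" "strict_mono r" "cball (t0, 0) \<rho> \<subseteq> D" "\<psi> ` cball (t0, 0) \<rho> \<subseteq> W"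
    "\<And>k y. y \<in> cball (t0, 0) \<rho> \<Longrightarrow> (f ^^ r k) (\<psi> y) \<in> \<psi> ` collar h width"
proof -
  obtain e where e: "e > 0" "\<And>p q. p \<in> ring_circle \<gamma> h \<Longrightarrow> dist p q < e \<Longrightarrow> q \<in> \<psi> ` collar h width"
    using circle_neighborhood by metis
  have t0w: "\<bar>Im t0 - h\<bar> < width" using t0 width_pos by simp
  have "open (D \<inter> \<psi> -` W)" by (rule continuous_open_preimage[OF \<psi>_cont open_D W(1)])
  moreover have "(t0, 0) \<in> D \<inter> \<psi> -` W" using line_in_D[OF t0(1)] t0 by simp
  ultimately obtain r1 where r1: "r1 > 0" "cball (t0, 0) r1 \<subseteq> D \<inter> \<psi> -` W"
    by (meson open_contains_cball)
  let ?B = "cball (t0, 0::complex) r1"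
  have "compact (\<psi> ` ?B)"
    by (rule compact_continuous_image[OF continuous_on_subset[OF \<psi>_cont]]) (use r1 in auto)
  moreover have "\<psi> ` ?B \<subseteq> W" using r1 by auto
  moreover have "\<exists>r g. strict_mono r \<and>
      (\<forall>K. compact K \<and> K \<subseteq> W \<longrightarrow> uniform_limit K (\<lambda>k. f ^^ r k) g sequentially)"
    using W(3)[unfolded normal_family_def, rule_format, of "\<lambda>n. f ^^ n"] by simp
  then obtain r g where r: "strict_mono r"
    and lim: "\<And>K. compact K \<and> K \<subseteq> W \<Longrightarrow> uniform_limit K (\<lambda>k. f ^^ r k) g sequentially"
    by blast
  with calculation have "uniform_limit (\<psi> ` ?B) (\<lambda>k. f ^^ r k) g sequentially" by blast
  then have ul: "uniform_limit ?B (\<lambda>k y. (f ^^ r k) (\<psi> y)) (\<lambda>y. g (\<psi> y)) sequentially"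
    by (simp add: uniform_limit_iff)
  have "continuous_on ?B (\<lambda>y. (f ^^ n) (\<psi> y))" for n
    using r1 W(2) by (intro continuous_at_imp_continuous_on ballI hol_cp2_isCont hol_cp2_iterate) auto
  then have cont: "continuous_on ?B (\<lambda>y. g (\<psi> y))"
    by (intro uniform_limit_theorem[OF _ ul]) auto
  have c: "(t0, 0) \<in> ?B" and e3: "e / 3 > 0" using r1 e(1) by simp_all
  obtain d where d: "d > 0"
    "\<And>y. y \<in> ?B \<Longrightarrow> dist y (t0, 0) < d \<Longrightarrow> dist (g (\<psi> y)) (g (\<psi> (t0, 0))) < e / 3"
    using cont[unfolded continuous_on_iff, rule_format, OF c e3] by blast
  have "\<forall>\<^sub>F k in sequentially. \<forall>y\<in>?B. dist ((f ^^ r k) (\<psi> y)) (g (\<psi> y)) < e / 3"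
    by (rule uniform_limitD[OF ul]) (use e in simp)
  then obtain k0 where k0: "\<And>k y. k \<ge> k0 \<Longrightarrow> y \<in> ?B \<Longrightarrow> dist ((f ^^ r k) (\<psi> y)) (g (\<psi> y)) < e / 3"
    unfolding eventually_sequentially by blast
  define \<rho> where "\<rho> = min r1 (d / 2)"
  have \<rho>: "\<rho> > 0" "\<rho> < d" "\<rho> \<le> r1" using r1 d by (auto simp: \<rho>_def)
  have sub: "cball (t0, 0) \<rho> \<subseteq> ?B" using \<rho> by auto
  show ?thesis
  proof (rule that[of \<rho> "\<lambda>k. r (k + k0)"])
    show "strict_mono (\<lambda>k. r (k + k0))" using r by (simp add: strict_mono_def)
    fix k and y :: "complex \<times> complex" assume y: "y \<in> cball (t0, 0) \<rho>"
    let ?n = "r (k + k0)"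
    have base: "(f ^^ ?n) (\<psi> (t0, 0)) \<in> ring_circle \<gamma> h"
    proof -
      have "(f ^^ ?n) (\<psi> (t0, 0)) = \<psi> ((lift ^^ ?n) (t0, 0))"
        using t0w width_pos near_axis(2)[OF t0w] by (intro iterate_lift) (simp_all add: lift_iterate_axis[OF t0w])
      also have "\<dots> = \<gamma> (t0 + of_nat ?n * of_real \<alpha>)"
        unfolding lift_iterate_axis[OF t0w] by (rule line_in_D) (simp add: t0)
      finally show ?thesis using t0 by (simp add: ring_circle_def)
    qed
    have yB: "y \<in> ?B" using y sub by blast
    have "dist y (t0, 0) < d" using y \<rho> by (simp add: dist_commute)
    note 1 = d(2)[OF yB this] and 2 = k0[OF _ yB, of "k + k0"] and 3 = k0[OF _ c, of "k + k0"]
    have "dist ((f ^^ ?n) (\<psi> (t0, 0))) ((f ^^ ?n) (\<psi> y))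
        \<le> dist ((f ^^ ?n) (\<psi> (t0, 0))) (g (\<psi> (t0, 0))) + dist (g (\<psi> (t0, 0))) ((f ^^ ?n) (\<psi> y))"
      by (rule dist_triangle)
    also have "dist (g (\<psi> (t0, 0))) ((f ^^ ?n) (\<psi> y))
        \<le> dist (g (\<psi> (t0, 0))) (g (\<psi> y)) + dist (g (\<psi> y)) ((f ^^ ?n) (\<psi> y))"
      by (rule dist_triangle)
    finally have "dist ((f ^^ ?n) (\<psi> (t0, 0))) ((f ^^ ?n) (\<psi> y)) < e"
      using 1 2 3 by (simp add: dist_commute)
    then show "(f ^^ ?n) (\<psi> y) \<in> \<psi> ` collar h width" by (rule e(2)[OF base])
  qed (use \<rho> sub r1 in auto)
qed

text \<open>On a Fatou neighborhood the \<open>u\<close>-coordinate of the iterates would be a bounded holomorphic function of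
  \<open>u\<close> on a disc of fixed radius. Cauchy's inequality then bounds its derivative at 0, which is the
  product of the multipliers along the orbit.\<close>

lemma positive_exponent_julia:
  assumes pos: "transverse_lyapunov F D \<psi> (Complex 0 h) > 0"
  shows "ring_circle \<gamma> h \<subseteq> julia_set F"
proof
  fix p assume p: "p \<in> ring_circle \<gamma> h"
  show "p \<in> julia_set F"
  proof (rule ccontr)
    assume "p \<notin> julia_set F"
    then obtain W where W: "open W" "\<forall>p\<in>W. \<forall>n. iterate_defined F n p"
      "normal_family W (range (\<lambda>n. f ^^ n))" "p \<in> W"
      by (auto simp: julia_set_def fatou_set_def)
    obtain t0 where t0: "Im t0 = h" "p = \<gamma> t0" using p by (auto simp: ring_circle_def)
    obtain \<rho> and r :: "nat \<Rightarrow> nat" where \<rho>: "\<rho> > 0" "strict_mono r" "cball (t0, 0) \<rho> \<subseteq> D" "\<psi> ` cball (t0, 0) \<rho> \<subseteq> W"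
      and stay: "\<And>k y. y \<in> cball (t0, 0) \<rho> \<Longrightarrow> (f ^^ r k) (\<psi> y) \<in> \<psi> ` collar h width"
      using fatou_iterates_stay_near_circle[OF W(1-3) t0(1)] W(4) t0(2) by metis
    define M where "M = width / (\<rho> / 4)"
    have bound: "(\<Prod>j<r k. expansion (x + real j * \<alpha>)) \<le> M" if x: "\<bar>x - Re t0\<bar> < \<rho> / 2" for k x
    proof -
      let ?t = "Complex x h"
      let ?v = "\<lambda>u. u_coord D \<psi> ((f ^^ r k) (\<psi> (?t, u)))"
      have tw: "\<bar>Im ?t - h\<bar> < width" using width_pos by simp
      have near: "(?t, u) \<in> cball (t0, 0) \<rho>" if "cmod u < \<rho> / 2" for u
      proof -
        have "?t - t0 = of_real (x - Re t0)" using t0 by (simp add: complex_eq_iff)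
        then have "dist t0 ?t = \<bar>x - Re t0\<bar>" by (metis dist_commute dist_norm norm_of_real)
        then have "dist (t0, 0) (?t, u) \<le> \<bar>x - Re t0\<bar> + cmod u"
          unfolding dist_Pair_Pair using sqrt_sum_squares_le_sum[of "\<bar>x - Re t0\<bar>" "cmod u"] by simp
        then show ?thesis using x that by simp
      qed
      have hol: "?v holomorphic_on ball 0 (\<rho> / 2)"
        unfolding holomorphic_on_def
      proof
        fix u :: complex assume u: "u \<in> ball 0 (\<rho> / 2)"
        have y: "(?t, u) \<in> cball (t0, 0) \<rho>" using near u by simp
        have "(?t, u) \<in> D" "iterate_defined F (r k) (\<psi> (?t, u))" using y \<rho>(3,4) W(2) by blast+
        from hol_cp2_iterate[OF this] have "cdiff (\<lambda>y. u_coord D \<psi> ((f ^^ r k) (\<psi> y))) (?t, u)"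
          by (rule cdiff_u_coord) (use stay[OF y, of k] collar_in_D in blast)
        from cdiff_field_differentiable_snd[OF this]
        show "?v field_differentiable (at u within ball 0 (\<rho> / 2))" by (rule field_differentiable_at_within)
      qed
      have "cmod ((deriv ^^ 1) ?v 0) \<le> fact 1 * width / (\<rho> / 4) ^ 1"
      proof (rule Cauchy_inequality)
        show "?v holomorphic_on ball 0 (\<rho> / 4)" by (rule holomorphic_on_subset[OF hol]) (use \<rho>(1) in auto)
        show "continuous_on (cball 0 (\<rho> / 4)) ?v"
          by (rule continuous_on_subset[OF holomorphic_on_imp_continuous_on[OF hol]]) (use \<rho>(1) in auto)
        show "cmod (?v u) \<le> width" if "cmod (0 - u) = \<rho> / 4" for u
        proof -
          have "(?t, u) \<in> cball (t0, 0) \<rho>" by (rule near) (use that \<rho>(1) in simp)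
          then obtain z where z: "z \<in> collar h width" "(f ^^ r k) (\<psi> (?t, u)) = \<psi> z" using stay by blast
          then have "?v u = snd z" using u_coord_\<psi>[OF collar_in_D[OF z(1)]] by simp
          then show ?thesis using z(1) by (cases z) auto
        qed
      qed (use \<rho>(1) in auto)
      moreover have "deriv ?v 0 = (\<Prod>j<r k. multiplier (?t + of_nat j * of_real \<alpha>))"
        by (rule DERIV_imp_deriv[OF has_derivative_u_coord_iterate[OF tw]])
      moreover have "multiplier (?t + of_nat j * of_real \<alpha>) = multiplier (Complex (x + real j * \<alpha>) h)" for j
        by (rule arg_cong[of _ _ multiplier]) (simp add: complex_eq_iff)
      ultimately show ?thesis by (simp add: expansion_def M_def prod_norm[symmetric])
    qed
    obtain I where I: "I > 0" "negligible {x. expansion x = 0}" "((\<lambda>x. ln (expansion x)) has_integral I) {0..1}"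
      "(\<lambda>x. \<bar>ln (expansion x)\<bar>) integrable_on {0..1}"
      using positive_log_mean_integrable[OF expansion_continuous expansion_nonneg _ expansion_periodic] pos
      unfolding transverse_lyapunov_eq by metis
    obtain n0 where n0: "\<And>n. n \<ge> n0 \<Longrightarrow>
        \<exists>x. \<bar>x - Re t0\<bar> < \<rho> / 2 \<and> M < (\<Prod>j<n. expansion (x + real j * \<alpha>))"
      using positive_mean_products_unbounded[OF irrational expansion_periodic expansion_continuous expansion_nonneg
          I(2,3,4,1), of "\<rho> / 2"] \<rho>(1) by (metis half_gt_zero)
    have "r n0 \<ge> n0" using \<rho>(2) by (rule strict_mono_imp_increasing)
    then show False using n0[of "r n0"] bound[of _ n0] by (meson not_le)
  qed
qed

end

theorem lemma8p4:
  fixes F :: "3 \<Rightarrow> poly3" and d :: nat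
    and H :: "cp2 set" and h0 h1 :: ereal and \<alpha> :: real and \<gamma> :: "complex \<Rightarrow> cp2"
    and h :: real and D :: "(complex \<times> complex) set" and \<psi> :: "complex \<times> complex \<Rightarrow> cp2"
  assumes "rational_map d F"
    and "herman_ring F H h0 h1 \<alpha> \<gamma>"
    and "h0 < ereal h" and "ereal h < h1"
    and "ring_coordinates H h0 h1 \<gamma> h D \<psi>"
  shows "((\<forall>t. Im t = h \<longrightarrow> transverse_lyapunov F D \<psi> t < 0) \<longrightarrow>
            (\<exists>H0. openin (top_of_set H) H0 \<and> ring_circle \<gamma> h \<subseteq> H0 \<and>
                  uniformly_attracting F D \<psi> H0 \<and> H0 \<subseteq> fatou_set F)) \<and>
         ((\<forall>t. Im t = h \<longrightarrow> transverse_lyapunov F D \<psi> t > 0) \<longrightarrow>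
            ring_circle \<gamma> h \<subseteq> julia_set F)"
proof -
  interpret herman_circle F d H h0 h1 \<alpha> \<gamma> h D \<psi> by unfold_locales (use assms in auto)
  have "Im (Complex 0 h) = h" by simp
  then show ?thesis using negative_exponent_uniformly_attracting positive_exponent_julia by blast
qed

end
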